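(* Let $V_1,V_2$ be $1$-periodic functions on $\mathbb{R}$, put $V(x)=V_1(x)$ for $x\ge 0$ and $V(x)=V_2(x)$ for $x<0$, and let $\lambda<\min\sigma\left(-\frac{d^2}{dx^2}+V\right)$. Let $u_-^{(1)}$ be the Bloch mode decaying at $-\infty$ of $-\frac{d^2}{dx^2}+V_1(x)-\lambda$, let $u_+^{(2)}$ be the Bloch mode decaying at $+\infty$ of $-\frac{d^2}{dx^2}+V_2(x)-\lambda$, and set $$I_1:=\int_{-1}^0\big(V_2(x)-V_1(x)\big)\,u_-^{(1)}(x)^2\,dx,\qquad I_2:=\int_0^1\big(V_1(x)-V_2(x)\big)\,u_+^{(2)}(x)^2\,dx .$$ If both $I_1<0$ and $I_2<0$, then the equation $$-u''+V(x)u-\lambda u=\Gamma(x)|u|^{p-1}u\quad\text{on }\mathbb{R},$$ where $\Gamma(x)=\Gamma_1(x)$ for $x\ge 0$ and $\Gamma(x)=\Gamma_2(x)$ for $x<0$, has a strong ground state irrespectively of the order of the energies $c_1$ and $c_2$ (defined in the context), and thus irrespectively of the choice of $\Gamma_1,\Gamma_2$ and $p$, as long as $\Gamma_1,\Gamma_2$ are $1$-periodic with $\operatorname{ess\,sup}\Gamma_i>0$ for $i=1,2$, and $1<p<\infty$.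
   Context: Bloch modes: $u_-^{(1)}$ is a nontrivial solution of $-u''+(V_1(x)-\lambda)u=0$ on $\mathbb{R}$ of the form $u_-^{(1)}(x)=p_-^{(1)}(x)e^{\kappa_1x}$ with $\kappa_1>0$ and $p_-^{(1)}$ $1$-periodic; $u_+^{(2)}$ is a nontrivial solution of $-u''+(V_2(x)-\lambda)u=0$ on $\mathbb{R}$ of the form $u_+^{(2)}(x)=p_+^{(2)}(x)e^{-\kappa_2x}$ with $\kappa_2>0$ and $p_+^{(2)}$ $1$-periodic. $\sigma(\cdot)$ denotes the spectrum. Strong ground state: a strong ground state of $-u''+V(x)u-\lambda u=\Gamma(x)|u|^{p-1}u$ on $\mathbb{R}$ is a minimizer of the energy $$J(u)=\int_{\mathbb{R}}\tfrac12\big(|u'|^2+(V(x)-\lambda)u^2\big)-\tfrac1{p+1}\Gamma(x)|u|^{p+1}\,dx$$ over the Nehari manifold $$N=\Big\{u\in H^1(\mathbb{R})\setminus\{0\}:\ \int_{\mathbb{R}}|u'|^2+(V(x)-\lambda)u^2-\Gamma(x)|u|^{p+1}\,dx=0\Big\}.$$ Energies: for $i=1,2$, $c_i$ is the energy of a strong ground state of the purely periodic problem $\left(-\frac{d^2}{dx^2}+V_i(x)-\lambda\right)u=\Gamma_i(x)|u|^{p-1}u$ on $\mathbb{R}$ (the same definitions with $V,\Gamma$ replaced by $V_i,\Gamma_i$). *)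

theory Defs
  imports
    "HOL-Analysis.Analysis"
    "HOL-Library.Periodic_Fun"
    "HOL-Probability.Essential_Supremum"
begin

text \<open>
  Elements of the Lebesgue and Sobolev spaces below are honest functions on \<open>\<real>\<close>, not equivalence
  classes; every notion is invariant under changes on null sets, and being nonzero
  means not vanishing almost everywhere.
\<close>

definition Linf :: "(real \<Rightarrow> real) set" where
  "Linf = {f \<in> borel_measurable lebesgue. \<exists>C. AE x in lebesgue. \<bar>f x\<bar> \<le> C}"

definition L2 :: "(real \<Rightarrow> 'a::euclidean_space) set" where
  "L2 = {f \<in> borel_measurable lebesgue. integrable lebesgue (\<lambda>x. (norm (f x))\<^sup>2)}"

definition L2_norm :: "(real \<Rightarrow> 'a::euclidean_space) \<Rightarrow> real" where
  "L2_norm f = sqrt (LINT x|lebesgue. (norm (f x))\<^sup>2)"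

definition locally_integrable :: "(real \<Rightarrow> 'a::euclidean_space) \<Rightarrow> bool" where
  "locally_integrable f \<longleftrightarrow> (\<forall>a b. set_integrable lebesgue {a..b} f)"

text \<open>Weak derivatives, tested against compactly supported \<open>C\<^sup>1\<close> functions \<open>\<phi>\<close>
  with derivative \<open>\<phi>'\<close>.\<close>

definition has_weak_deriv ::
    "(real \<Rightarrow> 'a::euclidean_space) \<Rightarrow> (real \<Rightarrow> 'a) \<Rightarrow> bool" where
  "has_weak_deriv u g \<longleftrightarrow>
     locally_integrable u \<and> locally_integrable g \<and>
     (\<forall>\<phi> \<phi>' :: real \<Rightarrow> real.
        (\<forall>x. (\<phi> has_real_derivative \<phi>' x) (at x)) \<and> continuous_on UNIV \<phi>' \<and>
        bounded {x. \<phi> x \<noteq> 0} \<longrightarrow>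
        (LINT x|lebesgue. \<phi>' x *\<^sub>R u x) = - (LINT x|lebesgue. \<phi> x *\<^sub>R g x))"

text \<open>Some representative of the weak derivative, which is unique up to null sets.\<close>

definition weak_deriv :: "(real \<Rightarrow> 'a::euclidean_space) \<Rightarrow> real \<Rightarrow> 'a" where
  "weak_deriv u = (SOME g. has_weak_deriv u g)"

definition H1 :: "(real \<Rightarrow> 'a::euclidean_space) set" where
  "H1 = {u \<in> L2. \<exists>g\<in>L2. has_weak_deriv u g}"

definition H2 :: "(real \<Rightarrow> 'a::euclidean_space) set" where
  "H2 = {u \<in> H1. weak_deriv u \<in> H1}"

text \<open>The operator \<open>-d\<^sup>2/dx\<^sup>2 + V\<close> in the complex space \<open>L\<^sup>2(\<real>)\<close> with domain \<open>H\<^sup>2(\<real>)\<close>.\<close>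

definition schroedinger_op :: "(real \<Rightarrow> real) \<Rightarrow> (real \<Rightarrow> complex) \<Rightarrow> real \<Rightarrow> complex" where
  "schroedinger_op V u = (\<lambda>x. - weak_deriv (weak_deriv u) x + complex_of_real (V x) * u x)"

text \<open>Applied to the zero right-hand side, the norm estimate contains injectivity.\<close>

definition resolvent_set :: "(real \<Rightarrow> real) \<Rightarrow> complex set" where
  "resolvent_set V =
     {z. (\<forall>f\<in>L2. \<exists>u\<in>H2. AE x in lebesgue. schroedinger_op V u x - z * u x = f x) \<and>
         (\<exists>C. \<forall>u\<in>H2. L2_norm u \<le> C * L2_norm (\<lambda>x. schroedinger_op V u x - z * u x))}"

definition schroedinger_spectrum :: "(real \<Rightarrow> real) \<Rightarrow> complex set" where
  "schroedinger_spectrum V = - resolvent_set V"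

text \<open>Solutions of \<open>-u'' + (V - lam) u = 0\<close> on \<open>\<real>\<close>; as \<open>V\<close> is merely bounded and measurable, the
  derivatives are weak ones and the equation holds almost everywhere.\<close>

definition linear_solution :: "(real \<Rightarrow> real) \<Rightarrow> real \<Rightarrow> (real \<Rightarrow> real) \<Rightarrow> bool" where
  "linear_solution V lam u \<longleftrightarrow>
     (\<exists>v w. has_weak_deriv u v \<and> has_weak_deriv v w \<and>
        (AE x in lebesgue. - w x + (V x - lam) * u x = 0))"

text \<open>Bloch modes \<open>u(x) = p(x) exp(\<mu> x)\<close>: those decaying at \<open>-\<infinity>\<close> have exponent \<open>\<mu> = \<kappa> > 0\<close>,
  those decaying at \<open>+\<infinity>\<close> have exponent \<open>\<mu> = -\<kappa> < 0\<close>.\<close>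

definition bloch_mode :: "(real \<Rightarrow> real) \<Rightarrow> real \<Rightarrow> real \<Rightarrow> (real \<Rightarrow> real) \<Rightarrow> bool" where
  "bloch_mode V lam \<mu> u \<longleftrightarrow>
     linear_solution V lam u \<and> \<not> (AE x in lebesgue. u x = 0) \<and>
     (\<exists>p. periodic_fun_simple' p \<and> (\<forall>x. u x = p x * exp (\<mu> * x)))"

definition interface :: "(real \<Rightarrow> real) \<Rightarrow> (real \<Rightarrow> real) \<Rightarrow> real \<Rightarrow> real" where
  "interface f\<^sub>1 f\<^sub>2 x = (if x \<ge> 0 then f\<^sub>1 x else f\<^sub>2 x)"

definition energy ::
    "(real \<Rightarrow> real) \<Rightarrow> (real \<Rightarrow> real) \<Rightarrow> real \<Rightarrow> real \<Rightarrow> (real \<Rightarrow> real) \<Rightarrow> real" where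
  "energy V \<Gamma> lam p u =
     (LINT x|lebesgue. 1/2 * (\<bar>weak_deriv u x\<bar>\<^sup>2 + (V x - lam) * (u x)\<^sup>2)
                       - 1 / (p + 1) * \<Gamma> x * \<bar>u x\<bar> powr (p + 1))"

definition nehari ::
    "(real \<Rightarrow> real) \<Rightarrow> (real \<Rightarrow> real) \<Rightarrow> real \<Rightarrow> real \<Rightarrow> (real \<Rightarrow> real) set" where
  "nehari V \<Gamma> lam p =
     {u \<in> H1. \<not> (AE x in lebesgue. u x = 0) \<and>
        (LINT x|lebesgue. \<bar>weak_deriv u x\<bar>\<^sup>2 + (V x - lam) * (u x)\<^sup>2
                          - \<Gamma> x * \<bar>u x\<bar> powr (p + 1)) = 0}"

definition strong_ground_state ::
    "(real \<Rightarrow> real) \<Rightarrow> (real \<Rightarrow> real) \<Rightarrow> real \<Rightarrow> real \<Rightarrow> (real \<Rightarrow> real) \<Rightarrow> bool" where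
  "strong_ground_state V \<Gamma> lam p u \<longleftrightarrow>
     u \<in> nehari V \<Gamma> lam p \<and> (\<forall>v \<in> nehari V \<Gamma> lam p. energy V \<Gamma> lam p u \<le> energy V \<Gamma> lam p v)"

end

theory Submission
  imports Defs "HOL-Complex_Analysis.Great_Picard"
begin

text \<open>Since \<open>\<lambda>\<close> lies below the spectrum, a resolvent estimate makes the form \<open>a\<close> of
  \<open>- d\<^sup>2/dx\<^sup>2 + V - \<lambda>\<close> coercive on \<open>H\<^sup>1\<close>. Let \<open>S\<close> be the supremum of \<open>G(u) = \<integral> \<Gamma> |u|\<^sup>p\<^sup>+\<^sup>1\<close> subject to
  \<open>a(u) = 1\<close>; a maximizer becomes a strong ground state after scaling. Shift the members of a maximizing
  sequence by integers so that they do not vanish near the origin. Along a subsequence the weak limit is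
  nonzero and the problem converges to a shift of the interface problem or to one of the two periodic
  problems. As \<open>a\<close> and \<open>G\<close> split asymptotically and \<open>t \<mapsto> t\<^sup>q\<close> is strictly superadditive for
  \<open>q = (p+1)/2 > 1\<close>, the weak limit is a maximizer of the limit problem, again with value \<open>S\<close>.
  In the periodic case, shift this maximizer far away from the interface and replace its small tail by
  a multiple of the Bloch mode. Because \<open>I\<^sub>i < 0\<close>, the result would exceed \<open>S\<close> in the interface problem,
  unless the tail is zero; but then the shifted maximizer already solves the interface problem. This
  needs neither the comparison of \<open>c\<^sub>1\<close> and \<open>c\<^sub>2\<close> nor the asymptotics of periodic ground states.\<close>

subsection \<open>Primitives of locally integrable functions\<close>

text \<open>Everything in the tail step is quadratic in the same two quantities: the coefficient of
  the Bloch mode and the L^2 norm of the difference on the left half-line. The drop of the form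
  controls both squares with fixed positive constants, while the loss in the nonlinear term carries
  the extra factor \<open>sup |w|\<close> over the tail to the power p-1. Moving the profile away
  makes this factor small and leaves the constants of the gain unchanged. Hence no lower bound, sign
  or decay rate of the tail and no Euler-Lagrange equation of the maximizer is involved. The form
  drops by its value at the difference because the mode solves the linear equation and the
  difference vanishes at 0. The further gain is the sum of I_i over all periods of a half-line, a
  geometric series, and so has the sign of I_i. Fixing the value of the form instead of working on
  the Nehari manifold turns optimality into the homogeneous inequality
  \<open>G(u) \<le> S a(u)^q\<close>. It applies to every competitor without projection, and the
  same S can be compared with all three limit problems.\<close>

lemma sigma_finite_lebesgue: "sigma_finite_measure (lebesgue :: real measure)"
proof (rule sigma_finite_measure.intro)
  show "\<exists>A. countable A \<and> A \<subseteq> sets (lebesgue :: real measure) \<and> \<Union> A = space lebesgue \<and> (\<forall>a\<in>A. emeasure lebesgue a \<noteq> \<infinity>)"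
  proof (intro exI[where x="range (\<lambda>n::nat. cball (0::real) (real n))"] conjI ballI)
    have "\<exists>n. x \<in> cball 0 (real n)" for x :: real
      using real_arch_simple[of "\<bar>x\<bar>"] by (simp add: dist_real_def)
    then show "\<Union> (range (\<lambda>n::nat. cball (0::real) (real n))) = space lebesgue" by auto
    fix a assume "a \<in> range (\<lambda>n::nat. cball (0::real) (real n))"
    then show "emeasure lebesgue a \<noteq> \<infinity>"
      using emeasure_compact_finite[OF compact_cball, of "0::real"] by (auto simp: less_top)
  qed auto
qed

interpretation lebesgue_real: sigma_finite_measure "lebesgue :: real measure"
  by (rule sigma_finite_lebesgue)

text \<open>Fubini for two copies of the completed measure is what the integration by parts below
  rests on.\<close>

interpretation lebesgue_real_pair: pair_sigma_finite "lebesgue :: real measure" "lebesgue :: real measure" ..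

text \<open>Absolute continuity in integral form. It singles out the continuous representative of a
  weakly differentiable function, so that point values and cuts at 0 make sense; \<open>g\<close>
  matters only up to null sets.\<close>

definition primitive :: "(real \<Rightarrow> real) \<Rightarrow> (real \<Rightarrow> real) \<Rightarrow> bool" where
  "primitive u g \<longleftrightarrow> locally_integrable g \<and>
     (\<forall>a b. a \<le> b \<longrightarrow> u b - u a = (LINT x:{a..b}|lebesgue. g x))"

lemma primitive_integrable: "primitive u g \<Longrightarrow> set_integrable lebesgue {a..b} g"
  by (simp add: primitive_def locally_integrable_def)

lemma primitive_diff: "primitive u g \<Longrightarrow> a \<le> b \<Longrightarrow> u b - u a = (LINT x:{a..b}|lebesgue. g x)"
  by (simp add: primitive_def)

lemma borel_measurable_lebesgue_continuous:
  fixes f :: "real \<Rightarrow> 'a::{topological_space}"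
  shows "continuous_on UNIV f \<Longrightarrow> f \<in> borel_measurable lebesgue"
  by (rule measurable_completion) (simp add: borel_measurable_continuous_onI)

lemma measurable_ident_lebesgue [measurable]: "(\<lambda>x::real. x) \<in> borel_measurable lebesgue"
  by (rule borel_measurable_lebesgue_continuous) (rule continuous_on_id)

lemma integrable_indicator_Icc: "integrable lebesgue (indicator {a..b} :: real \<Rightarrow> real)"
  by (rule integrable_real_indicator) (auto simp: emeasure_lborel_Icc_eq)

text \<open>Dominated convergence for sets whose membership stabilises at each point; this covers
  growing half-lines as well as tails that shrink to the empty set.\<close>

lemma tendsto_integral_indicator:
  fixes f :: "real \<Rightarrow> real" and A :: "nat \<Rightarrow> real set"
  assumes f: "integrable lebesgue f" and A: "\<And>n. A n \<in> sets lebesgue"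
    and ev: "\<And>x. \<forall>\<^sub>F n in sequentially. x \<in> A n \<longleftrightarrow> x \<in> B"
  shows "(\<lambda>n. LINT x|lebesgue. indicator (A n) x * f x) \<longlonglongrightarrow> (LINT x|lebesgue. indicator B x * f x)"
proof (rule integral_dominated_convergence[where w="\<lambda>x. \<bar>f x\<bar>"])
  have l: "(\<lambda>n. indicator (A n) x * f x) \<longlonglongrightarrow> indicator B x * f x" for x
    by (rule tendsto_eventually) (use ev[of x] in \<open>eventually_elim, simp add: indicator_def\<close>)
  have m: "(\<lambda>x. indicator (A n) x * f x) \<in> borel_measurable lebesgue" for n
    using borel_measurable_integrable[OF f] A by measurable
  show "(\<lambda>x. indicator B x * f x) \<in> borel_measurable lebesgue"
    by (rule borel_measurable_LIMSEQ_real[OF l m])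
  show "(\<lambda>x. indicator (A n) x * f x) \<in> borel_measurable lebesgue" for n by (rule m)
  show "integrable lebesgue (\<lambda>x. \<bar>f x\<bar>)" using f by (rule integrable_abs)
  show "AE x in lebesgue. (\<lambda>n. indicator (A n) x * f x) \<longlonglongrightarrow> indicator B x * f x" by (intro AE_I2 l)
  show "AE x in lebesgue. norm (indicator (A n) x * f x) \<le> \<bar>f x\<bar>" for n
    by (intro AE_I2) (simp add: indicator_def)
qed

lemma primitive_continuous:
  assumes "primitive u g" shows "continuous_on UNIV u"
proof -
  have "isCont u x" for x
  proof -
    have gi: "g integrable_on {x-1..x+1}"
      using primitive_integrable[OF assms] by (rule set_lebesgue_integral_eq_integral(1))
    have c: "continuous_on {x-1..x+1} (\<lambda>y. u (x-1) + integral {x-1..y} g)"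
      by (intro continuous_intros indefinite_integral_continuous_1 gi)
    have "continuous_on {x-1..x+1} u"
      using c
    proof (rule continuous_on_eq)
      fix y assume "y \<in> {x-1..x+1}"
      then show "u (x-1) + integral {x-1..y} g = u y"
        using primitive_diff[OF assms, of "x-1" y]
          set_lebesgue_integral_eq_integral(2)[OF primitive_integrable[OF assms, of "x-1" y]] by auto
    qed
    then show ?thesis
      by (rule continuous_on_interior) auto
  qed
  then show ?thesis by (simp add: continuous_at_imp_continuous_on)
qed

lemma primitive_borel: "primitive u g \<Longrightarrow> u \<in> borel_measurable lebesgue"
  using borel_measurable_lebesgue_continuous primitive_continuous by blast

lemma locally_integrable_borel:
  fixes g :: "real \<Rightarrow> real"
  assumes "locally_integrable g" shows "g \<in> borel_measurable lebesgue"
proof (rule borel_measurable_LIMSEQ_real)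
  show "(\<lambda>x. indicator {-real n..real n} x *\<^sub>R g x) \<in> borel_measurable lebesgue" for n
    using assms unfolding locally_integrable_def set_integrable_def by (simp add: borel_measurable_integrable)
  fix x :: real assume "x \<in> space lebesgue"
  obtain N where N: "\<bar>x\<bar> \<le> real N" using real_arch_simple by blast
  show "(\<lambda>n. indicator {-real n..real n} x *\<^sub>R g x) \<longlonglongrightarrow> g x"
  proof (rule tendsto_eventually, rule eventually_sequentiallyI[of N])
    fix n assume "N \<le> n"
    then have "real N \<le> real n" by simp
    then show "indicator {-real n..real n} x *\<^sub>R g x = g x" using N by (auto simp: indicator_def)
  qed
qed

lemma primitive_borel': "primitive u g \<Longrightarrow> g \<in> borel_measurable lebesgue"
  using locally_integrable_borel primitive_def by blast

lemma set_integrable_mult_bounded: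
  fixes f g :: "real \<Rightarrow> real"
  assumes f: "set_integrable lebesgue A f" and g: "g \<in> borel_measurable lebesgue"
    and A: "A \<in> sets lebesgue" and b: "\<And>x. x \<in> A \<Longrightarrow> \<bar>g x\<bar> \<le> C"
  shows "set_integrable lebesgue A (\<lambda>x. f x * g x)"
  unfolding set_integrable_def
proof (rule Bochner_Integration.integrable_bound)
  show "integrable lebesgue (\<lambda>x. C * (indicator A x *\<^sub>R f x))"
    using f unfolding set_integrable_def by auto
  have 1: "(\<lambda>x. (indicator A x *\<^sub>R f x) * g x) \<in> borel_measurable lebesgue"
    using f g unfolding set_integrable_def by measurable
  show "(\<lambda>x. indicator A x *\<^sub>R (f x * g x)) \<in> borel_measurable lebesgue"
    using 1 by (simp add: mult.assoc)
  show "AE x in lebesgue. norm (indicator A x *\<^sub>R (f x * g x)) \<le> norm (C * (indicator A x *\<^sub>R f x))"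
  proof (rule AE_I2)
    fix x
    show "norm (indicator A x *\<^sub>R (f x * g x)) \<le> norm (C * (indicator A x *\<^sub>R f x))"
    proof (cases "x \<in> A")
      case True
      have "\<bar>f x\<bar> * \<bar>g x\<bar> \<le> \<bar>f x\<bar> * \<bar>C\<bar>" using b[OF True] by (intro mult_left_mono) auto
      then show ?thesis using True by (simp add: abs_mult mult.commute)
    qed auto
  qed
qed

lemma continuous_bounded_interval:
  fixes g :: "real \<Rightarrow> real"
  assumes "continuous_on UNIV g"
  obtains C where "C \<ge> 0" "\<And>x. x \<in> {a..b} \<Longrightarrow> \<bar>g x\<bar> \<le> C"
proof -
  have "compact (g ` {a..b})"
    by (rule compact_continuous_image) (use assms continuous_on_subset in auto)
  then have "bounded (g ` {a..b})" by (rule compact_imp_bounded)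
  then obtain C where "\<And>x. x \<in> {a..b} \<Longrightarrow> \<bar>g x\<bar> \<le> C"
    unfolding bounded_iff by (metis image_eqI real_norm_def)
  then have "\<And>x. x \<in> {a..b} \<Longrightarrow> \<bar>g x\<bar> \<le> \<bar>C\<bar>" by (meson abs_ge_self order_trans)
  then show ?thesis using that[of "\<bar>C\<bar>"] by simp
qed

lemma set_integrable_mult_continuous:
  fixes f g :: "real \<Rightarrow> real"
  assumes "set_integrable lebesgue {a..b} f" "continuous_on UNIV g"
  shows "set_integrable lebesgue {a..b} (\<lambda>x. f x * g x)"
proof -
  obtain C where "\<And>x. x \<in> {a..b} \<Longrightarrow> \<bar>g x\<bar> \<le> C"
    using continuous_bounded_interval[OF assms(2)] by metis
  then show ?thesis
    by (intro set_integrable_mult_bounded[OF assms(1) borel_measurable_lebesgue_continuous[OF assms(2)]]) auto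
qed

text \<open>The product \<open>g' x * f' y\<close> is integrated over the triangle
  \<open>y \<le> x\<close> in both orders; the inner integrals are increments of \<open>f\<close>
  and of \<open>g\<close>.\<close>

lemma integration_by_parts_primitive:
  assumes f: "primitive f f'" and g: "primitive g g'" and ab: "a \<le> b"
  shows "(LINT x:{a..b}|lebesgue. f' x * g x) + (LINT x:{a..b}|lebesgue. g' x * f x) = f b * g b - f a * g a"
proof -
  define F where "F x = indicator {a..b} x * f' x" for x
  define G where "G x = indicator {a..b} x * g' x" for x
  have Fi: "integrable lebesgue F" and Gi: "integrable lebesgue G"
    using primitive_integrable[OF f, of a b] primitive_integrable[OF g, of a b]
    unfolding F_def G_def set_integrable_def by simp_all
  note [measurable] = borel_measurable_integrable[OF Fi] borel_measurable_integrable[OF Gi]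
  let ?P = "\<lambda>x y. G x * F y"
  have PI: "integrable (lebesgue \<Otimes>\<^sub>M lebesgue) (\<lambda>(x,y). ?P x y)"
  proof (rule lebesgue_real_pair.Fubini_integrable)
    show "(\<lambda>(x,y). ?P x y) \<in> borel_measurable (lebesgue \<Otimes>\<^sub>M lebesgue)" by measurable
    show "integrable lebesgue (\<lambda>x. \<integral>y. norm (case (x,y) of (x,y) \<Rightarrow> ?P x y) \<partial>lebesgue)"
      using Fi Gi by (simp add: abs_mult)
    show "AE x in lebesgue. integrable lebesgue (\<lambda>y. case (x,y) of (x,y) \<Rightarrow> ?P x y)"
      using Fi by simp
  qed
  let ?K = "\<lambda>x y. if y \<le> x then G x * F y else 0"
  have meas [measurable]: "fst \<in> borel_measurable ((lebesgue::real measure) \<Otimes>\<^sub>M (lebesgue::real measure))"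
      "snd \<in> borel_measurable ((lebesgue::real measure) \<Otimes>\<^sub>M (lebesgue::real measure))"
    subgoal by (rule measurable_compose[OF measurable_fst measurable_ident_lebesgue])
    subgoal by (rule measurable_compose[OF measurable_snd measurable_ident_lebesgue])
    done
  have KI: "integrable (lebesgue \<Otimes>\<^sub>M lebesgue) (\<lambda>(x,y). ?K x y)"
  proof (rule Bochner_Integration.integrable_bound[OF PI])
    have "(\<lambda>p. if snd p \<le> fst p then G (fst p) * F (snd p) else 0) \<in> borel_measurable (lebesgue \<Otimes>\<^sub>M lebesgue)"
      by measurable
    then show "(\<lambda>(x,y). ?K x y) \<in> borel_measurable (lebesgue \<Otimes>\<^sub>M lebesgue)"
      by (simp add: case_prod_beta)
    show "AE p in lebesgue \<Otimes>\<^sub>M lebesgue. norm (case p of (x,y) \<Rightarrow> ?K x y) \<le> norm (case p of (x,y) \<Rightarrow> ?P x y)"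
      by auto
  qed
  have inner1: "(\<integral>y. ?K x y \<partial>lebesgue) = G x * (f x - f a)" for x
  proof (cases "x \<in> {a..b}")
    case True
    have "(\<integral>y. ?K x y \<partial>lebesgue) = (\<integral>y. G x * (indicator {a..x} y *\<^sub>R f' y) \<partial>lebesgue)"
      by (rule Bochner_Integration.integral_cong) (use True in \<open>auto simp: F_def indicator_def\<close>)
    also have "\<dots> = G x * (LINT y:{a..x}|lebesgue. f' y)"
      unfolding set_lebesgue_integral_def by simp
    also have "\<dots> = G x * (f x - f a)"
      using primitive_diff[OF f, of a x] True by simp
    finally show ?thesis .
  next
    case False
    then have "G x = 0" by (simp add: G_def)
    then show ?thesis by (simp cong: if_cong)
  qed
  have inner2: "(\<integral>x. ?K x y \<partial>lebesgue) = F y * (g b - g y)" for y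
  proof (cases "y \<in> {a..b}")
    case True
    have "(\<integral>x. ?K x y \<partial>lebesgue) = (\<integral>x. F y * (indicator {y..b} x *\<^sub>R g' x) \<partial>lebesgue)"
      by (rule Bochner_Integration.integral_cong) (use True in \<open>auto simp: G_def indicator_def\<close>)
    also have "\<dots> = F y * (LINT x:{y..b}|lebesgue. g' x)"
      unfolding set_lebesgue_integral_def by simp
    also have "\<dots> = F y * (g b - g y)"
      using primitive_diff[OF g, of y b] True by simp
    finally show ?thesis .
  next
    case False
    then have "F y = 0" by (simp add: F_def)
    then show ?thesis by (simp cong: if_cong)
  qed
  have eq: "(\<integral>x. G x * (f x - f a) \<partial>lebesgue) = (\<integral>y. F y * (g b - g y) \<partial>lebesgue)"
    using lebesgue_real_pair.Fubini_integral[OF KI] by (simp add: inner1 inner2)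
  have i1: "integrable lebesgue (\<lambda>x. G x * f x)" "integrable lebesgue (\<lambda>x. F x * g x)"
    using set_integrable_mult_continuous[OF primitive_integrable[OF g, of a b] primitive_continuous[OF f]]
      set_integrable_mult_continuous[OF primitive_integrable[OF f, of a b] primitive_continuous[OF g]]
    unfolding set_integrable_def F_def G_def by (simp_all add: mult.assoc)
  have "(\<integral>x. G x * (f x - f a) \<partial>lebesgue) = (\<integral>x. G x * f x \<partial>lebesgue) - (\<integral>x. G x \<partial>lebesgue) * f a"
    using i1 Gi by (simp add: right_diff_distrib)
  moreover have "(\<integral>y. F y * (g b - g y) \<partial>lebesgue) = (\<integral>x. F x \<partial>lebesgue) * g b - (\<integral>x. F x * g x \<partial>lebesgue)"
    using i1 Fi by (simp add: right_diff_distrib)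
  moreover have "(\<integral>x. G x \<partial>lebesgue) = g b - g a" "(\<integral>x. F x \<partial>lebesgue) = f b - f a"
    using primitive_diff[OF g ab] primitive_diff[OF f ab]
    unfolding G_def F_def set_lebesgue_integral_def by simp_all
  moreover have "(LINT x:{a..b}|lebesgue. f' x * g x) = (\<integral>x. F x * g x \<partial>lebesgue)"
     "(LINT x:{a..b}|lebesgue. g' x * f x) = (\<integral>x. G x * f x \<partial>lebesgue)"
    unfolding G_def F_def set_lebesgue_integral_def by (simp_all add: mult.assoc)
  ultimately show ?thesis using eq by (simp add: algebra_simps)
qed

lemma primitive_mult:
  assumes f: "primitive f f'" and g: "primitive g g'"
  shows "primitive (\<lambda>x. f x * g x) (\<lambda>x. f' x * g x + g' x * f x)"
proof -
  have i: "set_integrable lebesgue {a..b} (\<lambda>x. f' x * g x)" "set_integrable lebesgue {a..b} (\<lambda>x. g' x * f x)" for a b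
    using f g by (blast intro: set_integrable_mult_continuous primitive_integrable primitive_continuous)+
  show ?thesis
    unfolding primitive_def locally_integrable_def
    using i integration_by_parts_primitive[OF f g] by (auto simp: set_integral_add)
qed

lemma primitive_C1:
  assumes d: "\<And>x. (\<phi> has_real_derivative \<phi>' x) (at x)" and c: "continuous_on UNIV \<phi>'"
  shows "primitive \<phi> \<phi>'"
proof -
  have i: "set_integrable lebesgue {a..b} \<phi>'" for a b
    by (rule absolutely_integrable_continuous_real) (use c continuous_on_subset in blast)
  have "\<phi> b - \<phi> a = (LINT x:{a..b}|lebesgue. \<phi>' x)" if "a \<le> b" for a b
  proof -
    have "(\<phi>' has_integral (\<phi> b - \<phi> a)) {a..b}"
      by (rule fundamental_theorem_of_calculus[OF that])
        (use d in \<open>auto simp: has_real_derivative_iff_has_vector_derivative[symmetric] intro: has_field_derivative_at_within\<close>)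
    then show ?thesis
      by (simp add: set_lebesgue_integral_eq_integral(2)[OF i] integral_unique)
  qed
  then show ?thesis using i by (simp add: primitive_def locally_integrable_def)
qed

section \<open>Existence of primitives; compactly supported integrands\<close>

lemma primitive_exists:
  assumes "locally_integrable g"
  obtains F where "primitive F g"
proof -
  define F where "F x = (if 0 \<le> x then integral {0..x} g else - integral {x..0} g)" for x
  have i: "set_integrable lebesgue {a..b} g" for a b
    using assms by (simp add: locally_integrable_def)
  then have io: "g integrable_on {a..b}" for a b
    by (rule set_lebesgue_integral_eq_integral(1))
  have "F b - F a = integral {a..b} g" if "a \<le> b" for a b
  proof -
    consider "0 \<le> a" | "a < 0" "0 \<le> b" | "b < 0" using that by linarith
    then show ?thesis
    proof cases
      case 1
      then show ?thesis using Henstock_Kurzweil_Integration.integral_combine[OF 1 that io] that by (simp add: F_def)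
    next
      case 2
      then show ?thesis using Henstock_Kurzweil_Integration.integral_combine[of a 0 b, OF _ _ io] by (simp add: F_def)
    next
      case 3
      then show ?thesis using Henstock_Kurzweil_Integration.integral_combine[OF that, of 0 g, OF _ io] that by (simp add: F_def)
    qed
  qed
  then have "primitive F g"
    unfolding primitive_def using assms set_lebesgue_integral_eq_integral(2)[OF i] by simp
  then show ?thesis by (rule that)
qed

lemma locally_integrable_continuous:
  fixes f :: "real \<Rightarrow> real"
  assumes "continuous_on UNIV f" shows "locally_integrable f"
  unfolding locally_integrable_def
  by (intro allI absolutely_integrable_continuous_real continuous_on_subset[OF assms]) auto

lemma primitive_has_derivative:
  assumes p: "primitive F f" and c: "continuous_on UNIV f"
  shows "(F has_real_derivative f x) (at x)"
proof -
  have c': "continuous_on {x-1..x+1} f" using c continuous_on_subset by blast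
  have "((\<lambda>y. F (x-1) + integral {x-1..y} f) has_real_derivative f x) (at x within {x-1..x+1})"
    using DERIV_add[OF DERIV_const integral_has_real_derivative[OF c', of x]] by simp
  then have "(F has_real_derivative f x) (at x within {x-1..x+1})"
  proof (rule has_field_derivative_transform_within[OF _ zero_less_one])
    fix y assume "y \<in> {x-1..x+1}"
    then show "F (x-1) + integral {x-1..y} f = F y"
      using primitive_diff[OF p, of "x-1" y]
        set_lebesgue_integral_eq_integral(2)[OF primitive_integrable[OF p, of "x-1" y]] by auto
  qed auto
  moreover have "at x within {x-1..x+1} = at x"
    by (rule at_within_interior) auto
  ultimately show ?thesis by simp
qed

lemma antiderivative_exists:
  fixes f :: "real \<Rightarrow> real"
  assumes "continuous_on UNIV f"
  obtains F where "\<And>x. (F has_real_derivative f x) (at x)"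
  using primitive_exists[OF locally_integrable_continuous[OF assms]] primitive_has_derivative[OF _ assms]
  by metis

lemma compact_support_integral:
  fixes f :: "real \<Rightarrow> real"
  assumes "\<And>x. x \<notin> {a..b} \<Longrightarrow> f x = 0"
  shows "(LINT x|lebesgue. f x) = (LINT x:{a..b}|lebesgue. f x)"
  unfolding set_lebesgue_integral_def
  by (rule Bochner_Integration.integral_cong) (use assms in \<open>auto simp: indicator_def\<close>)

lemma compact_support_integrable:
  fixes f g :: "real \<Rightarrow> real"
  assumes f: "locally_integrable f" and g: "continuous_on UNIV g"
    and z: "\<And>x. x \<notin> {a..b} \<Longrightarrow> g x = 0"
  shows "integrable lebesgue (\<lambda>x. g x * f x)"
proof -
  have "set_integrable lebesgue {a..b} (\<lambda>x. f x * g x)"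
    using f by (intro set_integrable_mult_continuous g) (simp add: locally_integrable_def)
  moreover have "(\<lambda>x. indicator {a..b} x *\<^sub>R (f x * g x)) = (\<lambda>x. g x * f x)"
    using z by (intro ext) (auto simp: indicator_def)
  ultimately show ?thesis unfolding set_integrable_def by simp
qed

subsection \<open>Test functions and weak derivatives\<close>

text \<open>If \<open>f\<close> were positive on a set of positive measure, inner regularity would
  give a closed subset of positive measure, and continuous functions decreasing to its indicator
  would be tests with a positive limit.\<close>

lemma AE_nonpos_of_test:
  fixes f :: "real \<Rightarrow> real"
  assumes f: "locally_integrable f"
    and t: "\<And>\<psi> R. continuous_on UNIV \<psi> \<Longrightarrow> (\<And>x. 0 \<le> \<psi> x) \<Longrightarrow> (\<And>x. x \<notin> {-R..R} \<Longrightarrow> \<psi> x = 0)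
        \<Longrightarrow> (LINT x|lebesgue. \<psi> x * f x) \<le> 0"
  shows "AE x in lebesgue. f x \<le> 0"
proof -
  have fm [measurable]: "f \<in> borel_measurable lebesgue" using locally_integrable_borel[OF f] .
  have "AE x in lebesgue. x \<in> {-real n..real n} \<longrightarrow> f x \<le> 0" for n
  proof (rule ccontr)
    define A where "A = {x \<in> {-real n..real n}. 0 < f x}"
    assume neg: "\<not> (AE x in lebesgue. x \<in> {-real n..real n} \<longrightarrow> f x \<le> 0)"
    have Am: "A \<in> sets lebesgue"
    proof -
      have "{x \<in> space lebesgue. 0 < f x} \<in> sets lebesgue" by measurable
      moreover have "{-real n..real n} \<in> sets lebesgue" by simp
      ultimately have "{-real n..real n} \<inter> {x \<in> space lebesgue. 0 < f x} \<in> sets lebesgue" by (rule sets.Int[rotated])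
      moreover have "{-real n..real n} \<inter> {x \<in> space lebesgue. 0 < f x} = A" by (auto simp: A_def)
      ultimately show ?thesis by metis
    qed
    have A0: "emeasure lebesgue A \<noteq> 0"
    proof
      assume "emeasure lebesgue A = 0"
      then have "A \<in> null_sets lebesgue" using Am by auto
      then have "AE x in lebesgue. x \<notin> A" by (rule AE_not_in)
      then have "AE x in lebesgue. x \<in> {-real n..real n} \<longrightarrow> f x \<le> 0"
        by eventually_elim (auto simp: A_def)
      then show False using neg by blast
    qed
    have Af: "A \<in> lmeasurable"
      by (rule bounded_set_imp_lmeasurable) (use Am in \<open>auto simp: A_def intro: bounded_subset[OF bounded_closed_interval]\<close>)
    then have mA: "0 < measure lebesgue A"
      using A0 by (simp add: emeasure_eq_measure2 zero_less_measure_iff)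
    \<comment> \<open>The part cut away has measure below that of \<open>A\<close>, so
      \<open>C\<close> is not null.\<close>
    then obtain C where C: "closed C" "C \<subseteq> A" "A - C \<in> lmeasurable" "emeasure lebesgue (A - C) < ennreal (measure lebesgue A)"
      using sets_lebesgue_inner_closed[OF Am mA] by blast
    have Cm: "C \<in> sets lebesgue" using C(1) by auto
    have C0: "emeasure lebesgue C \<noteq> 0"
    proof
      assume "emeasure lebesgue C = 0"
      then have "emeasure lebesgue A \<le> emeasure lebesgue (A - C)"
        using emeasure_subadditive[of C lebesgue "A - C"] Cm C(2) C(3)
        by (metis Un_Diff_cancel add_0 fmeasurableD sup.absorb2)
      also have "\<dots> < emeasure lebesgue A" using C(4) Af by (simp add: emeasure_eq_measure2)
      finally show False by simp
    qed
    then have Cne: "C \<noteq> {}" by auto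
    define \<psi> where "\<psi> k x = max 0 (1 - real k * infdist x C)" for k x
    have pc: "continuous_on UNIV (\<psi> k)" for k
      unfolding \<psi>_def by (intro continuous_intros)
    \<comment> \<open>The index starts at 1 because \<open>\<psi> 0\<close> is constantly 1; from
      then on the support stays within distance 1 of \<open>C\<close>.\<close>
    have p0: "\<psi> (Suc k) x = 0" if "x \<notin> {-(real n+1)..real n+1}" for k x
    proof -
      have "1 \<le> infdist x C"
      proof -
        have "1 \<le> dist x y" if "y \<in> C" for y
          using \<open>x \<notin> _\<close> that C(2) by (force simp: A_def dist_real_def abs_if)
        then show ?thesis using Cne infdist_attains_inf[OF C(1) Cne, of x] by metis
      qed
      then have "1 * 1 \<le> real (Suc k) * infdist x C" by (intro mult_mono) auto
      then show ?thesis by (simp add: \<psi>_def)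
    qed
    have pb: "\<bar>\<psi> k x\<bar> \<le> 1" for k x by (simp add: \<psi>_def infdist_nonneg)
    have lim: "(\<lambda>k. \<psi> (Suc k) x) \<longlonglongrightarrow> indicator C x" for x
    proof (cases "x \<in> C")
      case True then show ?thesis by (simp add: \<psi>_def)
    next
      case False
      then have d: "infdist x C > 0" using C(1) Cne
        by (metis in_closed_iff_infdist_zero infdist_nonneg less_eq_real_def)
      obtain N where N: "1 < real N * infdist x C" using reals_Archimedean3[OF d] by blast
      have "\<psi> (Suc k) x = 0" if "N \<le> k" for k
      proof -
        have "real N * infdist x C \<le> real (Suc k) * infdist x C"
          using that d by (intro mult_right_mono) auto
        then show ?thesis using N by (simp add: \<psi>_def)
      qed
      then show ?thesis using False by (auto intro!: tendsto_eventually eventually_sequentiallyI[of N])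
    qed
    have ndom: "integrable lebesgue (\<lambda>x. indicator {-(real n+1)..real n+1} x *\<^sub>R \<bar>f x\<bar>)"
      using f set_integrable_abs unfolding locally_integrable_def set_integrable_def by blast
    have lim2: "(\<lambda>k. LINT x|lebesgue. \<psi> (Suc k) x * f x) \<longlonglongrightarrow> (LINT x|lebesgue. indicator C x * f x)"
    proof (rule integral_dominated_convergence[OF _ _ ndom])
      show "(\<lambda>x. indicator C x * f x) \<in> borel_measurable lebesgue" using Cm by measurable
      show "(\<lambda>x. \<psi> (Suc k) x * f x) \<in> borel_measurable lebesgue" for k
        using borel_measurable_lebesgue_continuous[OF pc] by measurable
      show "AE x in lebesgue. (\<lambda>k. \<psi> (Suc k) x * f x) \<longlonglongrightarrow> indicator C x * f x"
        by (intro AE_I2 tendsto_mult lim tendsto_const)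
      show "AE x in lebesgue. norm (\<psi> (Suc k) x * f x) \<le> indicator {-(real n+1)..real n+1} x *\<^sub>R \<bar>f x\<bar>" for k
      proof (rule AE_I2)
        fix x
        show "norm (\<psi> (Suc k) x * f x) \<le> indicator {-(real n+1)..real n+1} x *\<^sub>R \<bar>f x\<bar>"
          using p0[of x k] mult_right_mono[OF pb[of "Suc k" x], of "\<bar>f x\<bar>"]
          by (cases "x \<in> {-(real n+1)..real n+1}") (auto simp: abs_mult)
      qed
    qed
    have "(LINT x|lebesgue. \<psi> (Suc k) x * f x) \<le> 0" for k
      by (rule t[OF pc _ p0]) (auto simp: \<psi>_def)
    then have le0: "(LINT x|lebesgue. indicator C x * f x) \<le> 0"
      using LIMSEQ_le_const2[OF lim2] by blast
    have nn: "AE x in lebesgue. 0 \<le> indicator C x * f x"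
      using C(2) by (intro AE_I2) (auto simp: A_def indicator_def)
    have ic: "integrable lebesgue (\<lambda>x. indicator C x * f x)"
    proof (rule Bochner_Integration.integrable_bound[OF ndom])
      show "(\<lambda>x. indicator C x * f x) \<in> borel_measurable lebesgue" using Cm by measurable
      show "AE x in lebesgue. norm (indicator C x * f x) \<le> norm (indicator {-(real n+1)..real n+1} x *\<^sub>R \<bar>f x\<bar>)"
        using C(2) by (intro AE_I2) (auto simp: A_def indicator_def)
    qed
    have "AE x in lebesgue. indicator C x * f x = 0"
      using integral_nonneg_eq_0_iff_AE[OF ic nn] le0 integral_nonneg_AE[OF nn] by linarith
    then have "AE x in lebesgue. x \<notin> C"
      by eventually_elim (use C(2) in \<open>auto simp: A_def indicator_def split: if_splits\<close>)
    then have "C \<in> null_sets lebesgue" using Cm AE_iff_null_sets by blast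
    then show False using C0 by auto
  qed
  then have "AE x in lebesgue. \<forall>n. x \<in> {-real n..real n} \<longrightarrow> f x \<le> 0"
    by (subst AE_all_countable) blast
  then show ?thesis
  proof eventually_elim
    fix x assume *: "\<forall>n. x \<in> {-real n..real n} \<longrightarrow> f x \<le> 0"
    obtain n where "\<bar>x\<bar> \<le> real n" using real_arch_simple by blast
    then show "f x \<le> 0" using * by (auto simp: abs_le_iff)
  qed
qed

lemma AE_zero_of_test:
  fixes f :: "real \<Rightarrow> real"
  assumes f: "locally_integrable f"
    and t: "\<And>\<psi> R. continuous_on UNIV \<psi> \<Longrightarrow> (\<And>x. x \<notin> {-R..R} \<Longrightarrow> \<psi> x = 0)
        \<Longrightarrow> (LINT x|lebesgue. \<psi> x * f x) = 0"
  shows "AE x in lebesgue. f x = 0"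
proof -
  have "AE x in lebesgue. f x \<le> 0"
    using t by (intro AE_nonpos_of_test f) (metis order_refl)
  moreover have "AE x in lebesgue. - f x \<le> 0"
  proof (rule AE_nonpos_of_test)
    show "locally_integrable (\<lambda>x. - f x)" using f unfolding locally_integrable_def set_integrable_def by simp
    show "(LINT x|lebesgue. \<psi> x * - f x) \<le> 0"
      if "continuous_on UNIV \<psi>" "\<And>x. x \<notin> {-R..R} \<Longrightarrow> \<psi> x = 0" for \<psi> R
      using t[OF that] by simp
  qed
  ultimately show ?thesis by eventually_elim simp
qed

text \<open>The witness \<open>\<phi> n x\<close> is the average of \<open>\<psi>\<close> over \<open>{x..x + 1/(n+1)}\<close>.\<close>

lemma mollify:
  fixes \<psi> :: "real \<Rightarrow> real"
  assumes c: "continuous_on UNIV \<psi>" and z: "\<And>x. x \<notin> {-R..R} \<Longrightarrow> \<psi> x = 0"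
  obtains \<phi> \<phi>' :: "nat \<Rightarrow> real \<Rightarrow> real"
  where "\<And>n x. (\<phi> n has_real_derivative \<phi>' n x) (at x)" "\<And>n. continuous_on UNIV (\<phi>' n)"
    "\<And>n x. x \<notin> {-R-1..R+1} \<Longrightarrow> \<phi> n x = 0" "\<And>n x. x \<notin> {-R-1..R+1} \<Longrightarrow> \<phi>' n x = 0"
    "\<And>n x. \<exists>y. \<phi> n x = \<psi> y" "\<And>x. (\<lambda>n. \<phi> n x) \<longlonglongrightarrow> \<psi> x"
proof -
  obtain \<Psi> where P: "\<And>x. (\<Psi> has_real_derivative \<psi> x) (at x)"
    using antiderivative_exists[OF c] by metis
  define e where "e n = 1 / real (Suc n)" for n
  have e: "0 < e n" "e n \<le> 1" for n by (auto simp: e_def)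
  define \<phi> where "\<phi> n x = (\<Psi> (x + e n) - \<Psi> x) / e n" for n x
  define \<phi>' where "\<phi>' n x = (\<psi> (x + e n) - \<psi> x) / e n" for n x
  \<comment> \<open>By the mean value theorem each average is a value of \<open>\<psi>\<close> at a
    nearby point, so bounds carry over and the support grows by at most 1.\<close>
  have mv: "\<exists>y. x < y \<and> y < x + e n \<and> \<phi> n x = \<psi> y" for n x
  proof -
    obtain y where "x < y" "y < x + e n" "\<Psi> (x + e n) - \<Psi> x = (x + e n - x) * \<psi> y"
      using MVT2[of x "x + e n" \<Psi> \<psi>] P e(1)[of n] by auto
    then show ?thesis using e(1)[of n] by (intro exI[of _ y]) (auto simp: \<phi>_def)
  qed
  show ?thesis
  proof
    show "(\<phi> n has_real_derivative \<phi>' n x) (at x)" for n x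
    proof -
      have "((\<lambda>x. \<Psi> (x + e n)) has_real_derivative \<psi> (x + e n)) (at x)"
        using P[of "x + e n"] by (simp add: DERIV_shift)
      then show ?thesis unfolding \<phi>_def \<phi>'_def
        by (intro DERIV_cdivide DERIV_diff P)
    qed
    show "continuous_on UNIV (\<phi>' n)" for n
      unfolding \<phi>'_def using e(1)[of n]
      by (intro continuous_intros continuous_on_compose2[OF c]) auto
    show "\<phi> n x = 0" if "x \<notin> {-R-1..R+1}" for n x
    proof -
      obtain y where "x < y" "y < x + e n" "\<phi> n x = \<psi> y" using mv by blast
      then show ?thesis using z[of y] that e[of n] by fastforce
    qed
    show "\<phi>' n x = 0" if "x \<notin> {-R-1..R+1}" for n x
      using z[of x] z[of "x + e n"] that e[of n] by (force simp: \<phi>'_def)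
    show "\<exists>y. \<phi> n x = \<psi> y" for n x using mv by blast
    show "(\<lambda>n. \<phi> n x) \<longlonglongrightarrow> \<psi> x" for x
    proof -
      have "e \<longlonglongrightarrow> 0" unfolding e_def by (rule lim_1_over_n[THEN LIMSEQ_Suc])
      then have "filterlim e (at 0) sequentially"
        using e(1) by (simp add: filterlim_at less_imp_neq[symmetric] eventually_sequentially)
      then show ?thesis
        using P[of x] unfolding DERIV_def \<phi>_def by (rule filterlim_compose[rotated])
    qed
  qed
qed

lemma locally_integrable_diff:
  fixes f g :: "real \<Rightarrow> real"
  shows "locally_integrable f \<Longrightarrow> locally_integrable g \<Longrightarrow> locally_integrable (\<lambda>x. f x - g x)"
  unfolding locally_integrable_def by (auto intro: set_integral_diff(1))

lemma derivative_zero_outside: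
  fixes \<phi> :: "real \<Rightarrow> real"
  assumes d: "\<And>x. (\<phi> has_real_derivative \<phi>' x) (at x)" and z: "\<And>x. x \<notin> {-R..R} \<Longrightarrow> \<phi> x = 0"
    and x: "x \<notin> {-R..R}"
  shows "\<phi>' x = 0"
proof -
  have "open (- {-R..R})" by auto
  then have "((\<lambda>x. 0) has_real_derivative \<phi>' x) (at x)"
    by (rule has_field_derivative_transform_within_open[OF d[of x]]) (use x z in auto)
  then show ?thesis using DERIV_const DERIV_unique by blast
qed

lemma primitive_imp_weak_deriv:
  assumes p: "primitive u g" shows "has_weak_deriv u g"
  unfolding has_weak_deriv_def
proof (intro conjI allI impI)
  show "locally_integrable u" by (rule locally_integrable_continuous[OF primitive_continuous[OF p]])
  show "locally_integrable g" using p by (simp add: primitive_def)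
  fix \<phi> \<phi>' :: "real \<Rightarrow> real"
  assume *: "(\<forall>x. (\<phi> has_real_derivative \<phi>' x) (at x)) \<and> continuous_on UNIV \<phi>' \<and> bounded {x. \<phi> x \<noteq> 0}"
  then obtain R0 where R0: "\<And>x. \<phi> x \<noteq> 0 \<Longrightarrow> \<bar>x\<bar> \<le> R0" unfolding bounded_iff by auto
  \<comment> \<open>The extra 1 makes the test function vanish at both endpoints, so the boundary
    terms disappear.\<close>
  define R where "R = \<bar>R0\<bar> + 1"
  have z: "\<phi> x = 0" if "x \<notin> {-R<..<R}" for x using R0[of x] that by (fastforce simp: R_def)
  then have z1: "\<phi> x = 0" if "x \<notin> {-R..R}" for x using that by auto
  have z': "\<phi>' x = 0" if "x \<notin> {-R..R}" for x
    using derivative_zero_outside[of \<phi> \<phi>' R x] * z1 that by blast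
  have "primitive \<phi> \<phi>'" by (rule primitive_C1) (use * in auto)
  from integration_by_parts_primitive[OF this p, of "-R" R]
  have "(LINT x:{-R..R}|lebesgue. \<phi>' x * u x) + (LINT x:{-R..R}|lebesgue. \<phi> x * g x) = 0"
    using z by (simp add: R_def mult.commute)
  then show "(LINT x|lebesgue. \<phi>' x *\<^sub>R u x) = - (LINT x|lebesgue. \<phi> x *\<^sub>R g x)"
    using compact_support_integral[of "-R" R "\<lambda>x. \<phi>' x * u x"] compact_support_integral[of "-R" R "\<lambda>x. \<phi> x * g x"] z' z1
    by auto
qed

text \<open>The difference of the two derivatives annihilates all C^1 tests; mollification extends
  this to continuous tests with compact support.\<close>

lemma primitive_unique:
  assumes p: "primitive u g" and q: "primitive u h"
  shows "AE x in lebesgue. g x = h x"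
proof -
  define d where "d x = g x - h x" for x
  have gl: "locally_integrable g" "locally_integrable h" using p q by (auto simp: primitive_def)
  then have dl: "locally_integrable d" unfolding d_def by (rule locally_integrable_diff)
  have wg: "has_weak_deriv u g" and wh: "has_weak_deriv u h" using p q by (auto intro: primitive_imp_weak_deriv)
  have "AE x in lebesgue. d x = 0"
  proof (rule AE_zero_of_test[OF dl])
    fix \<psi> :: "real \<Rightarrow> real" and R
    assume c: "continuous_on UNIV \<psi>" and z: "\<And>x. x \<notin> {-R..R} \<Longrightarrow> \<psi> x = 0"
    obtain \<phi> \<phi>' :: "nat \<Rightarrow> real \<Rightarrow> real" where m:
      "\<And>n x. (\<phi> n has_real_derivative \<phi>' n x) (at x)" "\<And>n. continuous_on UNIV (\<phi>' n)"
      "\<And>n x. x \<notin> {-R-1..R+1} \<Longrightarrow> \<phi> n x = 0" "\<And>n x. \<exists>y. \<phi> n x = \<psi> y" "\<And>x. (\<lambda>n. \<phi> n x) \<longlonglongrightarrow> \<psi> x"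
      by (rule mollify[of \<psi> R, OF c z]) blast+
    have cphi: "continuous_on UNIV (\<phi> n)" for n
      using primitive_continuous[OF primitive_C1[OF m(1,2)]] .
    have 0: "(LINT x|lebesgue. \<phi> n x * d x) = 0" for n
    proof -
      have "bounded {x. \<phi> n x \<noteq> 0}"
        by (rule bounded_subset[OF bounded_closed_interval[of "-R-1" "R+1"]]) (use m(3) in blast)
      then have "(LINT x|lebesgue. \<phi>' n x *\<^sub>R u x) = - (LINT x|lebesgue. \<phi> n x *\<^sub>R g x)"
        "(LINT x|lebesgue. \<phi>' n x *\<^sub>R u x) = - (LINT x|lebesgue. \<phi> n x *\<^sub>R h x)"
        using wg wh m(1,2) unfolding has_weak_deriv_def by blast+
      moreover have "(LINT x|lebesgue. \<phi> n x * d x) = (LINT x|lebesgue. \<phi> n x * g x) - (LINT x|lebesgue. \<phi> n x * h x)"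
        unfolding d_def right_diff_distrib
        by (rule Bochner_Integration.integral_diff) (rule compact_support_integrable[OF _ cphi m(3)], use gl in auto)+
      ultimately show ?thesis by simp
    qed
    obtain M where M: "M \<ge> 0" "\<And>x. x \<in> {-R..R} \<Longrightarrow> \<bar>\<psi> x\<bar> \<le> M" using continuous_bounded_interval[OF c] by metis
    have M': "\<bar>\<phi> n x\<bar> \<le> M" for n x using m(4)[of n x] M z by force
    have "(\<lambda>n. LINT x|lebesgue. \<phi> n x * d x) \<longlonglongrightarrow> (LINT x|lebesgue. \<psi> x * d x)"
    proof (rule integral_dominated_convergence)
      show "integrable lebesgue (\<lambda>x. M * (indicator {-R-1..R+1} x *\<^sub>R \<bar>d x\<bar>))"
        by (rule integrable_mult_right) (use dl set_integrable_abs in \<open>unfold locally_integrable_def set_integrable_def, blast\<close>)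
      show "(\<lambda>x. \<psi> x * d x) \<in> borel_measurable lebesgue" "(\<lambda>x. \<phi> n x * d x) \<in> borel_measurable lebesgue" for n
        using borel_measurable_lebesgue_continuous[OF c] borel_measurable_lebesgue_continuous[OF cphi] locally_integrable_borel[OF dl] by measurable
      show "AE x in lebesgue. (\<lambda>n. \<phi> n x * d x) \<longlonglongrightarrow> \<psi> x * d x"
        by (intro AE_I2 tendsto_mult m(5) tendsto_const)
      show "AE x in lebesgue. norm (\<phi> n x * d x) \<le> M * (indicator {-R-1..R+1} x *\<^sub>R \<bar>d x\<bar>)" for n
      proof (rule AE_I2)
        fix x show "norm (\<phi> n x * d x) \<le> M * (indicator {-R-1..R+1} x *\<^sub>R \<bar>d x\<bar>)"
          using m(3)[of x n] mult_right_mono[OF M'[of n x], of "\<bar>d x\<bar>"]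
          by (cases "x \<in> {-R-1..R+1}") (auto simp: abs_mult)
      qed
    qed
    then show "(LINT x|lebesgue. \<psi> x * d x) = 0" using 0 LIMSEQ_unique by (simp add: LIMSEQ_const_iff)
  qed
  then show ?thesis by eventually_elim (simp add: d_def)
qed

text \<open>Supplies the bump of unit mass for the du Bois-Reymond argument. The mass is expressed
  as an increment of \<open>\<Theta>\<close>, the form in which it cancels there.\<close>

lemma hat_antiderivative:
  obtains \<theta> \<Theta> :: "real \<Rightarrow> real" where "continuous_on UNIV \<theta>" "\<And>x. x \<notin> {-1..1} \<Longrightarrow> \<theta> x = 0"
    "\<And>x. (\<Theta> has_real_derivative \<theta> x) (at x)" "\<And>R. 1 \<le> R \<Longrightarrow> \<Theta> R - \<Theta> (-R) = 1"
proof -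
  define h where "h x = max 0 (1 - \<bar>x\<bar>)" for x :: real
  have ch: "continuous_on UNIV h" unfolding h_def by (intro continuous_intros)
  obtain H where H: "\<And>x. (H has_real_derivative h x) (at x)" using antiderivative_exists[OF ch] by metis
  have inc: "H a \<le> H b" if "a \<le> b" for a b
    using DERIV_nonneg_imp_nondecreasing[OF that, of H] H by (metis h_def max.cobounded1)
  have "H (-1) < H 1"
  proof -
    obtain z :: real where "-1/2 < z" "z < 1/2" "H (1/2) - H (-1/2) = (1/2 - -1/2) * h z"
      using MVT2[of "-1/2" "1/2" H h] H by auto
    then have "H (-1/2) < H (1/2)" by (auto simp: h_def abs_if split: if_splits)
    then show ?thesis using inc[of "-1" "-1/2"] inc[of "1/2" 1] by linarith
  qed
  then have L: "H 1 - H (-1) > 0" by simp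
  define L where "L = H 1 - H (-1)"
  show ?thesis
  proof (rule that[of "\<lambda>x. h x / L" "\<lambda>x. H x / L"])
    show "continuous_on UNIV (\<lambda>x. h x / L)" using L L_def by (intro continuous_intros ch) auto
    show "h x / L = 0" if "x \<notin> {-1..1}" for x using that by (auto simp: h_def)
    show "((\<lambda>x. H x / L) has_real_derivative h x / L) (at x)" for x by (rule DERIV_cdivide[OF H])
    show "H R / L - H (-R) / L = 1" if "1 \<le> R" for R
    proof -
      have "H R = H 1"
      proof (cases "R = 1")
        case False
        then have "\<exists>z. 1 < z \<and> z < R \<and> H R - H 1 = (R - 1) * h z"
          by (intro MVT2 H) (use that in auto)
        then show ?thesis by (auto simp: h_def)
      qed simp
      moreover have "H (-R) = H (-1)"
      proof (cases "R = 1")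
        case False
        then have "\<exists>z. -R < z \<and> z < -1 \<and> H (-1) - H (-R) = (-1 - -R) * h z"
          by (intro MVT2 H) (use that in auto)
        then show ?thesis by (auto simp: h_def)
      qed simp
      ultimately show ?thesis using L by (simp add: L_def diff_divide_distrib[symmetric])
    qed
  qed
qed

text \<open>Du Bois-Reymond: subtracting a multiple of a fixed bump turns any test function into a derivative.\<close>

lemma AE_const_of_test:
  fixes f :: "real \<Rightarrow> real"
  assumes f: "locally_integrable f"
    and t: "\<And>\<phi> \<phi>'. (\<And>x. (\<phi> has_real_derivative \<phi>' x) (at x)) \<Longrightarrow> continuous_on UNIV \<phi>' \<Longrightarrow> bounded {x. \<phi> x \<noteq> 0}
        \<Longrightarrow> (LINT x|lebesgue. \<phi>' x * f x) = 0"
  obtains c where "AE x in lebesgue. f x = c"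
proof -
  obtain \<theta> \<Theta> :: "real \<Rightarrow> real" where th: "continuous_on UNIV \<theta>" "\<And>x. x \<notin> {-1..1} \<Longrightarrow> \<theta> x = 0"
    "\<And>x. (\<Theta> has_real_derivative \<theta> x) (at x)" "\<And>R. 1 \<le> R \<Longrightarrow> \<Theta> R - \<Theta> (-R) = 1"
    using hat_antiderivative by metis
  define c where "c = (LINT x|lebesgue. \<theta> x * f x)"
  have lc: "locally_integrable (\<lambda>x. c)" by (rule locally_integrable_continuous) simp
  have ld: "locally_integrable (\<lambda>x. f x - c)" by (rule locally_integrable_diff[OF f lc])
  have "AE x in lebesgue. f x - c = 0"
  proof (rule AE_zero_of_test[OF ld])
    fix \<psi> :: "real \<Rightarrow> real" and R0
    assume cp: "continuous_on UNIV \<psi>" and z0: "\<And>x. x \<notin> {-R0..R0} \<Longrightarrow> \<psi> x = 0"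
    define R where "R = max 1 R0"
    have R: "1 \<le> R" by (simp add: R_def)
    have z: "\<psi> x = 0" and zt: "\<theta> x = 0" if "x \<notin> {-R..R}" for x
      using that by (auto intro!: z0 th(2) simp: R_def)
    obtain \<Psi> where P: "\<And>x. (\<Psi> has_real_derivative \<psi> x) (at x)" using antiderivative_exists[OF cp] by metis
    \<comment> \<open>The mass of \<open>\<psi>\<close>. After subtracting \<open>m\<close> times
      the bump the total mass is 0, so the primitive started at \<open>-R\<close> vanishes beyond
      \<open>R\<close> as well.\<close>
    define m where "m = \<Psi> R - \<Psi> (-R)"
    define \<phi> where "\<phi> x = (\<Psi> x - \<Psi> (-R)) - m * (\<Theta> x - \<Theta> (-R))" for x
    define \<phi>' where "\<phi>' x = \<psi> x - m * \<theta> x" for x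
    have d: "(\<phi> has_real_derivative \<phi>' x) (at x)" for x
      unfolding \<phi>_def \<phi>'_def by (auto intro!: derivative_eq_intros P th(3))
    have cd: "continuous_on UNIV \<phi>'" unfolding \<phi>'_def by (intro continuous_intros cp th(1))
    have zd: "\<phi>' x = 0" if "x \<notin> {-R..R}" for x using z zt that by (simp add: \<phi>'_def)
    have z1: "\<phi> (-R) = 0" "\<phi> R = 0" using th(4)[OF R] by (auto simp: \<phi>_def m_def)
    have "\<phi> x = 0" if "x \<notin> {-R..R}" for x
    proof (cases "x < -R")
      case True
      then obtain y where "x < y" "y < -R" "\<phi> (-R) - \<phi> x = (-R - x) * \<phi>' y"
        using MVT2[OF True, of \<phi> \<phi>'] d by blast
      then show ?thesis using zd[of y] z1 by simp
    next
      case False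
      then have lt: "R < x" using that by auto
      then obtain y where "R < y" "y < x" "\<phi> x - \<phi> R = (x - R) * \<phi>' y"
        using MVT2[OF lt, of \<phi> \<phi>'] d by blast
      then show ?thesis using zd[of y] z1 by simp
    qed
    then have "{x. \<phi> x \<noteq> 0} \<subseteq> {-R..R}" by blast
    then have b: "bounded {x. \<phi> x \<noteq> 0}" by (rule bounded_subset[OF bounded_closed_interval])
    have ip: "integrable lebesgue (\<lambda>x. \<psi> x * f x)" and it: "integrable lebesgue (\<lambda>x. \<theta> x * f x)"
      and ip1: "integrable lebesgue (\<lambda>x. \<psi> x * c)"
      using compact_support_integrable[OF f cp z] compact_support_integrable[OF f th(1) zt]
        compact_support_integrable[OF lc cp z] by auto
    have "0 = (LINT x|lebesgue. \<phi>' x * f x)" using t[OF d cd b] by simp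
    also have "\<dots> = (LINT x|lebesgue. \<psi> x * f x - m * (\<theta> x * f x))"
      by (simp add: \<phi>'_def algebra_simps)
    also have "\<dots> = (LINT x|lebesgue. \<psi> x * f x) - m * c"
      using ip it by (simp add: c_def)
    finally have 1: "(LINT x|lebesgue. \<psi> x * f x) = m * c" by simp
    have "(LINT x|lebesgue. \<psi> x) = (LINT x:{-R..R}|lebesgue. \<psi> x)"
      by (rule compact_support_integral) (use z in auto)
    also have "\<dots> = m"
      using primitive_diff[OF primitive_C1[OF P cp], of "-R" R] R by (simp add: m_def)
    finally have "(LINT x|lebesgue. \<psi> x * c) = m * c" by simp
    then show "(LINT x|lebesgue. \<psi> x * (f x - c)) = 0"
      using 1 Bochner_Integration.integral_diff[OF ip ip1] by (simp only: right_diff_distrib)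
  qed
  then have "AE x in lebesgue. f x = c" by eventually_elim simp
  then show ?thesis by (rule that)
qed

text \<open>The difference of \<open>u\<close> and any primitive of \<open>g\<close> has weak
  derivative 0 and is therefore constant almost everywhere.\<close>

lemma weak_deriv_imp_primitive:
  fixes u g :: "real \<Rightarrow> real"
  assumes w: "has_weak_deriv u g"
  obtains v where "primitive v g" "AE x in lebesgue. v x = u x"
proof -
  have ul: "locally_integrable u" and gl: "locally_integrable g" using w by (auto simp: has_weak_deriv_def)
  obtain F where F: "primitive F g" using primitive_exists[OF gl] .
  have Fl: "locally_integrable F" by (rule locally_integrable_continuous[OF primitive_continuous[OF F]])
  obtain c where c: "AE x in lebesgue. u x - F x = c"
  proof (rule AE_const_of_test[OF locally_integrable_diff[OF ul Fl]])
    fix \<phi> \<phi>' :: "real \<Rightarrow> real"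
    assume d: "\<And>x. (\<phi> has_real_derivative \<phi>' x) (at x)" and cd: "continuous_on UNIV \<phi>'" and b: "bounded {x. \<phi> x \<noteq> 0}"
    then obtain R where R: "\<And>x. \<phi> x \<noteq> 0 \<Longrightarrow> \<bar>x\<bar> \<le> R" unfolding bounded_iff by auto
    have z: "\<phi> x = 0" if "x \<notin> {-R..R}" for x using R[of x] that by (cases "\<phi> x = 0") (auto simp: abs_le_iff)
    have z': "\<phi>' x = 0" if "x \<notin> {-R..R}" for x
      using derivative_zero_outside[of \<phi> \<phi>' R x] d z that by blast
    have "(LINT x|lebesgue. \<phi>' x *\<^sub>R u x) = (LINT x|lebesgue. \<phi>' x *\<^sub>R F x)"
    proof -
      have "(LINT x|lebesgue. \<phi>' x *\<^sub>R u x) = - (LINT x|lebesgue. \<phi> x *\<^sub>R g x)"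
        using w d cd b unfolding has_weak_deriv_def by blast
      moreover have "(LINT x|lebesgue. \<phi>' x *\<^sub>R F x) = - (LINT x|lebesgue. \<phi> x *\<^sub>R g x)"
        using primitive_imp_weak_deriv[OF F] d cd b unfolding has_weak_deriv_def by blast
      ultimately show ?thesis by simp
    qed
    then show "(LINT x|lebesgue. \<phi>' x * (u x - F x)) = 0"
      using compact_support_integrable[OF ul cd z'] compact_support_integrable[OF Fl cd z']
      by (simp add: right_diff_distrib)
  qed
  have "primitive (\<lambda>x. F x + c) g" using F by (simp add: primitive_def)
  moreover have "AE x in lebesgue. F x + c = u x" using c by eventually_elim simp
  ultimately show ?thesis by (rule that)
qed

text \<open>The set where they differ is open and null, hence empty.\<close>

lemma continuous_AE_eq:
  fixes f g :: "real \<Rightarrow> real"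
  assumes f: "continuous_on UNIV f" and g: "continuous_on UNIV g" and ae: "AE x in lebesgue. f x = g x"
  shows "f = g"
proof (rule ccontr)
  assume "f \<noteq> g"
  then obtain x where x: "f x \<noteq> g x" by blast
  have "open {x. f x \<noteq> g x}" by (rule open_Collect_neq[OF f g])
  moreover have "{x. f x \<noteq> g x} \<in> null_sets lebesgue"
  proof (rule AE_iff_null_sets[THEN iffD2])
    show "{x. f x \<noteq> g x} \<in> sets lebesgue" using \<open>open _\<close> by simp
    show "AE x in lebesgue. x \<notin> {x. f x \<noteq> g x}" using ae by eventually_elim simp
  qed
  ultimately have "{x. f x \<noteq> g x} = {}"
    using open_not_negligible[OF \<open>open _\<close>] by (auto simp: negligible_iff_null_sets)
  then show False using x by blast
qed

lemma weak_deriv_unique: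
  fixes u v g h :: "real \<Rightarrow> real"
  assumes "has_weak_deriv u g" "has_weak_deriv v h" "AE x in lebesgue. u x = v x"
  shows "AE x in lebesgue. g x = h x"
proof -
  obtain u1 where u1: "primitive u1 g" "AE x in lebesgue. u1 x = u x" using weak_deriv_imp_primitive[OF assms(1)] .
  obtain v1 where v1: "primitive v1 h" "AE x in lebesgue. v1 x = v x" using weak_deriv_imp_primitive[OF assms(2)] .
  have "u1 = v1"
  proof (rule continuous_AE_eq)
    show "continuous_on UNIV u1" "continuous_on UNIV v1" using u1 v1 primitive_continuous by auto
    show "AE x in lebesgue. u1 x = v1 x" using assms(3) u1(2) v1(2) by eventually_elim simp
  qed
  then show ?thesis using primitive_unique[OF u1(1)] v1(1) by simp
qed

subsection \<open>Sobolev functions on the line\<close>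

lemma lebesgue_shift:
  fixes f :: "real \<Rightarrow> real"
  shows integrable_shift: "integrable lebesgue (\<lambda>x. f (x + t)) \<longleftrightarrow> integrable lebesgue f"
    and integral_shift: "(LINT x|lebesgue. f (x + t)) = (LINT x|lebesgue. f x)"
  using lebesgue_integrable_real_affine_iff[of 1 f t] lebesgue_integral_real_affine[of 1 f t]
  by (simp_all add: add.commute)

lemma lebesgue_reflect:
  fixes f :: "real \<Rightarrow> real"
  shows integrable_reflect: "integrable lebesgue (\<lambda>x. f (- x)) \<longleftrightarrow> integrable lebesgue f"
    and integral_reflect: "(LINT x|lebesgue. f (- x)) = (LINT x|lebesgue. f x)"
  using lebesgue_integrable_real_affine_iff[of "-1" f 0] lebesgue_integral_real_affine[of "-1" f 0]
  by simp_all

lemma borel_measurable_shift: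
  fixes f :: "real \<Rightarrow> real"
  assumes "f \<in> borel_measurable lebesgue" shows "(\<lambda>x. f (x + t)) \<in> borel_measurable lebesgue"
proof -
  have "(\<lambda>x::real. t + 1 * x) \<in> lebesgue \<rightarrow>\<^sub>M lebesgue"
    using lebesgue_affine_measurable[where c= "\<lambda>x::real. 1" and t=t] by simp
  then show ?thesis using measurable_compose[OF _ assms] by (simp add: add.commute)
qed

lemma borel_measurable_reflect:
  fixes f :: "real \<Rightarrow> real"
  assumes "f \<in> borel_measurable lebesgue" shows "(\<lambda>x. f (- x)) \<in> borel_measurable lebesgue"
proof -
  have "(\<lambda>x::real. 0 + (-1) * x) \<in> lebesgue \<rightarrow>\<^sub>M lebesgue"
    using lebesgue_affine_measurable[where c= "\<lambda>x::real. -1" and t=0] by simp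
  then show ?thesis using measurable_compose[OF _ assms] by simp
qed

section \<open>Square integrable functions and Cauchy-Schwarz\<close>

definition sq_integrable :: "(real \<Rightarrow> real) \<Rightarrow> bool" where
  "sq_integrable f \<longleftrightarrow> f \<in> borel_measurable lebesgue \<and> integrable lebesgue (\<lambda>x. (f x)\<^sup>2)"

lemma sq_integrableD:
  assumes "sq_integrable f"
  shows sq_integrable_borel [measurable_dest]: "f \<in> borel_measurable lebesgue"
    and sq_integrable_square: "integrable lebesgue (\<lambda>x. (f x)\<^sup>2)"
  using assms by (auto simp: sq_integrable_def)

lemma sq_integrable_mult:
  assumes "sq_integrable f" "sq_integrable g" shows "integrable lebesgue (\<lambda>x. f x * g x)"
proof (rule Bochner_Integration.integrable_bound)
  show "integrable lebesgue (\<lambda>x. (f x)\<^sup>2 + (g x)\<^sup>2)" using assms by (simp add: sq_integrable_def)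
  show "(\<lambda>x. f x * g x) \<in> borel_measurable lebesgue" using assms by measurable
  show "AE x in lebesgue. norm (f x * g x) \<le> norm ((f x)\<^sup>2 + (g x)\<^sup>2)"
  proof (rule AE_I2)
    fix x
    have "0 \<le> (\<bar>f x\<bar> - \<bar>g x\<bar>)\<^sup>2" by simp
    then have 1: "2 * (\<bar>f x\<bar> * \<bar>g x\<bar>) \<le> (f x)\<^sup>2 + (g x)\<^sup>2" by (simp add: power2_diff)
    have "0 \<le> \<bar>f x\<bar> * \<bar>g x\<bar>" by simp
    with 1 have "\<bar>f x\<bar> * \<bar>g x\<bar> \<le> (f x)\<^sup>2 + (g x)\<^sup>2" by linarith
    then show "norm (f x * g x) \<le> norm ((f x)\<^sup>2 + (g x)\<^sup>2)" by (simp add: abs_mult)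
  qed
qed

lemma sq_integrable_add:
  assumes "sq_integrable f" "sq_integrable g" shows "sq_integrable (\<lambda>x. f x + g x)"
  unfolding sq_integrable_def
proof
  show "(\<lambda>x. f x + g x) \<in> borel_measurable lebesgue" using assms by measurable
  show "integrable lebesgue (\<lambda>x. (f x + g x)\<^sup>2)"
    using sq_integrable_mult[OF assms] assms[THEN sq_integrable_square]
    by (simp add: power2_sum mult.assoc)
qed

lemma sq_integrable_cmult:
  assumes "sq_integrable f" shows "sq_integrable (\<lambda>x. c * f x)"
  unfolding sq_integrable_def
proof
  show "(\<lambda>x. c * f x) \<in> borel_measurable lebesgue" using assms by measurable
  show "integrable lebesgue (\<lambda>x. (c * f x)\<^sup>2)"
    using sq_integrable_square[OF assms] by (simp add: power_mult_distrib)
qed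

lemma sq_integrable_diff:
  assumes "sq_integrable f" "sq_integrable g" shows "sq_integrable (\<lambda>x. f x - g x)"
  using sq_integrable_add[OF assms(1) sq_integrable_cmult[OF assms(2), of "-1"]] by simp

lemma sq_integrable_bounded_mult:
  assumes f: "sq_integrable f" and u: "u \<in> borel_measurable lebesgue" and b: "\<And>x. \<bar>u x\<bar> \<le> K"
  shows "sq_integrable (\<lambda>x. u x * f x)"
  unfolding sq_integrable_def
proof
  show "(\<lambda>x. u x * f x) \<in> borel_measurable lebesgue" using f u by measurable
  then have m: "(\<lambda>x. (u x * f x)\<^sup>2) \<in> borel_measurable lebesgue" by measurable
  show "integrable lebesgue (\<lambda>x. (u x * f x)\<^sup>2)"
  proof (rule Bochner_Integration.integrable_bound[OF _ m])
    show "integrable lebesgue (\<lambda>x. K\<^sup>2 * (f x)\<^sup>2)" using f by (simp add: sq_integrable_def)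
    show "AE x in lebesgue. norm ((u x * f x)\<^sup>2) \<le> norm (K\<^sup>2 * (f x)\<^sup>2)"
    proof (rule AE_I2)
      fix x
      have "(u x)\<^sup>2 \<le> K\<^sup>2" using b[of x] by (metis abs_ge_zero power2_abs power_mono)
      then show "norm ((u x * f x)\<^sup>2) \<le> norm (K\<^sup>2 * (f x)\<^sup>2)"
        by (simp add: power_mult_distrib mult_right_mono)
    qed
  qed
qed

text \<open>Kept free of integrals because it serves both the L^2 product and, in the spectral gap
  argument, the nonnegative energy form.\<close>

lemma quadratic_nonneg_imp_discriminant:
  fixes A B C :: real
  assumes q: "\<And>t. 0 \<le> A + 2 * t * B + t\<^sup>2 * C" and C: "0 \<le> C"
  shows "B\<^sup>2 \<le> A * C"
proof (cases "C = 0")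
  case True
  have "B = 0"
  proof (rule ccontr)
    assume "B \<noteq> 0"
    \<comment> \<open>For \<open>C = 0\<close> the expression is affine in \<open>t\<close> and
      takes the value -1 here.\<close>
    then show False using q[of "- (A + 1) / (2 * B)"] True by (simp add: field_simps)
  qed
  then show ?thesis using True by simp
next
  case False
  then have "0 < C" using C by simp
  moreover have "0 \<le> A + 2 * (- B / C) * B + (- B / C)\<^sup>2 * C" by (rule q)
  ultimately show ?thesis by (simp add: field_simps power2_eq_square)
qed

lemma sq_integral_add:
  assumes f: "sq_integrable f" and g: "sq_integrable g"
  shows "(LINT x|lebesgue. (f x + t * g x)\<^sup>2) = (LINT x|lebesgue. (f x)\<^sup>2)
     + 2 * t * (LINT x|lebesgue. f x * g x) + t\<^sup>2 * (LINT x|lebesgue. (g x)\<^sup>2)"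
proof -
  have "(\<lambda>x. (f x + t * g x)\<^sup>2) = (\<lambda>x. (f x)\<^sup>2 + (2 * t * (f x * g x) + t\<^sup>2 * (g x)\<^sup>2))"
    by (intro ext) (simp add: power2_eq_square algebra_simps)
  then show ?thesis
    using f g sq_integrable_mult[OF f g] by (simp add: sq_integrable_def)
qed

lemma integral_Cauchy_Schwarz:
  assumes f: "sq_integrable f" and g: "sq_integrable g"
  shows "(LINT x|lebesgue. f x * g x)\<^sup>2 \<le> (LINT x|lebesgue. (f x)\<^sup>2) * (LINT x|lebesgue. (g x)\<^sup>2)"
  by (rule quadratic_nonneg_imp_discriminant)
    (auto simp: sq_integral_add[OF f g, symmetric] intro: integral_nonneg_AE)

text \<open>\<open>H\<^sup>1\<close> functions are represented by pairs of the continuous representative and a weak derivative.\<close>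

definition H1pair :: "(real \<Rightarrow> real) \<Rightarrow> (real \<Rightarrow> real) \<Rightarrow> bool" where
  "H1pair u g \<longleftrightarrow> primitive u g \<and> sq_integrable u \<and> sq_integrable g"

lemma H1pairD:
  assumes "H1pair u g"
  shows "primitive u g" "sq_integrable u" "sq_integrable g" "u \<in> borel_measurable lebesgue"
    "g \<in> borel_measurable lebesgue" "integrable lebesgue (\<lambda>x. (u x)\<^sup>2)" "integrable lebesgue (\<lambda>x. (g x)\<^sup>2)"
    "continuous_on UNIV u"
  using assms primitive_continuous by (auto simp: H1pair_def sq_integrable_def)

lemma primitive_add:
  assumes "primitive u g" "primitive v h" shows "primitive (\<lambda>x. u x + v x) (\<lambda>x. g x + h x)"
  unfolding primitive_def locally_integrable_def
proof (intro conjI allI impI)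
  show "set_integrable lebesgue {a..b} (\<lambda>x. g x + h x)" for a b
    using assms by (intro set_integral_add(1) primitive_integrable)
  fix a b :: real assume ab: "a \<le> b"
  have "(LINT x:{a..b}|lebesgue. g x + h x) = (LINT x:{a..b}|lebesgue. g x) + (LINT x:{a..b}|lebesgue. h x)"
    by (intro set_integral_add(2)) (use assms primitive_integrable in blast)+
  then show "u b + v b - (u a + v a) = (LINT x:{a..b}|lebesgue. g x + h x)"
    using primitive_diff[OF assms(1) ab] primitive_diff[OF assms(2) ab] by simp
qed

lemma primitive_cmult:
  assumes "primitive u g" shows "primitive (\<lambda>x. c * u x) (\<lambda>x. c * g x)"
  unfolding primitive_def locally_integrable_def
proof (intro conjI allI impI)
  show "set_integrable lebesgue {a..b} (\<lambda>x. c * g x)" for a b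
    using primitive_integrable[OF assms, of a b] by simp
  fix a b :: real assume "a \<le> b"
  then show "c * u b - c * u a = (LINT x:{a..b}|lebesgue. c * g x)"
    using primitive_diff[OF assms, of a b] by (simp add: right_diff_distrib[symmetric])
qed

lemma H1pair_add: "H1pair u g \<Longrightarrow> H1pair v h \<Longrightarrow> H1pair (\<lambda>x. u x + v x) (\<lambda>x. g x + h x)"
  unfolding H1pair_def by (auto intro: primitive_add sq_integrable_add)

lemma H1pair_cmult: "H1pair u g \<Longrightarrow> H1pair (\<lambda>x. c * u x) (\<lambda>x. c * g x)"
  unfolding H1pair_def by (auto intro: primitive_cmult sq_integrable_cmult)

lemma H1pair_diff: "H1pair u g \<Longrightarrow> H1pair v h \<Longrightarrow> H1pair (\<lambda>x. u x - v x) (\<lambda>x. g x - h x)"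
  using H1pair_add[of u g "\<lambda>x. -1 * v x" "\<lambda>x. -1 * h x"] H1pair_cmult[of v h "-1"] by simp

lemma primitive_shift:
  assumes "primitive u g" shows "primitive (\<lambda>x. u (x + t)) (\<lambda>x. g (x + t))"
proof -
  have eq: "(\<lambda>x. indicator {a..b} x *\<^sub>R g (x + t)) = (\<lambda>x. indicator {a+t..b+t} (x + t) *\<^sub>R g (x + t))" for a b
    by (auto simp: indicator_def)
  have 1: "integrable lebesgue (\<lambda>x. indicator {a..b} x *\<^sub>R g (x + t))" for a b
    unfolding eq integrable_shift[of "\<lambda>y. indicator {a+t..b+t} y *\<^sub>R g y"]
    using primitive_integrable[OF assms] by (simp add: set_integrable_def)
  have 2: "(LINT x|lebesgue. indicator {a..b} x *\<^sub>R g (x + t)) = u (b + t) - u (a + t)" if "a \<le> b" for a b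
    unfolding eq integral_shift[of "\<lambda>y. indicator {a+t..b+t} y *\<^sub>R g y"]
    using primitive_diff[OF assms, of "a+t" "b+t"] that by (simp add: set_lebesgue_integral_def)
  show ?thesis
    unfolding primitive_def locally_integrable_def set_integrable_def set_lebesgue_integral_def
    using 1 2 by auto
qed

lemma primitive_reflect:
  assumes "primitive u g" shows "primitive (\<lambda>x. u (- x)) (\<lambda>x. - g (- x))"
proof -
  have eq: "(\<lambda>x. indicator {a..b} x *\<^sub>R - g (- x)) = (\<lambda>x. - (indicator {-b..-a} (- x) *\<^sub>R g (- x)))" for a b
    by (auto simp: indicator_def)
  have 1: "integrable lebesgue (\<lambda>x. indicator {a..b} x *\<^sub>R - g (- x))" for a b
    unfolding eq integrable_reflect[of "\<lambda>y. - (indicator {-b..-a} y *\<^sub>R g y)"]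
    using primitive_integrable[OF assms] by (simp add: set_integrable_def)
  have 2: "(LINT x|lebesgue. indicator {a..b} x *\<^sub>R - g (- x)) = u (- b) - u (- a)" if "a \<le> b" for a b
    unfolding eq integral_reflect[of "\<lambda>y. - (indicator {-b..-a} y *\<^sub>R g y)"]
    using primitive_diff[OF assms, of "-b" "-a"] that by (simp add: set_lebesgue_integral_def)
  show ?thesis
    unfolding primitive_def locally_integrable_def set_integrable_def set_lebesgue_integral_def
    using 1 2 by auto
qed

lemma H1pair_shift: "H1pair u g \<Longrightarrow> H1pair (\<lambda>x. u (x + t)) (\<lambda>x. g (x + t))"
  unfolding H1pair_def sq_integrable_def
  using integrable_shift[of "\<lambda>x. (u x)\<^sup>2"] integrable_shift[of "\<lambda>x. (g x)\<^sup>2"]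
  by (auto intro: primitive_shift borel_measurable_shift)

lemma H1pair_reflect: "H1pair u g \<Longrightarrow> H1pair (\<lambda>x. u (- x)) (\<lambda>x. - g (- x))"
  unfolding H1pair_def sq_integrable_def
  using integrable_reflect[of "\<lambda>x. (u x)\<^sup>2"] integrable_reflect[of "\<lambda>x. (g x)\<^sup>2"]
  by (auto intro: primitive_reflect borel_measurable_reflect)

section \<open>Pointwise control and decay of H^1 functions\<close>

lemma sq_integrable_indicator:
  assumes "sq_integrable g" "A \<in> sets lebesgue" shows "sq_integrable (\<lambda>x. indicator A x * g x)"
  using assms by (intro sq_integrable_bounded_mult[where K=1]) (auto simp: indicator_def)

lemma sq_integrable_indicator_Icc: "sq_integrable (indicator {a..b})"
  unfolding sq_integrable_def
  using integrable_indicator_Icc by (simp add: power2_eq_square indicator_inter_arith[symmetric])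

text \<open>Cauchy-Schwarz against the indicator of the interval between the two points gives
  exponent 1/2, with the energy on any enclosing interval as constant.\<close>

lemma primitive_Hoelder:
  assumes p: "primitive u g" and g: "sq_integrable g" and xy: "x \<in> {a..b}" "y \<in> {a..b}"
  shows "(u x - u y)\<^sup>2 \<le> \<bar>x - y\<bar> * (LINT t|lebesgue. indicator {a..b} t * (g t)\<^sup>2)"
proof -
  have *: "(u x - u y)\<^sup>2 \<le> \<bar>x - y\<bar> * (LINT t|lebesgue. indicator {a..b} t * (g t)\<^sup>2)"
    if yx: "y \<le> x" and xy: "x \<in> {a..b}" "y \<in> {a..b}" for x y
  proof -
    have s1: "sq_integrable (\<lambda>t. indicator {y..x} t :: real)" by (rule sq_integrable_indicator_Icc)
    have s2: "sq_integrable (\<lambda>t. indicator {a..b} t * g t)"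
      by (rule sq_integrable_indicator[OF g]) auto
    have "u x - u y = (LINT t|lebesgue. indicator {y..x} t * (indicator {a..b} t * g t))"
      unfolding primitive_diff[OF p yx] set_lebesgue_integral_def
      by (rule Bochner_Integration.integral_cong) (use xy in \<open>auto simp: indicator_def\<close>)
    then have "(u x - u y)\<^sup>2 \<le> (LINT t|lebesgue. (indicator {y..x} t :: real)\<^sup>2) * (LINT t|lebesgue. (indicator {a..b} t * g t)\<^sup>2)"
      using integral_Cauchy_Schwarz[OF s1 s2] by simp
    also have "(LINT t|lebesgue. (indicator {y..x} t :: real)\<^sup>2) = \<bar>x - y\<bar>"
      using yx by (simp add: power2_eq_square indicator_inter_arith[symmetric])
    also have "(\<lambda>t. (indicator {a..b} t * g t)\<^sup>2) = (\<lambda>t. indicator {a..b} t * (g t)\<^sup>2)"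
      by (auto simp: indicator_def)
    finally show ?thesis .
  qed
  show ?thesis
  proof (cases "y \<le> x")
    case True then show ?thesis using * xy by blast
  next
    case False then show ?thesis using *[of x y] xy by (simp add: power2_commute abs_minus_commute)
  qed
qed

text \<open>A comparison of \<open>u x\<close> with \<open>u t\<close> is averaged over the unit
  interval to the left of \<open>x\<close>. Only the norm over that interval enters, and this is
  what yields decay at infinity.\<close>

lemma H1pair_local_sup:
  assumes h: "H1pair u g"
  shows "(u x)\<^sup>2 \<le> 2 * (LINT t|lebesgue. indicator {x-1..x} t * (u t)\<^sup>2) + 2 * (LINT t|lebesgue. indicator {x-1..x} t * (g t)\<^sup>2)"
proof -
  let ?I = "LINT t|lebesgue. indicator {x-1..x} t * (g t)\<^sup>2"
  have I0: "0 \<le> ?I" by (intro integral_nonneg_AE AE_I2) simp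
  have ci: "integrable lebesgue (\<lambda>t. indicator {x-1..x} t * c :: real)" for c :: real
    by (rule integrable_mult_left) (rule integrable_indicator_Icc)
  have ui: "integrable lebesgue (\<lambda>t. indicator {x-1..x} t * (u t)\<^sup>2)"
    using integrable_mult_indicator[OF _ H1pairD(6)[OF h], of "{x-1..x}"] by simp
  have pt: "(u x)\<^sup>2 \<le> 2 * (u t)\<^sup>2 + 2 * ?I" if "t \<in> {x-1..x}" for t
  proof -
    have "(u x - u t)\<^sup>2 \<le> \<bar>x - t\<bar> * ?I"
      by (rule primitive_Hoelder[OF H1pairD(1,3)[OF h]]) (use that in auto)
    also have "\<dots> \<le> 1 * ?I" by (rule mult_right_mono[OF _ I0]) (use that in auto)
    finally have "(u x - u t)\<^sup>2 \<le> ?I" by simp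
    \<comment> \<open>This square equals
      \<open>2 (u t)^2 + 2 (u x - u t)^2 - (u x)^2\<close>.\<close>
    moreover have "0 \<le> (u x - 2 * u t)\<^sup>2" by simp
    ultimately show ?thesis by (simp add: power2_eq_square algebra_simps)
  qed
  have "(LINT t|lebesgue. indicator {x-1..x} t * (u x)\<^sup>2) \<le> (LINT t|lebesgue. 2 * (indicator {x-1..x} t * (u t)\<^sup>2) + indicator {x-1..x} t * (2 * ?I))"
  proof (rule integral_mono)
    show "integrable lebesgue (\<lambda>t. indicator {x-1..x} t * (u x)\<^sup>2)" by (rule ci)
    show "integrable lebesgue (\<lambda>t. 2 * (indicator {x-1..x} t * (u t)\<^sup>2) + indicator {x-1..x} t * (2 * ?I))"
      using ui by (intro Bochner_Integration.integrable_add ci) simp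
    show "indicator {x-1..x} t * (u x)\<^sup>2 \<le> 2 * (indicator {x-1..x} t * (u t)\<^sup>2) + indicator {x-1..x} t * (2 * ?I)" for t
      using pt[of t] by (auto simp: indicator_def)
  qed
  also have "\<dots> = 2 * (LINT t|lebesgue. indicator {x-1..x} t * (u t)\<^sup>2) + (LINT t|lebesgue. indicator {x-1..x} t * (2 * ?I))"
    using ui by (subst Bochner_Integration.integral_add) (auto intro: ci)
  also have "(LINT t|lebesgue. indicator {x-1..x} t * (2 * ?I)) = 2 * ?I" by simp
  finally show ?thesis by simp
qed

lemma H1pair_sup:
  assumes h: "H1pair u g"
  shows "(u x)\<^sup>2 \<le> 2 * ((LINT t|lebesgue. (u t)\<^sup>2) + (LINT t|lebesgue. (g t)\<^sup>2))"
proof -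
  have "(LINT t|lebesgue. indicator A t * (f t)\<^sup>2) \<le> (LINT t|lebesgue. (f t)\<^sup>2)"
    if "A \<in> sets lebesgue" "integrable lebesgue (\<lambda>x. (f x)\<^sup>2)" for A and f :: "real \<Rightarrow> real"
    using integrable_mult_indicator[OF that] that by (intro integral_mono) (auto simp: indicator_def)
  from this[of "{x-1..x}" u] this[of "{x-1..x}" g] show ?thesis
    using H1pair_local_sup[OF h, of x] H1pairD[OF h] by simp
qed

text \<open>The local estimate looks only to the left of \<open>x\<close>, so an integral over a
  left half-line bounds all values there at once, and such integrals tend to 0.\<close>

lemma H1pair_small_at_bot:
  assumes h: "H1pair u g" and e: "0 < e"
  obtains T where "\<And>x. x \<le> - T \<Longrightarrow> \<bar>u x\<bar> \<le> e"
proof -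
  define f where "f t = 2 * (u t)\<^sup>2 + 2 * (g t)\<^sup>2" for t
  have fi: "integrable lebesgue f"
    unfolding f_def by (intro Bochner_Integration.integrable_add integrable_mult_right H1pairD[OF h])
  have lim: "(\<lambda>n. LINT t|lebesgue. indicator {..- real n} t * f t) \<longlonglongrightarrow> (LINT t|lebesgue. indicator {} t * f t)"
  proof (rule tendsto_integral_indicator[OF fi])
    fix t :: real
    obtain N where "- t < real N" using reals_Archimedean2 by blast
    then show "\<forall>\<^sub>F n in sequentially. t \<in> {..- real n} \<longleftrightarrow> t \<in> {}"
      by (intro eventually_sequentiallyI[of N]) auto
  qed simp
  then have "\<forall>\<^sub>F n in sequentially. (LINT t|lebesgue. indicator {..- real n} t * f t) < e\<^sup>2"
    using e by (intro order_tendstoD(2)[where y=0]) auto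
  then obtain n where n: "(LINT t|lebesgue. indicator {..- real n} t * f t) < e\<^sup>2"
    by (meson eventually_sequentially order_refl)
  show ?thesis
  proof
    fix x assume x: "x \<le> - real n"
    have ii: "integrable lebesgue (\<lambda>t. indicator A t * k t)" if "A \<in> sets lebesgue" "integrable lebesgue k" for A and k :: "real \<Rightarrow> real"
      using integrable_mult_indicator[OF that] by simp
    have "(u x)\<^sup>2 \<le> (LINT t|lebesgue. 2 * (indicator {x-1..x} t * (u t)\<^sup>2) + 2 * (indicator {x-1..x} t * (g t)\<^sup>2))"
      using H1pair_local_sup[OF h, of x] ii[OF _ H1pairD(6)[OF h], of "{x-1..x}"] ii[OF _ H1pairD(7)[OF h], of "{x-1..x}"] by simp
    also have "\<dots> \<le> (LINT t|lebesgue. indicator {..- real n} t * f t)"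
    proof (rule integral_mono)
      show "integrable lebesgue (\<lambda>t. 2 * (indicator {x-1..x} t * (u t)\<^sup>2) + 2 * (indicator {x-1..x} t * (g t)\<^sup>2))"
        by (intro Bochner_Integration.integrable_add integrable_mult_right ii H1pairD[OF h]) auto
      show "integrable lebesgue (\<lambda>t. indicator {..- real n} t * f t)" by (intro ii fi) auto
      show "2 * (indicator {x-1..x} t * (u t)\<^sup>2) + 2 * (indicator {x-1..x} t * (g t)\<^sup>2) \<le> indicator {..- real n} t * f t" for t
        using x by (auto simp: f_def indicator_def)
    qed
    finally have "(u x)\<^sup>2 \<le> e\<^sup>2" using n by linarith
    then show "\<bar>u x\<bar> \<le> e" using e by (metis abs_le_square_iff abs_of_pos)
  qed
qed

lemma H1pair_tendsto:
  assumes h: "H1pair u g"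
  shows "(\<lambda>n. u (- real n)) \<longlonglongrightarrow> 0" "(\<lambda>n. u (real n)) \<longlonglongrightarrow> 0"
proof -
  have *: "(\<lambda>n. v (- real n)) \<longlonglongrightarrow> 0" if hv: "H1pair v k" for v k
  proof (rule LIMSEQ_I)
    fix r :: real assume "0 < r"
    then obtain T where T: "\<And>x. x \<le> - T \<Longrightarrow> \<bar>v x\<bar> \<le> r / 2" using H1pair_small_at_bot[OF hv, of "r/2"] by auto
    obtain N where N: "T < real N" using reals_Archimedean2 by blast
    show "\<exists>no. \<forall>n\<ge>no. norm (v (- real n) - 0) < r"
    proof (intro exI allI impI)
      fix n assume "N \<le> n"
      then have "- real n \<le> - T" using N by linarith
      from T[OF this] show "norm (v (- real n) - 0) < r" using \<open>0 < r\<close> by simp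
    qed
  qed
  show "(\<lambda>n. u (- real n)) \<longlonglongrightarrow> 0" by (rule *[OF h])
  show "(\<lambda>n. u (real n)) \<longlonglongrightarrow> 0" using *[OF H1pair_reflect[OF h]] by simp
qed

text \<open>The limit at minus infinity is required only along integers, which is the form in which
  Floquet multipliers provide it.\<close>

lemma primitive_half_line:
  assumes p: "primitive F f" and i: "integrable lebesgue (\<lambda>x. indicator {..s} x * f x)"
    and l: "(\<lambda>n. F (- real n)) \<longlonglongrightarrow> 0"
  shows "(LINT x|lebesgue. indicator {..s} x * f x) = F s"
proof -
  have eq: "indicator {-real n..} x * (indicator {..s} x * f x) = indicator {-real n..s} x * f x" for n x
    by (simp add: indicator_def)
  have "(\<lambda>n. LINT x|lebesgue. indicator {-real n..} x * (indicator {..s} x * f x)) \<longlonglongrightarrow>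
    (LINT x|lebesgue. indicator UNIV x * (indicator {..s} x * f x))"
  proof (rule tendsto_integral_indicator[OF i])
    fix x :: real
    obtain N where "- x < real N" using reals_Archimedean2 by blast
    then show "\<forall>\<^sub>F n in sequentially. x \<in> {-real n..} \<longleftrightarrow> x \<in> UNIV"
      by (intro eventually_sequentiallyI[of N]) auto
  qed simp
  then have "(\<lambda>n. LINT x|lebesgue. indicator {-real n..s} x * f x) \<longlonglongrightarrow> (LINT x|lebesgue. indicator {..s} x * f x)"
    unfolding eq by simp
  moreover have "(\<lambda>n. LINT x|lebesgue. indicator {-real n..s} x * f x) \<longlonglongrightarrow> F s"
  proof -
    obtain N where N: "- s < real N" using reals_Archimedean2 by blast
    have ev: "\<forall>\<^sub>F n in sequentially. F s - F (- real n) = (LINT x|lebesgue. indicator {-real n..s} x * f x)"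
    proof (rule eventually_sequentiallyI)
      fix n assume "N \<le> n"
      then have "- real n \<le> s" using N by linarith
      then show "F s - F (- real n) = (LINT x|lebesgue. indicator {-real n..s} x * f x)"
        using primitive_diff[OF p, of "- real n" s] by (simp add: set_lebesgue_integral_def)
    qed
    have "(\<lambda>n. F s - F (- real n)) \<longlonglongrightarrow> F s" using tendsto_diff[OF tendsto_const l] by simp
    then show ?thesis using ev by (rule Lim_transform_eventually)
  qed
  ultimately show ?thesis using LIMSEQ_unique by blast
qed

lemma primitive_full_line:
  assumes p: "primitive F f" and i: "integrable lebesgue f"
    and l: "(\<lambda>n. F (- real n)) \<longlonglongrightarrow> 0" "(\<lambda>n. F (real n)) \<longlonglongrightarrow> 0"
  shows "(LINT x|lebesgue. f x) = 0"
proof -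
  have ii: "integrable lebesgue (\<lambda>x. indicator {..s} x * f x)" for s :: real
    using integrable_mult_indicator[OF _ i, of "{..s}"] by simp
  have "(\<lambda>n. LINT x|lebesgue. indicator {..real n} x * f x) \<longlonglongrightarrow> (LINT x|lebesgue. indicator UNIV x * f x)"
  proof (rule tendsto_integral_indicator[OF i])
    fix x :: real
    obtain N where "x < real N" using reals_Archimedean2 by blast
    then show "\<forall>\<^sub>F n in sequentially. x \<in> {..real n} \<longleftrightarrow> x \<in> UNIV"
      by (intro eventually_sequentiallyI[of N]) auto
  qed simp
  moreover have "(\<lambda>n. LINT x|lebesgue. indicator {..real n} x * f x) \<longlonglongrightarrow> 0"
    using l(2) primitive_half_line[OF p ii l(1)] by simp
  ultimately show ?thesis using LIMSEQ_unique by fastforce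
qed

subsection \<open>The energy form below the spectrum\<close>

text \<open>The bound holds at every point, not merely almost everywhere; the given coefficients are
  later replaced by truncated representatives for which this is true.\<close>

definition bdd_by :: "real \<Rightarrow> (real \<Rightarrow> real) \<Rightarrow> bool" where
  "bdd_by K f \<longleftrightarrow> f \<in> borel_measurable lebesgue \<and> (\<forall>x. \<bar>f x\<bar> \<le> K)"

lemma bdd_byD:
  assumes "bdd_by K f"
  shows bdd_by_borel [measurable_dest]: "f \<in> borel_measurable lebesgue"
    and bdd_by_abs: "\<bar>f x\<bar> \<le> K"
  using assms by (auto simp: bdd_by_def)

lemma bdd_by_shift: "bdd_by K f \<Longrightarrow> bdd_by K (\<lambda>x. f (x + t))"
  by (simp add: bdd_by_def borel_measurable_shift)

lemma bdd_by_reflect: "bdd_by K f \<Longrightarrow> bdd_by K (\<lambda>x. f (- x))"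
  by (simp add: bdd_by_def borel_measurable_reflect)

lemma bdd_by_diff:
  assumes f: "bdd_by K f" and g: "bdd_by L g" shows "bdd_by (K + L) (\<lambda>x. f x - g x)"
  unfolding bdd_by_def
proof
  show "(\<lambda>x. f x - g x) \<in> borel_measurable lebesgue" using f g by measurable
  have "\<bar>f x - g x\<bar> \<le> K + L" for x using bdd_by_abs[OF f, of x] bdd_by_abs[OF g, of x] by linarith
  then show "\<forall>x. \<bar>f x - g x\<bar> \<le> K + L" by blast
qed

lemma bdd_by_const: "bdd_by \<bar>c\<bar> (\<lambda>x. c)"
  by (simp add: bdd_by_def)

lemma bdd_by_nonneg: "bdd_by K f \<Longrightarrow> 0 \<le> K"
  using bdd_by_abs abs_ge_zero order_trans by blast

text \<open>The derivative is a separate argument, so that no representative has to be selected by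
  \<open>weak_deriv\<close> before the final step; \<open>bform\<close> is the polarisation.\<close>

definition qform :: "(real \<Rightarrow> real) \<Rightarrow> (real \<Rightarrow> real) \<Rightarrow> (real \<Rightarrow> real) \<Rightarrow> real" where
  "qform U u g = (LINT x|lebesgue. (g x)\<^sup>2 + U x * (u x)\<^sup>2)"

definition bform :: "(real \<Rightarrow> real) \<Rightarrow> (real \<Rightarrow> real) \<Rightarrow> (real \<Rightarrow> real) \<Rightarrow> (real \<Rightarrow> real) \<Rightarrow> (real \<Rightarrow> real) \<Rightarrow> real" where
  "bform U u g v h = (LINT x|lebesgue. g x * h x + U x * (u x * v x))"

lemma bdd_mult_integrable:
  assumes U: "bdd_by K U" and f: "integrable lebesgue f"
  shows "integrable lebesgue (\<lambda>x. U x * f x)"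
proof (rule Bochner_Integration.integrable_bound)
  show "integrable lebesgue (\<lambda>x. K * f x)" using f by simp
  have [measurable]: "f \<in> borel_measurable lebesgue" using f by (rule borel_measurable_integrable)
  show "(\<lambda>x. U x * f x) \<in> borel_measurable lebesgue" using U by measurable
  show "AE x in lebesgue. norm (U x * f x) \<le> norm (K * f x)"
    using bdd_by_abs[OF U] bdd_by_nonneg[OF U] by (intro AE_I2) (simp add: abs_mult mult_right_mono)
qed

lemma bform_integrable:
  assumes "bdd_by K U" "H1pair u g" "H1pair v h"
  shows "integrable lebesgue (\<lambda>x. g x * h x + U x * (u x * v x))"
  using assms by (intro Bochner_Integration.integrable_add bdd_mult_integrable sq_integrable_mult H1pairD)

lemma qform_integrable:
  assumes "bdd_by K U" "H1pair u g"
  shows "integrable lebesgue (\<lambda>x. (g x)\<^sup>2 + U x * (u x)\<^sup>2)"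
  using assms by (intro Bochner_Integration.integrable_add bdd_mult_integrable H1pairD)

lemma qform_add:
  assumes U: "bdd_by K U" and u: "H1pair u g" and v: "H1pair v h"
  shows "qform U (\<lambda>x. u x + t * v x) (\<lambda>x. g x + t * h x) = qform U u g + 2 * t * bform U u g v h + t\<^sup>2 * qform U v h"
proof -
  have "qform U (\<lambda>x. u x + t * v x) (\<lambda>x. g x + t * h x) =
    (LINT x|lebesgue. ((g x)\<^sup>2 + U x * (u x)\<^sup>2) + (2 * t * (g x * h x + U x * (u x * v x)) + t\<^sup>2 * ((h x)\<^sup>2 + U x * (v x)\<^sup>2)))"
    unfolding qform_def by (rule Bochner_Integration.integral_cong) (auto simp: power2_eq_square algebra_simps)
  also have "\<dots> = qform U u g + ((LINT x|lebesgue. 2 * t * (g x * h x + U x * (u x * v x))) + (LINT x|lebesgue. t\<^sup>2 * ((h x)\<^sup>2 + U x * (v x)\<^sup>2)))"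
    unfolding qform_def
    using qform_integrable[OF U u] qform_integrable[OF U v] bform_integrable[OF U u v]
    by (subst Bochner_Integration.integral_add) (auto intro!: Bochner_Integration.integrable_add simp del: distrib_left)
  finally show ?thesis by (simp add: qform_def bform_def)
qed

lemma qform_cmult: "qform U (\<lambda>x. c * u x) (\<lambda>x. c * g x) = c\<^sup>2 * qform U u g"
proof -
  have "qform U (\<lambda>x. c * u x) (\<lambda>x. c * g x) = (LINT x|lebesgue. c\<^sup>2 * ((g x)\<^sup>2 + U x * (u x)\<^sup>2))"
    unfolding qform_def by (rule Bochner_Integration.integral_cong) (auto simp: power_mult_distrib algebra_simps)
  then show ?thesis by (simp add: qform_def)
qed

lemma qform_split:
  assumes U: "bdd_by K U" and u: "H1pair u g"
  shows "qform U u g = (LINT x|lebesgue. (g x)\<^sup>2) + (LINT x|lebesgue. U x * (u x)\<^sup>2)"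
  unfolding qform_def
  by (intro Bochner_Integration.integral_add bdd_mult_integrable[OF U] H1pairD[OF u])

lemma qform_add_const:
  assumes U: "bdd_by K U" and u: "H1pair u g"
  shows "qform (\<lambda>x. U x - t) u g = qform U u g - t * (LINT x|lebesgue. (u x)\<^sup>2)"
proof -
  have "qform (\<lambda>x. U x - t) u g = (LINT x|lebesgue. ((g x)\<^sup>2 + U x * (u x)\<^sup>2) - t * (u x)\<^sup>2)"
    unfolding qform_def by (rule Bochner_Integration.integral_cong) (auto simp: algebra_simps)
  also have "\<dots> = qform U u g - (LINT x|lebesgue. t * (u x)\<^sup>2)"
    unfolding qform_def by (intro Bochner_Integration.integral_diff qform_integrable[OF U u] integrable_mult_right H1pairD[OF u])
  finally show ?thesis by simp
qed

lemma potential_lower: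
  assumes U: "bdd_by K U" and u: "H1pair u g"
  shows "- K * (LINT x|lebesgue. (u x)\<^sup>2) \<le> (LINT x|lebesgue. U x * (u x)\<^sup>2)"
proof -
  have "(LINT x|lebesgue. - K * (u x)\<^sup>2) \<le> (LINT x|lebesgue. U x * (u x)\<^sup>2)"
  proof (rule integral_mono)
    show "integrable lebesgue (\<lambda>x. - K * (u x)\<^sup>2)" "integrable lebesgue (\<lambda>x. U x * (u x)\<^sup>2)"
      by (intro integrable_mult_right bdd_mult_integrable[OF U] H1pairD[OF u])+
    show "- K * (u x)\<^sup>2 \<le> U x * (u x)\<^sup>2" for x
      using bdd_by_abs[OF U, of x] by (intro mult_right_mono) auto
  qed
  then show ?thesis by simp
qed

lemma qform_shift: "qform (\<lambda>x. U (x + t)) (\<lambda>x. u (x + t)) (\<lambda>x. g (x + t)) = qform U u g"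
  unfolding qform_def using integral_shift[of "\<lambda>x. (g x)\<^sup>2 + U x * (u x)\<^sup>2" t] .

lemma qform_reflect: "qform (\<lambda>x. U (- x)) (\<lambda>x. u (- x)) (\<lambda>x. - g (- x)) = qform U u g"
  unfolding qform_def using integral_reflect[of "\<lambda>x. (g x)\<^sup>2 + U x * (u x)\<^sup>2"] by simp

section \<open>From the complex resolvent to real solutions\<close>

lemma locally_integrable_Re:
  assumes "locally_integrable w" shows "locally_integrable (\<lambda>x. Re (w x))"
  using assms integrable_Re unfolding locally_integrable_def set_integrable_def by fastforce

lemma has_weak_deriv_Re:
  assumes w: "has_weak_deriv w z"
  shows "has_weak_deriv (\<lambda>x. Re (w x)) (\<lambda>x. Re (z x))"
  unfolding has_weak_deriv_def
proof (intro conjI allI impI)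
  have wl: "locally_integrable w" and zl: "locally_integrable z" using w by (auto simp: has_weak_deriv_def)
  then show "locally_integrable (\<lambda>x. Re (w x))" "locally_integrable (\<lambda>x. Re (z x))"
    by (auto intro: locally_integrable_Re)
  fix \<phi> \<phi>' :: "real \<Rightarrow> real"
  assume *: "(\<forall>x. (\<phi> has_real_derivative \<phi>' x) (at x)) \<and> continuous_on UNIV \<phi>' \<and> bounded {x. \<phi> x \<noteq> 0}"
  then obtain R where R: "\<And>x. \<phi> x \<noteq> 0 \<Longrightarrow> \<bar>x\<bar> \<le> R" unfolding bounded_iff by auto
  have z: "\<phi> x = 0" if "x \<notin> {-R..R}" for x using R[of x] that by (cases "\<phi> x = 0") (auto simp: abs_le_iff)
  have z': "\<phi>' x = 0" if "x \<notin> {-R..R}" for x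
    using derivative_zero_outside[of \<phi> \<phi>' R x] * z that by blast
  have c: "continuous_on UNIV \<phi>" using * primitive_C1 primitive_continuous by blast
  have int: "integrable lebesgue (\<lambda>x. f x *\<^sub>R y x)"
    if f: "continuous_on UNIV f" "\<And>x. x \<notin> {-R..R} \<Longrightarrow> f x = 0" and y: "locally_integrable y" for f :: "real \<Rightarrow> real" and y :: "real \<Rightarrow> complex"
  proof -
    obtain C where C: "\<And>x. x \<in> {-R..R} \<Longrightarrow> \<bar>f x\<bar> \<le> C" using continuous_bounded_interval[OF f(1)] by metis
    have yi: "integrable lebesgue (\<lambda>x. indicator {-R..R} x *\<^sub>R y x)"
      using y by (simp add: locally_integrable_def set_integrable_def)
    have "integrable lebesgue (\<lambda>x. f x *\<^sub>R (indicator {-R..R} x *\<^sub>R y x))"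
    proof (rule Bochner_Integration.integrable_bound)
      show "integrable lebesgue (\<lambda>x. C *\<^sub>R (indicator {-R..R} x *\<^sub>R y x))"
        by (rule integrable_scaleR_right) (rule yi)
      show "(\<lambda>x. f x *\<^sub>R (indicator {-R..R} x *\<^sub>R y x)) \<in> borel_measurable lebesgue"
        by (rule borel_measurable_scaleR[OF borel_measurable_lebesgue_continuous[OF f(1)] borel_measurable_integrable[OF yi]])
      show "AE x in lebesgue. norm (f x *\<^sub>R (indicator {-R..R} x *\<^sub>R y x)) \<le> norm (C *\<^sub>R (indicator {-R..R} x *\<^sub>R y x))"
      proof (rule AE_I2)
        fix x show "norm (f x *\<^sub>R (indicator {-R..R} x *\<^sub>R y x)) \<le> norm (C *\<^sub>R (indicator {-R..R} x *\<^sub>R y x))"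
          using C[of x] by (cases "x \<in> {-R..R}") (auto intro!: mult_right_mono)
      qed
    qed
    moreover have "(\<lambda>x. f x *\<^sub>R (indicator {-R..R} x *\<^sub>R y x)) = (\<lambda>x. f x *\<^sub>R y x)"
      using f(2) by (intro ext) (auto simp: indicator_def)
    ultimately show ?thesis by simp
  qed
  have i1: "integrable lebesgue (\<lambda>x. \<phi>' x *\<^sub>R w x)" using * by (intro int wl z') auto
  have i2: "integrable lebesgue (\<lambda>x. \<phi> x *\<^sub>R z x)" by (intro int zl z c)
  have "(LINT x|lebesgue. \<phi>' x *\<^sub>R w x) = - (LINT x|lebesgue. \<phi> x *\<^sub>R z x)"
    using w * unfolding has_weak_deriv_def by blast
  then have "Re (LINT x|lebesgue. \<phi>' x *\<^sub>R w x) = - Re (LINT x|lebesgue. \<phi> x *\<^sub>R z x)" by simp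
  then show "(LINT x|lebesgue. \<phi>' x *\<^sub>R Re (w x)) = - (LINT x|lebesgue. \<phi> x *\<^sub>R Re (z x))"
    using integral_Re[OF i1] integral_Re[OF i2] by simp
qed

lemma has_weak_deriv_weak_deriv:
  assumes "u \<in> H1" shows "has_weak_deriv u (weak_deriv u)"
  using assms someI_ex[of "has_weak_deriv u"] unfolding H1_def weak_deriv_def by blast

lemma primitive_cong_AE:
  assumes p: "primitive u g" and ae: "AE x in lebesgue. g x = h x"
  shows "primitive u h"
proof -
  have hm: "h \<in> borel_measurable lebesgue"
    using borel_measurable_AE[OF primitive_borel'[OF p] ae] .
  note gm = primitive_borel'[OF p]
  have ae': "AE x in lebesgue. indicator {a..b} x *\<^sub>R g x = indicator {a..b} x *\<^sub>R h x" for a b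
    using ae by eventually_elim simp
  have m: "(\<lambda>x. indicator {a..b} x *\<^sub>R g x) \<in> borel_measurable lebesgue"
    "(\<lambda>x. indicator {a..b} x *\<^sub>R h x) \<in> borel_measurable lebesgue" for a b :: real
    using gm hm by measurable
  have "integrable lebesgue (\<lambda>x. indicator {a..b} x *\<^sub>R h x)" for a b
    by (rule integrable_cong_AE_imp[OF primitive_integrable[OF p, of a b, unfolded set_integrable_def] m(2) ae'])
  moreover have "(LINT x|lebesgue. indicator {a..b} x *\<^sub>R g x) = (LINT x|lebesgue. indicator {a..b} x *\<^sub>R h x)" for a b
    by (rule integral_cong_AE[OF m ae'])
  ultimately show ?thesis
    using primitive_diff[OF p]
    unfolding primitive_def locally_integrable_def set_integrable_def set_lebesgue_integral_def by auto
qed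

lemma sq_integrable_cong_AE:
  assumes f: "sq_integrable f" and ae: "AE x in lebesgue. f x = h x"
  shows "sq_integrable h" and "(LINT x|lebesgue. (f x)\<^sup>2) = (LINT x|lebesgue. (h x)\<^sup>2)"
proof -
  have hm [measurable]: "h \<in> borel_measurable lebesgue"
    using borel_measurable_AE[OF sq_integrable_borel[OF f] ae] .
  have ae2: "AE x in lebesgue. (f x)\<^sup>2 = (h x)\<^sup>2" using ae by eventually_elim simp
  have m: "(\<lambda>x. (h x)\<^sup>2) \<in> borel_measurable lebesgue" by measurable
  show "sq_integrable h"
    unfolding sq_integrable_def
    using hm integrable_cong_AE_imp[OF sq_integrable_square[OF f] m ae2] by blast
  show "(LINT x|lebesgue. (f x)\<^sup>2) = (LINT x|lebesgue. (h x)\<^sup>2)"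
    by (rule integral_cong_AE[OF _ m ae2]) (rule borel_measurable_integrable[OF sq_integrable_square[OF f]])
qed

lemma sq_integrable_Re:
  assumes w: "w \<in> L2"
  shows "sq_integrable (\<lambda>x. Re (w x))"
    and "(LINT x|lebesgue. (Re (w x))\<^sup>2) \<le> (LINT x|lebesgue. (norm (w x))\<^sup>2)"
proof -
  have wm: "w \<in> borel_measurable lebesgue" and wi: "integrable lebesgue (\<lambda>x. (norm (w x))\<^sup>2)"
    using w by (auto simp: L2_def)
  have m [measurable]: "(\<lambda>x. Re (w x)) \<in> borel_measurable lebesgue" using wm by measurable
  have le: "(Re (w x))\<^sup>2 \<le> (norm (w x))\<^sup>2" for x
    using abs_Re_le_cmod[of "w x"] by (metis abs_ge_zero power2_abs power_mono)
  have "integrable lebesgue (\<lambda>x. (Re (w x))\<^sup>2)"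
    by (rule Bochner_Integration.integrable_bound[OF wi]) (use le in auto)
  then show "sq_integrable (\<lambda>x. Re (w x))"
    "(LINT x|lebesgue. (Re (w x))\<^sup>2) \<le> (LINT x|lebesgue. (norm (w x))\<^sup>2)"
    using wi m le by (auto simp: sq_integrable_def intro: integral_mono)
qed

lemma has_weak_deriv_H1pair:
  fixes u g :: "real \<Rightarrow> real"
  assumes w: "has_weak_deriv u g" and u: "sq_integrable u" and g: "sq_integrable g"
  obtains v where "H1pair v g" "AE x in lebesgue. u x = v x"
proof -
  obtain v where v: "primitive v g" "AE x in lebesgue. v x = u x" by (rule weak_deriv_imp_primitive[OF w])
  have ae: "AE x in lebesgue. u x = v x" using v(2) by eventually_elim simp
  have "H1pair v g" unfolding H1pair_def using v(1) g sq_integrable_cong_AE(1)[OF u ae] by blast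
  then show ?thesis using ae by (rule that)
qed

lemma H1pair_by_parts:
  assumes u: "H1pair u g" and v: "H1pair v h"
  shows "(LINT x|lebesgue. g x * v x) + (LINT x|lebesgue. h x * u x) = 0"
proof -
  have i: "integrable lebesgue (\<lambda>x. g x * v x)" "integrable lebesgue (\<lambda>x. h x * u x)"
    by (intro sq_integrable_mult H1pairD[OF u] H1pairD[OF v])+
  have "(LINT x|lebesgue. g x * v x + h x * u x) = 0"
  proof (rule primitive_full_line[OF primitive_mult[OF H1pairD(1)[OF u] H1pairD(1)[OF v]]])
    show "integrable lebesgue (\<lambda>x. g x * v x + h x * u x)" using i by simp
    show "(\<lambda>n. u (- real n) * v (- real n)) \<longlonglongrightarrow> 0" "(\<lambda>n. u (real n) * v (real n)) \<longlonglongrightarrow> 0"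
      using tendsto_mult[OF H1pair_tendsto(1)[OF u] H1pair_tendsto(1)[OF v]]
        tendsto_mult[OF H1pair_tendsto(2)[OF u] H1pair_tendsto(2)[OF v]] by simp_all
  qed
  then show ?thesis using i by simp
qed

text \<open>For a real right-hand side the real part of the complex solution is again a solution, as
  \<open>z\<close> and the potential are real, and it obeys the same bound because taking real parts
  does not increase the norm.\<close>

lemma resolvent_real:
  assumes z: "complex_of_real z \<in> resolvent_set V"
    and U: "bdd_by K U" and UV: "AE x in lebesgue. V x = U x"
  shows "\<exists>C\<ge>0. \<forall>f. sq_integrable f \<longrightarrow> (\<exists>w w' w''. H1pair w w' \<and> H1pair w' w'' \<and>
        (AE x in lebesgue. - w'' x + (U x - z) * w x = f x) \<and>
        (LINT x|lebesgue. (w x)\<^sup>2) \<le> C * (LINT x|lebesgue. (f x)\<^sup>2))"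
proof -
  from z obtain C where C: "\<And>u. u \<in> H2 \<Longrightarrow> L2_norm u \<le> C * L2_norm (\<lambda>x. schroedinger_op V u x - complex_of_real z * u x)"
    unfolding resolvent_set_def by blast
  show ?thesis
  \<comment> \<open>Squaring passes from norms to their squares and makes the constant nonnegative
    whatever the sign of \<open>C\<close>.\<close>
  proof (intro exI[of _ "C\<^sup>2"] conjI allI impI)
    show "0 \<le> C\<^sup>2" by simp
    fix f assume f: "sq_integrable f"
    define F where "F x = complex_of_real (f x)" for x
    have "F \<in> borel_measurable lebesgue" unfolding F_def using f by measurable
    then have "F \<in> L2"
      using sq_integrable_square[OF f] unfolding L2_def by (simp add: F_def)
    then obtain w where w: "w \<in> H2" and eq: "AE x in lebesgue. schroedinger_op V w x - complex_of_real z * w x = F x"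
      using z unfolding resolvent_set_def by blast
    define w1 where "w1 = weak_deriv w"
    define w2 where "w2 = weak_deriv w1"
    have wH: "w \<in> H1" "w1 \<in> H1" using w by (auto simp: H2_def w1_def)
    then have d: "has_weak_deriv w w1" "has_weak_deriv w1 w2"
      using has_weak_deriv_weak_deriv by (auto simp: w1_def w2_def)
    have wL: "w \<in> L2" "w1 \<in> L2" using wH by (auto simp: H1_def)
    have eqr: "AE x in lebesgue. - Re (w2 x) + (U x - z) * Re (w x) = f x"
      using eq UV
    proof eventually_elim
      case (elim x)
      then have "Re (schroedinger_op V w x - complex_of_real z * w x) = f x" by (simp add: F_def)
      then show ?case using elim(2) by (simp add: schroedinger_op_def w1_def w2_def algebra_simps)
    qed
    obtain W0 where W0: "H1pair W0 (\<lambda>x. Re (w1 x))" "AE x in lebesgue. Re (w x) = W0 x"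
      using has_weak_deriv_H1pair[OF has_weak_deriv_Re[OF d(1)] sq_integrable_Re(1)[OF wL(1)] sq_integrable_Re(1)[OF wL(2)]] .
    \<comment> \<open>The equation expresses the second derivative through \<open>w\<close> and
      \<open>f\<close>; its square integrability is read off from there.\<close>
    have s: "sq_integrable (\<lambda>x. (U x - z) * Re (w x) - f x)"
    proof (intro sq_integrable_diff f)
      show "sq_integrable (\<lambda>x. (U x - z) * Re (w x))"
      proof (rule sq_integrable_bounded_mult[OF sq_integrable_Re(1)[OF wL(1)]])
        show "(\<lambda>x. U x - z) \<in> borel_measurable lebesgue" using U by measurable
        show "\<bar>U x - z\<bar> \<le> K + \<bar>z\<bar>" for x using bdd_by_abs[OF U, of x] by linarith
      qed
    qed
    have s2: "sq_integrable (\<lambda>x. Re (w2 x))"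
      by (rule sq_integrable_cong_AE(1)[OF s]) (use eqr in \<open>eventually_elim, simp\<close>)
    obtain W1 where W1: "H1pair W1 (\<lambda>x. Re (w2 x))" "AE x in lebesgue. Re (w1 x) = W1 x"
      using has_weak_deriv_H1pair[OF has_weak_deriv_Re[OF d(2)] sq_integrable_Re(1)[OF wL(2)] s2] .
    have H: "H1pair W0 W1"
      unfolding H1pair_def
      using primitive_cong_AE[OF H1pairD(1)[OF W0(1)] W1(2)] H1pairD(2)[OF W0(1)] H1pairD(2)[OF W1(1)] by blast
    have eqf: "AE x in lebesgue. - Re (w2 x) + (U x - z) * W0 x = f x"
      using eqr W0(2) by eventually_elim simp
    have nn: "0 \<le> (LINT x|lebesgue. (norm (y x))\<^sup>2)" for y :: "real \<Rightarrow> complex"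
      by (intro integral_nonneg_AE AE_I2) simp
    have "L2_norm (\<lambda>x. schroedinger_op V w x - complex_of_real z * w x) = L2_norm F"
    proof -
      have m: "F \<in> borel_measurable lebesgue" using \<open>F \<in> L2\<close> by (simp add: L2_def)
      have ae: "AE x in lebesgue. F x = schroedinger_op V w x - complex_of_real z * w x"
        using eq by eventually_elim simp
      have m2: "(\<lambda>x. schroedinger_op V w x - complex_of_real z * w x) \<in> borel_measurable lebesgue"
        by (rule borel_measurable_AE[OF m ae])
      have "(LINT x|lebesgue. (norm (schroedinger_op V w x - complex_of_real z * w x))\<^sup>2) = (LINT x|lebesgue. (norm (F x))\<^sup>2)"
      proof (rule integral_cong_AE)
        show "(\<lambda>x. (norm (schroedinger_op V w x - complex_of_real z * w x))\<^sup>2) \<in> borel_measurable lebesgue"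
          using m2 by measurable
        show "(\<lambda>x. (norm (F x))\<^sup>2) \<in> borel_measurable lebesgue" using m by measurable
        show "AE x in lebesgue. (norm (schroedinger_op V w x - complex_of_real z * w x))\<^sup>2 = (norm (F x))\<^sup>2"
          using eq by eventually_elim simp
      qed
      then show ?thesis by (simp add: L2_norm_def)
    qed
    then have "L2_norm w \<le> C * L2_norm F" using C[OF w] by simp
    moreover have "0 \<le> L2_norm w" by (simp add: L2_norm_def nn)
    ultimately have "(L2_norm w)\<^sup>2 \<le> (C * L2_norm F)\<^sup>2" by (rule power_mono)
    then have "(LINT x|lebesgue. (norm (w x))\<^sup>2) \<le> C\<^sup>2 * (LINT x|lebesgue. (norm (F x))\<^sup>2)"
      by (simp add: L2_norm_def nn power_mult_distrib)
    also have "(\<lambda>x. (norm (F x))\<^sup>2) = (\<lambda>x. (f x)\<^sup>2)" by (simp add: F_def)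
    finally have "(LINT x|lebesgue. (Re (w x))\<^sup>2) \<le> C\<^sup>2 * (LINT x|lebesgue. (f x)\<^sup>2)"
      using sq_integrable_Re(2)[OF wL(1)] by linarith
    then have bound: "(LINT x|lebesgue. (W0 x)\<^sup>2) \<le> C\<^sup>2 * (LINT x|lebesgue. (f x)\<^sup>2)"
      using sq_integrable_cong_AE(2)[OF sq_integrable_Re(1)[OF wL(1)] W0(2)] by simp
    show "\<exists>w w' w''. H1pair w w' \<and> H1pair w' w'' \<and>
        (AE x in lebesgue. - w'' x + (U x - z) * w x = f x) \<and>
        (LINT x|lebesgue. (w x)\<^sup>2) \<le> C\<^sup>2 * (LINT x|lebesgue. (f x)\<^sup>2)"
      by (intro exI conjI) (rule H, rule W1(1), rule eqf, rule bound)
  qed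
qed

text \<open>If \<open>w\<close> solves \<open>(H - z) w = u\<close>, then \<open>\<parallel>u\<parallel>\<^sup>2 = b(w, u)\<close> for the form \<open>b\<close> of \<open>H - z\<close>;
  the Cauchy-Schwarz inequality for \<open>b\<close> and the bound on the resolvent give a spectral gap.\<close>

lemma spectral_gap:
  assumes z: "complex_of_real z \<in> resolvent_set V"
    and U: "bdd_by K U" and UV: "AE x in lebesgue. V x = U x"
    and nn: "\<And>u g. H1pair u g \<Longrightarrow> 0 \<le> qform (\<lambda>x. U x - z) u g"
  shows "\<exists>d>0. \<forall>u g. H1pair u g \<longrightarrow> d * (LINT x|lebesgue. (u x)\<^sup>2) \<le> qform (\<lambda>x. U x - z) u g"
proof -
  define Uz where "Uz x = U x - z" for x
  have Uzb: "bdd_by (K + \<bar>z\<bar>) Uz"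
    unfolding Uz_def by (rule bdd_by_diff[OF U bdd_by_const])
  obtain C where C: "C \<ge> 0"
    "\<And>f. sq_integrable f \<Longrightarrow> \<exists>w w' w''. H1pair w w' \<and> H1pair w' w'' \<and>
        (AE x in lebesgue. - w'' x + (U x - z) * w x = f x) \<and>
        (LINT x|lebesgue. (w x)\<^sup>2) \<le> C * (LINT x|lebesgue. (f x)\<^sup>2)"
    using resolvent_real[OF z U UV] by blast
  have main: "(LINT x|lebesgue. (u x)\<^sup>2) \<le> (1 + C) * qform Uz u g" if u: "H1pair u g" for u g
  proof -
    obtain w w' w'' where w: "H1pair w w'" "H1pair w' w''"
        and eq: "AE x in lebesgue. - w'' x + (U x - z) * w x = u x"
        and le: "(LINT x|lebesgue. (w x)\<^sup>2) \<le> C * (LINT x|lebesgue. (u x)\<^sup>2)"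
      using C(2)[OF H1pairD(2)[OF u]] by blast
    \<comment> \<open>The weak form of the resolvent equation. There are no boundary terms because
      H^1 functions vanish at infinity.\<close>
    have test: "(LINT x|lebesgue. u x * v x) = bform Uz w w' v h" if v: "H1pair v h" for v h
    proof -
      have i: "integrable lebesgue (\<lambda>x. w'' x * v x)" "integrable lebesgue (\<lambda>x. h x * w' x)"
        "integrable lebesgue (\<lambda>x. Uz x * (w x * v x))" "integrable lebesgue (\<lambda>x. u x * v x)"
        by (intro bdd_mult_integrable[OF Uzb] sq_integrable_mult H1pairD[OF w(1)] H1pairD[OF w(2)] H1pairD[OF v] H1pairD[OF u])+
      have "(LINT x|lebesgue. u x * v x) = (LINT x|lebesgue. - (w'' x * v x) + Uz x * (w x * v x))"
      proof (rule integral_cong_AE)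
        show "(\<lambda>x. u x * v x) \<in> borel_measurable lebesgue" using i by (simp add: borel_measurable_integrable)
        have "integrable lebesgue (\<lambda>x. - (w'' x * v x) + Uz x * (w x * v x))" using i by simp
        then show "(\<lambda>x. - (w'' x * v x) + Uz x * (w x * v x)) \<in> borel_measurable lebesgue"
          by (rule borel_measurable_integrable)
        show "AE x in lebesgue. u x * v x = - (w'' x * v x) + Uz x * (w x * v x)"
          using eq
        proof eventually_elim
          case (elim x)
          then show ?case unfolding elim[symmetric] Uz_def by (simp add: algebra_simps)
        qed
      qed
      also have "\<dots> = - (LINT x|lebesgue. w'' x * v x) + (LINT x|lebesgue. Uz x * (w x * v x))"
        using i by simp
      also have "- (LINT x|lebesgue. w'' x * v x) = (LINT x|lebesgue. h x * w' x)"
        using H1pair_by_parts[OF w(2) v] by simp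
      also have "(LINT x|lebesgue. h x * w' x) + (LINT x|lebesgue. Uz x * (w x * v x)) = bform Uz w w' v h"
        unfolding bform_def using i by (simp add: mult.commute)
      finally show ?thesis .
    qed
    let ?N = "LINT x|lebesgue. (u x)\<^sup>2"
    have N0: "0 \<le> ?N" by (intro integral_nonneg_AE AE_I2) simp
    have b1: "bform Uz w w' u g = ?N" using test[OF u] by (simp add: power2_eq_square)
    have qw: "qform Uz w w' = (LINT x|lebesgue. u x * w x)"
      using test[OF w(1)] by (simp add: bform_def qform_def power2_eq_square)
    have cs: "(bform Uz w w' u g)\<^sup>2 \<le> qform Uz w w' * qform Uz u g"
    proof (rule quadratic_nonneg_imp_discriminant)
      fix t
      have "H1pair (\<lambda>x. w x + t * u x) (\<lambda>x. w' x + t * g x)"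
        by (rule H1pair_add[OF w(1) H1pair_cmult[OF u]])
      from nn[OF this] show "0 \<le> qform Uz w w' + 2 * t * bform Uz w w' u g + t\<^sup>2 * qform Uz u g"
        using qform_add[OF Uzb w(1) u, of t] by (simp add: Uz_def[abs_def])
      show "0 \<le> qform Uz u g" using nn[OF u] by (simp add: Uz_def[abs_def])
    qed
    \<comment> \<open>Young's inequality and the resolvent bound control the form at
      \<open>w\<close>, which equals the product of \<open>u\<close> and \<open>w\<close>, by the
      squared norm of \<open>u\<close>.\<close>
    have "2 * (u x * w x) \<le> (u x)\<^sup>2 + (w x)\<^sup>2" for x
      using zero_le_power2[of "u x - w x"] by (simp add: power2_diff)
    then have "(LINT x|lebesgue. 2 * (u x * w x)) \<le> (LINT x|lebesgue. (u x)\<^sup>2 + (w x)\<^sup>2)"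
      by (intro integral_mono integrable_mult_right sq_integrable_mult Bochner_Integration.integrable_add H1pairD[OF u] H1pairD[OF w(1)])
    also have "\<dots> = ?N + (LINT x|lebesgue. (w x)\<^sup>2)"
      by (intro Bochner_Integration.integral_add H1pairD[OF u] H1pairD[OF w(1)])
    finally have "2 * qform Uz w w' \<le> ?N + (LINT x|lebesgue. (w x)\<^sup>2)" unfolding qw by simp
    also have "\<dots> \<le> (1 + C) * ?N" using le by (simp only: distrib_right mult_1_left add_left_mono)
    finally have "2 * qform Uz w w' \<le> (1 + C) * ?N" .
    moreover have "0 \<le> (1 + C) * ?N" using N0 C(1) by simp
    ultimately have "qform Uz w w' \<le> (1 + C) * ?N" by linarith
    then have "qform Uz w w' * qform Uz u g \<le> (1 + C) * ?N * qform Uz u g"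
      using nn[OF u] by (intro mult_right_mono) (auto simp: Uz_def[abs_def])
    then have "?N * ?N \<le> ?N * ((1 + C) * qform Uz u g)"
      using cs b1 by (simp add: power2_eq_square algebra_simps)
    then show ?thesis
    proof (cases "?N = 0")
      case True
      then show ?thesis using nn[OF u] C(1) by (simp add: Uz_def[abs_def])
    next
      case False
      then have "0 < ?N" using N0 by linarith
      then show ?thesis using \<open>?N * ?N \<le> _\<close> by (rule mult_left_le_imp_le[rotated])
    qed
  qed
  show ?thesis
  proof (intro exI[of _ "1 / (1 + C)"] conjI allI impI)
    show "0 < 1 / (1 + C)" using C(1) by simp
    show "1 / (1 + C) * (LINT x|lebesgue. (u x)\<^sup>2) \<le> qform (\<lambda>x. U x - z) u g" if "H1pair u g" for u g
      using main[OF that] C(1) by (simp add: Uz_def[abs_def] field_simps)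
  qed
qed

text \<open>If no lower bound of the form exceeded \<open>lam\<close>, the best one would be
  \<open>lam + m\<close> with \<open>m \<le> 0\<close>, a point of the resolvent set. The spectral
  gap there improves the best bound, a contradiction. The resulting L^2 estimate is then combined
  with the boundedness of the potential to control the derivative as well.\<close>

lemma coercive_below_spectrum:
  assumes spec: "\<forall>z \<in> schroedinger_spectrum V. lam < Re z"
    and U: "bdd_by K U" and UV: "AE x in lebesgue. V x = U x"
  shows "\<exists>d>0. \<forall>u g. H1pair u g \<longrightarrow>
    d * ((LINT x|lebesgue. (u x)\<^sup>2) + (LINT x|lebesgue. (g x)\<^sup>2)) \<le> qform (\<lambda>x. U x - lam) u g"
proof -
  let ?N = "\<lambda>u. LINT x|(lebesgue::real measure). (u x :: real)\<^sup>2"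
  define T where "T = {t. \<forall>u g. H1pair u g \<longrightarrow> (lam + t) * ?N u \<le> qform U u g}"
  have N0: "0 \<le> ?N u" for u by (intro integral_nonneg_AE AE_I2) simp
  have low: "(LINT x|lebesgue. (g x)\<^sup>2) - K * ?N u \<le> qform U u g" if "H1pair u g" for u g
    using potential_lower[OF U that] qform_split[OF U that] by simp
  have "\<exists>t>0. t \<in> T"
  proof (rule ccontr)
    assume no: "\<not> (\<exists>t>0. t \<in> T)"
    \<comment> \<open>The potential is at least \<open>-K\<close>; thus the set of admissible shifts
      is not empty.\<close>
    have ne: "- K - lam \<in> T" unfolding T_def
    proof (intro CollectI allI impI)
      fix u g assume "H1pair u g"
      from low[OF this] have "- K * ?N u \<le> qform U u g"
        using N0[of g] by linarith
      then show "(lam + (- K - lam)) * ?N u \<le> qform U u g" by simp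
    qed
    have bdd: "bdd_above T" using no by (intro bdd_aboveI[of _ 0]) (meson not_le)
    define m where "m = Sup T"
    have m0: "m \<le> 0" unfolding m_def using ne no by (intro cSup_least) (blast, meson not_le)
    \<comment> \<open>The supremum is itself admissible: dividing by a positive norm turns the
      condition on shifts into an upper bound for them.\<close>
    have mT: "(lam + m) * ?N u \<le> qform U u g" if h: "H1pair u g" for u g
    proof (cases "?N u = 0")
      case True
      have "(lam + (- K - lam)) * ?N u \<le> qform U u g" using ne h unfolding T_def by blast
      then show ?thesis using True by simp
    next
      case False
      then have Np: "0 < ?N u" using N0[of u] by linarith
      have "m \<le> qform U u g / ?N u - lam"
        unfolding m_def
      proof (rule cSup_least)
        show "T \<noteq> {}" using ne by blast
        fix t assume "t \<in> T"
        then have "(lam + t) * ?N u \<le> qform U u g" using h by (auto simp: T_def)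
        then show "t \<le> qform U u g / ?N u - lam" using Np by (simp add: field_simps)
      qed
      then show ?thesis using Np by (simp add: field_simps)
    qed
    have res: "complex_of_real (lam + m) \<in> resolvent_set V"
    proof (rule ccontr)
      assume "\<not> ?thesis"
      then have "complex_of_real (lam + m) \<in> schroedinger_spectrum V" by (simp add: schroedinger_spectrum_def)
      then have "lam < Re (complex_of_real (lam + m))" using spec by blast
      then show False using m0 by simp
    qed
    have nn: "0 \<le> qform (\<lambda>x. U x - (lam + m)) u g" if "H1pair u g" for u g
      unfolding qform_add_const[OF U that] using mT[OF that] by simp
    obtain d where d: "d > 0" "\<And>u g. H1pair u g \<Longrightarrow> d * ?N u \<le> qform (\<lambda>x. U x - (lam + m)) u g"
      using spectral_gap[OF res U UV nn] by blast
    have "m + d \<in> T" unfolding T_def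
    proof (intro CollectI allI impI)
      fix u g assume "H1pair u g"
      from d(2)[OF this] show "(lam + (m + d)) * ?N u \<le> qform U u g"
        unfolding qform_add_const[OF U \<open>H1pair u g\<close>] by (simp add: algebra_simps)
    qed
    then have "m + d \<le> m" unfolding m_def by (rule cSup_upper[OF _ bdd])
    then show False using d(1) by simp
  qed
  then obtain t where t: "t > 0" "t \<in> T" by blast
  define B where "B = K + \<bar>lam\<bar>"
  have B0: "0 \<le> B" using bdd_by_nonneg[OF U] by (simp add: B_def)
  \<comment> \<open>Half of the form pays for the norm of \<open>u\<close>, through
    \<open>t\<close>. The other half pays for the derivative, through the estimate
    \<open>t * ?N g \<le> (t + B) * ?q\<close> obtained below.\<close>
  define d where "d = min (t / 2) (t / (2 * (t + B)))"
  show ?thesis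
  proof (intro exI[of _ d] conjI allI impI)
    show "d > 0" using t B0 by (simp add: d_def)
    fix u g assume h: "H1pair u g"
    let ?q = "qform (\<lambda>x. U x - lam) u g"
    have q1: "t * ?N u \<le> ?q"
      using t(2) h unfolding T_def qform_add_const[OF U h] by (auto simp: algebra_simps)
    have "- \<bar>lam\<bar> * ?N u \<le> - lam * ?N u" by (rule mult_right_mono[OF _ N0]) simp
    then have q2: "?N g - B * ?N u \<le> ?q"
      using low[OF h] unfolding qform_add_const[OF U h] by (simp add: B_def algebra_simps)
    have "t * ?N g \<le> t * (?q + B * ?N u)" using q2 t(1) by (intro mult_left_mono) auto
    also have "\<dots> = t * ?q + B * (t * ?N u)" by (simp add: algebra_simps)
    also have "\<dots> \<le> t * ?q + B * ?q" using q1 B0 by (intro add_left_mono mult_left_mono)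
    finally have q3: "t * ?N g \<le> (t + B) * ?q" by (simp add: algebra_simps)
    have "d * ?N u \<le> t / 2 * ?N u" unfolding d_def by (rule mult_right_mono[OF min.cobounded1 N0])
    moreover have "d * ?N g \<le> t / (2 * (t + B)) * ?N g" unfolding d_def by (rule mult_right_mono[OF min.cobounded2 N0])
    moreover have "t / (2 * (t + B)) * ?N g \<le> ?q / 2"
      using q3 t(1) B0 by (simp add: field_simps)
    ultimately show "d * (?N u + ?N g) \<le> ?q" using q1 unfolding distrib_left by linarith
  qed
qed

subsection \<open>Weak compactness\<close>

lemma fast_subsequence:
  assumes "\<And>n. eventually (P n) sequentially"
  shows "\<exists>r :: nat \<Rightarrow> nat. strict_mono r \<and> (\<forall>n. P n (r n))"
proof -
  have "\<forall>n. \<exists>N. \<forall>k\<ge>N. P n k" using assms by (simp add: eventually_sequentially)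
  then obtain M where M: "\<And>n k. M n \<le> k \<Longrightarrow> P n k" by metis
  \<comment> \<open>The sum dominates each threshold \<open>M n\<close>, and the summand
    \<open>n\<close> makes the sequence strictly increasing.\<close>
  define r where "r n = (\<Sum>i\<le>n. M i) + n" for n
  have "strict_mono r" unfolding strict_mono_Suc_iff r_def by simp
  moreover have "P n (r n)" for n
  proof (rule M)
    have "M n \<le> (\<Sum>i\<le>n. M i)" by (rule member_le_sum) auto
    then show "M n \<le> r n" by (simp add: r_def)
  qed
  ultimately show ?thesis by blast
qed

section \<open>Strong limits in L^2\<close>

lemma sq_integrable_Fatou:
  assumes f: "\<And>n::nat. sq_integrable (f n)" and h: "h \<in> borel_measurable lebesgue"
    and l: "AE x in lebesgue. (\<lambda>n. f n x) \<longlonglongrightarrow> h x"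
    and b: "\<And>n. (LINT x|lebesgue. (f n x)\<^sup>2) \<le> C"
  shows "sq_integrable h" "(LINT x|lebesgue. (h x)\<^sup>2) \<le> C"
proof -
  have C0: "0 \<le> C" by (rule order_trans[OF _ b[of 0]]) simp
  have fm [measurable]: "f n \<in> borel_measurable lebesgue" for n using f sq_integrable_borel by blast
  have "(\<integral>\<^sup>+x. ennreal ((h x)\<^sup>2) \<partial>lebesgue) = (\<integral>\<^sup>+x. liminf (\<lambda>n. ennreal ((f n x)\<^sup>2)) \<partial>lebesgue)"
  proof (rule nn_integral_cong_AE)
    show "AE x in lebesgue. ennreal ((h x)\<^sup>2) = liminf (\<lambda>n. ennreal ((f n x)\<^sup>2))"
      using l
    proof eventually_elim
      case (elim x)
      have "(\<lambda>n. ennreal ((f n x)\<^sup>2)) \<longlonglongrightarrow> ennreal ((h x)\<^sup>2)"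
        by (intro tendsto_ennrealI tendsto_power elim)
      from lim_imp_Liminf[OF sequentially_bot this] show ?case by (rule sym)
    qed
  qed
  also have "\<dots> \<le> liminf (\<lambda>n. \<integral>\<^sup>+x. ennreal ((f n x)\<^sup>2) \<partial>lebesgue)"
    by (rule nn_integral_liminf) measurable
  also have "\<dots> \<le> liminf (\<lambda>n. ennreal C)"
  proof (rule Liminf_mono, rule always_eventually, rule allI)
    fix n
    have "(\<integral>\<^sup>+x. ennreal ((f n x)\<^sup>2) \<partial>lebesgue) = ennreal (LINT x|lebesgue. (f n x)\<^sup>2)"
      by (rule nn_integral_eq_integral[OF sq_integrable_square[OF f]]) simp
    then show "(\<integral>\<^sup>+x. ennreal ((f n x)\<^sup>2) \<partial>lebesgue) \<le> ennreal C" using b by (simp add: ennreal_leI)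
  qed
  also have "\<dots> = ennreal C" by (rule Liminf_const[OF sequentially_bot])
  finally have le: "(\<integral>\<^sup>+x. ennreal ((h x)\<^sup>2) \<partial>lebesgue) \<le> ennreal C" .
  have m: "(\<lambda>x. (h x)\<^sup>2) \<in> borel_measurable lebesgue" using h by measurable
  have i: "integrable lebesgue (\<lambda>x. (h x)\<^sup>2)"
  proof (rule integrableI_nonneg[OF m])
    show "AE x in lebesgue. 0 \<le> (h x)\<^sup>2" by simp
    show "(\<integral>\<^sup>+x. ennreal ((h x)\<^sup>2) \<partial>lebesgue) < \<infinity>"
      using le_less_trans[OF le ennreal_less_top] by simp
  qed
  then show "sq_integrable h" using h by (simp add: sq_integrable_def)
  have "ennreal (LINT x|lebesgue. (h x)\<^sup>2) \<le> ennreal C"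
  proof -
    have "(\<integral>\<^sup>+x. ennreal ((h x)\<^sup>2) \<partial>lebesgue) = ennreal (LINT x|lebesgue. (h x)\<^sup>2)"
      by (rule nn_integral_eq_integral[OF i]) simp
    then show ?thesis using le by metis
  qed
  then show "(LINT x|lebesgue. (h x)\<^sup>2) \<le> C" using C0 by simp
qed

text \<open>Riesz-Fischer for a rapidly convergent sequence. The rate 16^(-n) leaves room for a
  weight 4^n: the weighted squared increments have integrals of at most 4^(-n), so almost everywhere
  they are bounded and the increments are of order 2^(-n).\<close>

lemma L2_complete:
  assumes f: "\<And>n::nat. sq_integrable (f n)"
    and c: "\<And>n m. n \<le> m \<Longrightarrow> (LINT x|lebesgue. (f n x - f m x)\<^sup>2) \<le> (1/16)^n"
  shows "\<exists>h. sq_integrable h \<and> (\<lambda>n. LINT x|lebesgue. (f n x - h x)\<^sup>2) \<longlonglongrightarrow> 0"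
proof -
  have fm [measurable]: "f n \<in> borel_measurable lebesgue" for n using f sq_integrable_borel by blast
  define a where "a n x = 4^n * (f n x - f (Suc n) x)\<^sup>2" for n x
  have am [measurable]: "a n \<in> borel_measurable lebesgue" for n unfolding a_def by measurable
  have a0: "0 \<le> a n x" for n x by (simp add: a_def)
  have "(\<integral>\<^sup>+x. (\<Sum>n. ennreal (a n x)) \<partial>lebesgue) = (\<Sum>n. \<integral>\<^sup>+x. ennreal (a n x) \<partial>lebesgue)"
    by (rule nn_integral_suminf) measurable
  also have "\<dots> \<le> (\<Sum>n. ennreal ((1/4)^n))"
  proof (rule suminf_le)
    fix n
    have "sq_integrable (\<lambda>x. f n x - f (Suc n) x)" by (intro sq_integrable_diff f)
    then have i: "integrable lebesgue (a n)" unfolding a_def by (simp add: sq_integrable_square)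
    have "(LINT x|lebesgue. a n x) = 4^n * (LINT x|lebesgue. (f n x - f (Suc n) x)\<^sup>2)"
      by (simp add: a_def)
    also have "\<dots> \<le> 4^n * (1/16)^n" using c[of n "Suc n"] by (intro mult_left_mono) auto
    also have "\<dots> = (1/4)^n" by (simp add: power_mult_distrib[symmetric])
    finally have "(LINT x|lebesgue. a n x) \<le> (1/4)^n" .
    then show "(\<integral>\<^sup>+x. ennreal (a n x) \<partial>lebesgue) \<le> ennreal ((1/4)^n)"
      using nn_integral_eq_integral[OF i] a0 by (simp add: ennreal_leI)
  qed (rule summableI)+
  also have "\<dots> = ennreal (\<Sum>n. (1/4)^n)"
    by (rule suminf_ennreal2) (auto intro!: summable_geometric)
  also have "\<dots> < \<infinity>" by simp
  finally have "(\<integral>\<^sup>+x. (\<Sum>n. ennreal (a n x)) \<partial>lebesgue) \<noteq> \<infinity>" by simp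
  then have "AE x in lebesgue. (\<Sum>n. ennreal (a n x)) \<noteq> \<infinity>"
    by (intro nn_integral_PInf_AE) measurable
  then have conv: "AE x in lebesgue. convergent (\<lambda>n. f n x)"
  proof eventually_elim
    case (elim x)
    have "summable (\<lambda>n. a n x)" by (rule summable_suminf_not_top) (use elim a0 in auto)
    then have "Bseq (\<lambda>n. a n x)"
      by (intro convergent_imp_Bseq convergentI) (rule summable_LIMSEQ_zero)
    then obtain K where "K > 0" "\<forall>n. norm (a n x) \<le> K" by (rule BseqE)
    then have K: "K > 0" "\<And>n. norm (a n x) \<le> K" by blast+
    have le: "norm (f (Suc n) x - f n x) \<le> sqrt K * (1/2)^n" for n
    proof -
      have "\<bar>f (Suc n) x - f n x\<bar>\<^sup>2 = a n x * ((1/2)^n)\<^sup>2"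
      proof -
        have "4^n * ((1/2)^n)\<^sup>2 = (1::real)" by (induction n) (auto simp: power2_eq_square)
        then have "(4^n * ((1/2)^n)\<^sup>2) * (f n x - f (Suc n) x)\<^sup>2 = (f n x - f (Suc n) x)\<^sup>2" by simp
        moreover have "\<bar>f (Suc n) x - f n x\<bar>\<^sup>2 = (f n x - f (Suc n) x)\<^sup>2" by (simp add: power2_eq_square algebra_simps)
        ultimately show ?thesis unfolding a_def by (simp only: mult.assoc mult.commute mult.left_commute)
      qed
      also have "\<dots> \<le> K * ((1/2)^n)\<^sup>2" using K(2)[of n] by (intro mult_right_mono) auto
      also have "\<dots> = (sqrt K * (1/2)^n)\<^sup>2" using K(1) by (simp add: power_mult_distrib)
      finally show ?thesis unfolding real_norm_def
        by (rule power2_le_imp_le) (use K(1) in simp)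
    qed
    have "summable (\<lambda>n. f (Suc n) x - f n x)"
      by (rule summable_comparison_test'[of "\<lambda>n. sqrt K * (1/2)^n" 0]) (use le in \<open>auto intro!: summable_mult summable_geometric\<close>)
    then have "convergent (\<lambda>n. \<Sum>i<n. f (Suc i) x - f i x)" by (simp add: summable_iff_convergent)
    then have "convergent (\<lambda>n. f n x - f 0 x)" using sum_lessThan_telescope[of "\<lambda>n. f n x"] by simp
    then obtain L where "(\<lambda>n. f n x - f 0 x) \<longlonglongrightarrow> L" by (auto simp: convergent_def)
    then have "(\<lambda>n. (f n x - f 0 x) + f 0 x) \<longlonglongrightarrow> L + f 0 x" by (intro tendsto_add tendsto_const)
    then show ?case by (auto simp: convergent_def)
  qed
  define h where "h x = lim (\<lambda>n. f n x)" for x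
  have hm [measurable]: "h \<in> borel_measurable lebesgue" unfolding h_def by measurable
  have lim: "AE x in lebesgue. (\<lambda>n. f n x) \<longlonglongrightarrow> h x"
    using conv by eventually_elim (simp add: h_def convergent_LIMSEQ_iff)
  have d: "sq_integrable (\<lambda>x. f n x - h x)" "(LINT x|lebesgue. (f n x - h x)\<^sup>2) \<le> (1/16)^n" for n
  proof -
    have 1: "sq_integrable (\<lambda>x. f n x - f (m + n) x)" for m by (intro sq_integrable_diff f)
    have 2: "(\<lambda>x. f n x - h x) \<in> borel_measurable lebesgue" by measurable
    have 3: "AE x in lebesgue. (\<lambda>m. f n x - f (m + n) x) \<longlonglongrightarrow> f n x - h x"
      using lim by eventually_elim (intro tendsto_diff tendsto_const LIMSEQ_ignore_initial_segment)
    have 4: "(LINT x|lebesgue. (f n x - f (m + n) x)\<^sup>2) \<le> (1/16)^n" for m by (rule c) simp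
    show "sq_integrable (\<lambda>x. f n x - h x)" "(LINT x|lebesgue. (f n x - h x)\<^sup>2) \<le> (1/16)^n"
      using sq_integrable_Fatou[OF 1 2 3 4] by auto
  qed
  have "sq_integrable (\<lambda>x. f 0 x - (f 0 x - h x))" by (intro sq_integrable_diff f d)
  then have "sq_integrable h" by simp
  moreover have "(\<lambda>n. LINT x|lebesgue. (f n x - h x)\<^sup>2) \<longlonglongrightarrow> 0"
  proof (rule tendsto_sandwich[OF _ _ tendsto_const])
    show "(\<lambda>n. (1/16)^n :: real) \<longlonglongrightarrow> 0" by (rule LIMSEQ_realpow_zero) auto
    show "\<forall>\<^sub>F n in sequentially. (LINT x|lebesgue. (f n x - h x)\<^sup>2) \<le> (1/16)^n" using d(2) by simp
    show "\<forall>\<^sub>F n in sequentially. 0 \<le> (LINT x|lebesgue. (f n x - h x)\<^sup>2)" by simp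
  qed
  ultimately show ?thesis by blast
qed

lemma sq_integrable_locally_integrable:
  assumes h: "sq_integrable h" shows "locally_integrable h"
  unfolding locally_integrable_def set_integrable_def
proof (intro allI)
  fix a b :: real
  from sq_integrable_mult[OF sq_integrable_indicator_Icc h] show "integrable lebesgue (\<lambda>x. indicator {a..b} x *\<^sub>R h x)" by simp
qed

lemma tendsto_integral_mult_L2:
  assumes f: "\<And>n::nat. sq_integrable (f n)" and h: "sq_integrable h" and k: "sq_integrable k"
    and l: "(\<lambda>n. LINT x|lebesgue. (f n x - h x)\<^sup>2) \<longlonglongrightarrow> 0"
  shows "(\<lambda>n. LINT x|lebesgue. f n x * k x) \<longlonglongrightarrow> (LINT x|lebesgue. h x * k x)"
proof -
  have "(\<lambda>n. (LINT x|lebesgue. (f n x - h x) * k x)\<^sup>2) \<longlonglongrightarrow> 0"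
  proof (rule tendsto_sandwich[OF _ _ tendsto_const])
    show "(\<lambda>n. (LINT x|lebesgue. (f n x - h x)\<^sup>2) * (LINT x|lebesgue. (k x)\<^sup>2)) \<longlonglongrightarrow> 0"
      using tendsto_mult_left_zero[OF l] by simp
    show "\<forall>\<^sub>F n in sequentially. (LINT x|lebesgue. (f n x - h x) * k x)\<^sup>2
       \<le> (LINT x|lebesgue. (f n x - h x)\<^sup>2) * (LINT x|lebesgue. (k x)\<^sup>2)"
      by (intro always_eventually allI integral_Cauchy_Schwarz sq_integrable_diff f h k)
  qed auto
  then have "(\<lambda>n. LINT x|lebesgue. (f n x - h x) * k x) \<longlonglongrightarrow> 0"
    using tendsto_real_sqrt[of "\<lambda>n. (LINT x|lebesgue. (f n x - h x) * k x)\<^sup>2" 0]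
    by (simp add: tendsto_rabs_zero_iff)
  moreover have "(LINT x|lebesgue. (f n x - h x) * k x) = (LINT x|lebesgue. f n x * k x) - (LINT x|lebesgue. h x * k x)" for n
    using sq_integrable_mult[OF f k] sq_integrable_mult[OF h k] by (simp add: left_diff_distrib)
  ultimately have "(\<lambda>n. (LINT x|lebesgue. f n x * k x) - (LINT x|lebesgue. h x * k x)) \<longlonglongrightarrow> 0" by simp
  then show ?thesis by (simp add: LIM_zero_iff)
qed

text \<open>The dyadic convex hull of a tail of a sequence; it serves as a countable version of Mazur's lemma.\<close>

inductive midhull :: "(nat \<Rightarrow> real \<Rightarrow> real) \<Rightarrow> (nat \<Rightarrow> real \<Rightarrow> real) \<Rightarrow> nat \<Rightarrow> (real \<Rightarrow> real) \<Rightarrow> (real \<Rightarrow> real) \<Rightarrow> bool"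
  for u g N where
  base: "N \<le> n \<Longrightarrow> midhull u g N (u n) (g n)"
| mid: "midhull u g N v h \<Longrightarrow> midhull u g N v' h' \<Longrightarrow>
    midhull u g N (\<lambda>x. (v x + v' x) / 2) (\<lambda>x. (h x + h' x) / 2)"

lemma midhull_mono: "midhull u g M v h \<Longrightarrow> N \<le> M \<Longrightarrow> midhull u g N v h"
  by (induction rule: midhull.induct) (auto intro: midhull.intros)

lemma midhull_H1pair:
  assumes "\<And>n. H1pair (u n) (g n)" and "midhull u g N v h"
  shows "H1pair v h"
  using assms(2)
proof (induction rule: midhull.induct)
  case (mid v h v' h')
  then show ?case
    using H1pair_cmult[OF H1pair_add[OF mid.IH], of "1/2"] by simp
qed (use assms in auto)

lemma midhull_pointwise:
  assumes "midhull u g N v h" and "\<And>n. N \<le> n \<Longrightarrow> \<bar>u n x - w\<bar> \<le> e"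
  shows "\<bar>v x - w\<bar> \<le> e"
  using assms(1)
proof (induction rule: midhull.induct)
  case (mid v h v' h')
  have "(v x + v' x) / 2 - w = (v x - w) / 2 + (v' x - w) / 2" by (simp add: field_simps)
  then show ?case using mid.IH by (simp add: field_simps abs_le_iff)
qed (use assms in auto)

lemma midhull_integral:
  assumes u: "\<And>n. H1pair (u n) (g n)" and k: "sq_integrable k"
    and m: "midhull u g N v h" and e: "\<And>n. N \<le> n \<Longrightarrow> \<bar>(LINT x|lebesgue. g n x * k x) - L\<bar> \<le> e"
  shows "\<bar>(LINT x|lebesgue. h x * k x) - L\<bar> \<le> e"
  using m
proof (induction rule: midhull.induct)
  case (mid v h v' h')
  have "sq_integrable h" "sq_integrable h'" using midhull_H1pair[OF u mid.hyps(1)] midhull_H1pair[OF u mid.hyps(2)]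
    by (auto simp: H1pair_def)
  then have i: "integrable lebesgue (\<lambda>x. h x * k x)" "integrable lebesgue (\<lambda>x. h' x * k x)"
    using k by (auto intro: sq_integrable_mult)
  have "(LINT x|lebesgue. (h x + h' x) / 2 * k x) = (LINT x|lebesgue. 1/2 * (h x * k x) + 1/2 * (h' x * k x))"
    by (rule Bochner_Integration.integral_cong) (auto simp: field_simps)
  also have "\<dots> = 1/2 * (LINT x|lebesgue. h x * k x) + 1/2 * (LINT x|lebesgue. h' x * k x)"
    by (subst Bochner_Integration.integral_add) (use i in auto)
  finally have "(LINT x|lebesgue. (h x + h' x) / 2 * k x) - L
     = ((LINT x|lebesgue. h x * k x) - L) / 2 + ((LINT x|lebesgue. h' x * k x) - L) / 2" by (simp add: field_simps)
  then show ?case using mid.IH unfolding abs_le_iff by argo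
qed (use e in auto)

lemma parallelogram_L2:
  assumes f: "sq_integrable f" and g: "sq_integrable g"
  shows "(LINT x|lebesgue. (f x - g x)\<^sup>2) = 2 * (LINT x|lebesgue. (f x)\<^sup>2) + 2 * (LINT x|lebesgue. (g x)\<^sup>2)
    - 4 * (LINT x|lebesgue. ((f x + g x) / 2)\<^sup>2)"
proof -
  have s: "sq_integrable (\<lambda>x. 1/2 * (f x + g x))" by (intro sq_integrable_cmult sq_integrable_add f g)
  then have i: "integrable lebesgue (\<lambda>x. ((f x + g x) / 2)\<^sup>2)" using sq_integrable_square[OF s] by simp
  have "(LINT x|lebesgue. (f x - g x)\<^sup>2) = (LINT x|lebesgue. 2 * (f x)\<^sup>2 + 2 * (g x)\<^sup>2 - 4 * ((f x + g x) / 2)\<^sup>2)"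
    by (rule Bochner_Integration.integral_cong) (auto simp: power2_eq_square field_simps)
  also have "\<dots> = (LINT x|lebesgue. 2 * (f x)\<^sup>2 + 2 * (g x)\<^sup>2) - (LINT x|lebesgue. 4 * ((f x + g x) / 2)\<^sup>2)"
    by (intro Bochner_Integration.integral_diff Bochner_Integration.integrable_add integrable_mult_right i sq_integrable_square f g)
  also have "(LINT x|lebesgue. 2 * (f x)\<^sup>2 + 2 * (g x)\<^sup>2) = (LINT x|lebesgue. 2 * (f x)\<^sup>2) + (LINT x|lebesgue. 2 * (g x)\<^sup>2)"
    by (intro Bochner_Integration.integral_add integrable_mult_right sq_integrable_square f g)
  finally show ?thesis by simp
qed

text \<open>Hull elements with nearly minimal derivative norm have derivatives that form a Cauchy
  sequence by the parallelogram law, so these converge strongly. Pointwise limits of the functions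
  and limits of pairings survive midpoints; hence the strong limit is a derivative of
  \<open>w\<close> and represents every pairing that converges.\<close>

lemma H1pair_closure:
  assumes u: "\<And>n::nat. H1pair (u n) (g n)" and bu: "\<And>n. (LINT x|lebesgue. (u n x)\<^sup>2) \<le> K"
    and bg: "\<And>n. (LINT x|lebesgue. (g n x)\<^sup>2) \<le> K" and lim: "\<And>x. (\<lambda>n. u n x) \<longlonglongrightarrow> w x"
  shows "\<exists>h. H1pair w h \<and> (\<forall>k L. sq_integrable k \<longrightarrow> (\<lambda>n. LINT x|lebesgue. g n x * k x) \<longlonglongrightarrow> L
       \<longrightarrow> L = (LINT x|lebesgue. h x * k x))"
proof -
  let ?N = "\<lambda>f. LINT x|(lebesgue::real measure). (f x :: real)\<^sup>2"
  have N0: "0 \<le> ?N f" for f by (intro integral_nonneg_AE AE_I2) simp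
  define D where "D N = {?N h |v h. midhull u g N v h}" for N
  define d where "d N = Inf (D N)" for N
  have Dbdd: "bdd_below (D N)" for N using N0 by (intro bdd_belowI[of _ 0]) (auto simp: D_def)
  have Dne: "?N (g N) \<in> D N" for N unfolding D_def using midhull.base[of N N u g] by blast
  have dle: "d N \<le> ?N h" if "midhull u g N v h" for N v h
    unfolding d_def
  proof (rule cInf_lower[OF _ Dbdd])
    show "?N h \<in> D N" unfolding D_def using that by blast
  qed
  have dK: "d N \<le> K" for N using dle[OF midhull.base[of N N u g]] bg[of N] by simp
  have dinc: "incseq d" unfolding incseq_def
  proof (intro allI impI)
    fix m n :: nat assume "m \<le> n"
    then have "D n \<subseteq> D m" unfolding D_def using midhull_mono by blast
    then show "d m \<le> d n" unfolding d_def using Dne[of n] by (intro cInf_superset_mono Dbdd) blast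
  qed
  obtain l where "d \<longlonglongrightarrow> l" "\<forall>n. d n \<le> l"
    using incseq_convergent[OF dinc, of K] dK by blast
  then have l: "d \<longlonglongrightarrow> l" "\<And>n. d n \<le> l" by blast+
  have "\<exists>v h. midhull u g N v h \<and> ?N h < d N + 1 / real (Suc N)" for N
  proof -
    have "Inf (D N) < d N + 1 / real (Suc N)" by (simp add: d_def)
    then obtain y where "y \<in> D N" "y < d N + 1 / real (Suc N)"
      using cInf_lessD[of "D N"] Dne[of N] by blast
    then show ?thesis by (auto simp: D_def)
  qed
  then have "\<forall>N. \<exists>p. midhull u g N (fst p) (snd p) \<and> ?N (snd p) < d N + 1 / real (Suc N)" by simp
  from choice[OF this] obtain p where p: "\<forall>N. midhull u g N (fst (p N)) (snd (p N)) \<and> ?N (snd (p N)) < d N + 1 / real (Suc N)"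
    by blast
  define v f where "v N = fst (p N)" and "f N = snd (p N)" for N
  have vf: "midhull u g N (v N) (f N)" "?N (f N) < d N + 1 / real (Suc N)" for N
    using p by (simp_all add: v_def f_def)
  have vH: "H1pair (v N) (f N)" for N by (rule midhull_H1pair[OF u vf(1)])
  have fs: "sq_integrable (f N)" for N using vH by (simp add: H1pair_def)
  \<comment> \<open>The remainder of the parallelogram law: two near-minimality errors with factor 2
    each, and the distance of the increasing infima from their limit \<open>l\<close>.\<close>
  define e where "e N = 4 * (1 / real (Suc N)) + 2 * (l - d N)" for N
  have elim: "e \<longlonglongrightarrow> 0"
  proof -
    have "e \<longlonglongrightarrow> 4 * 0 + 2 * (l - l)" unfolding e_def
      by (intro tendsto_intros l(1) lim_1_over_n[THEN LIMSEQ_Suc])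
    then show ?thesis by simp
  qed
  have cauchy: "?N (\<lambda>x. f n x - f m x) \<le> e n" if nm: "n \<le> m" for n m
  proof -
    have "midhull u g n (\<lambda>x. (v n x + v m x) / 2) (\<lambda>x. (f n x + f m x) / 2)"
      by (rule midhull.mid[OF vf(1) midhull_mono[OF vf(1) nm]])
    from dle[OF this] have "d n \<le> ?N (\<lambda>x. (f n x + f m x) / 2)" .
    then have "?N (\<lambda>x. f n x - f m x) \<le> 2 * (d n + 1 / real (Suc n)) + 2 * (d m + 1 / real (Suc m)) - 4 * d n"
      unfolding parallelogram_L2[OF fs fs] using vf(2)[of n] vf(2)[of m] by argo
    moreover have "1 / real (Suc m) \<le> 1 / real (Suc n)" using nm by (simp add: frac_le)
    ultimately show ?thesis using l(2)[of m] unfolding e_def by argo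
  qed
  have ev: "\<forall>\<^sub>F k in sequentially. e k < (1/16)^n" for n
    using order_tendstoD(2)[OF elim] by simp
  obtain s where s: "strict_mono s" "\<And>n. e (s n) < (1/16)^n"
    using fast_subsequence[of "\<lambda>n k. e k < (1/16)^n", OF ev] by blast
  have "?N (\<lambda>x. f (s n) x - f (s m) x) \<le> (1/16)^n" if "n \<le> m" for n m
    using cauchy[of "s n" "s m"] s(2)[of n] that s(1) by (simp add: strict_mono_less_eq)
  from L2_complete[of "\<lambda>n. f (s n)", OF fs this]
  obtain h where h: "sq_integrable h" "(\<lambda>n. ?N (\<lambda>x. f (s n) x - h x)) \<longlonglongrightarrow> 0" by blast
  have stop: "n \<le> s n" for n using s(1) by (rule seq_suble)
  have vlim: "(\<lambda>n. v (s n) x) \<longlonglongrightarrow> w x" for x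
  proof (rule LIMSEQ_I)
    fix r :: real assume "0 < r"
    then obtain no where no: "\<And>n. no \<le> n \<Longrightarrow> \<bar>u n x - w x\<bar> < r / 2"
      using LIMSEQ_D[OF lim[of x], of "r/2"] by auto
    show "\<exists>no. \<forall>n\<ge>no. norm (v (s n) x - w x) < r"
    proof (intro exI allI impI)
      fix n assume "no \<le> n"
      have "\<bar>v (s n) x - w x\<bar> \<le> r / 2"
      proof (rule midhull_pointwise[OF vf(1)])
        fix k assume "s n \<le> k"
        then have "no \<le> k" using \<open>no \<le> n\<close> stop[of n] by linarith
        from no[OF this] show "\<bar>u k x - w x\<bar> \<le> r / 2" by simp
      qed
      then show "norm (v (s n) x - w x) < r" using \<open>0 < r\<close> by simp
    qed
  qed
  have hl: "locally_integrable h" by (rule sq_integrable_locally_integrable[OF h(1)])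
  have prim: "primitive w h"
    unfolding primitive_def
  proof (intro conjI allI impI hl)
    fix a b :: real assume ab: "a \<le> b"
    have "(\<lambda>n. LINT x|lebesgue. f (s n) x * indicator {a..b} x) \<longlonglongrightarrow> (LINT x|lebesgue. h x * indicator {a..b} x)"
      by (rule tendsto_integral_mult_L2[OF fs h(1) sq_integrable_indicator_Icc h(2)])
    moreover have "(LINT x|lebesgue. f (s n) x * indicator {a..b} x) = v (s n) b - v (s n) a" for n
      using primitive_diff[OF H1pairD(1)[OF vH] ab, of "s n"] by (simp add: set_lebesgue_integral_def mult.commute)
    ultimately have 1: "(\<lambda>n. v (s n) b - v (s n) a) \<longlonglongrightarrow> (LINT x|lebesgue. h x * indicator {a..b} x)" by simp
    have "w b - w a = (LINT x|lebesgue. h x * indicator {a..b} x)"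
      by (rule LIMSEQ_unique[OF tendsto_diff[OF vlim vlim] 1])
    then show "w b - w a = (LINT x:{a..b}|lebesgue. h x)"
      by (simp add: set_lebesgue_integral_def mult.commute)
  qed
  have ws: "sq_integrable w"
    by (rule sq_integrable_Fatou(1)[of u w K, OF H1pairD(2)[OF u] primitive_borel[OF prim] _ bu]) (simp add: lim)
  show ?thesis
  proof (intro exI[of _ h] conjI allI impI)
    show "H1pair w h" using prim ws h(1) by (simp add: H1pair_def)
    fix k L assume k: "sq_integrable k" and L: "(\<lambda>n. LINT x|lebesgue. g n x * k x) \<longlonglongrightarrow> L"
    have "(\<lambda>n. LINT x|lebesgue. f (s n) x * k x) \<longlonglongrightarrow> L"
    proof (rule LIMSEQ_I)
      fix r :: real assume "0 < r"
      then obtain no where no: "\<And>n. no \<le> n \<Longrightarrow> \<bar>(LINT x|lebesgue. g n x * k x) - L\<bar> < r / 2"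
        using LIMSEQ_D[OF L, of "r/2"] by auto
      show "\<exists>no. \<forall>n\<ge>no. norm ((LINT x|lebesgue. f (s n) x * k x) - L) < r"
      proof (intro exI allI impI)
        fix n assume "no \<le> n"
        have "\<bar>(LINT x|lebesgue. f (s n) x * k x) - L\<bar> \<le> r / 2"
        proof (rule midhull_integral[OF u k vf(1)])
          fix j assume "s n \<le> j"
          then have "no \<le> j" using \<open>no \<le> n\<close> stop[of n] by linarith
          from no[OF this] show "\<bar>(LINT x|lebesgue. g j x * k x) - L\<bar> \<le> r / 2" by simp
        qed
        then show "norm ((LINT x|lebesgue. f (s n) x * k x) - L) < r" using \<open>0 < r\<close> by simp
      qed
    qed
    then show "L = (LINT x|lebesgue. h x * k x)"
      using tendsto_integral_mult_L2[OF fs h(1) k h(2)] LIMSEQ_unique by blast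
  qed
qed

lemma primitive_Hoelder_global:
  assumes h: "H1pair u g" shows "(u x - u y)\<^sup>2 \<le> \<bar>x - y\<bar> * (LINT t|lebesgue. (g t)\<^sup>2)"
proof -
  let ?I = "{min x y..max x y}"
  have "(u x - u y)\<^sup>2 \<le> \<bar>x - y\<bar> * (LINT t|lebesgue. indicator ?I t * (g t)\<^sup>2)"
    by (rule primitive_Hoelder[OF H1pairD(1,3)[OF h]]) auto
  also have "\<dots> \<le> \<bar>x - y\<bar> * (LINT t|lebesgue. (g t)\<^sup>2)"
    using integrable_mult_indicator[OF _ H1pairD(7)[OF h], of ?I] H1pairD(7)[OF h]
    by (intro mult_left_mono integral_mono) (auto simp: indicator_def)
  finally show ?thesis .
qed

text \<open>Arzela-Ascoli in disguise: a diagonal sequence over the rationals and the uniform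
  Hoelder bound give convergence at every point. Of weak convergence of the derivatives only the
  pairing with the limit derivative is extracted, because expanding the quadratic form needs no
  other.\<close>

lemma H1pair_weak_compactness:
  assumes u: "\<And>n::nat. H1pair (u n) (g n)" and bu: "\<And>n. (LINT x|lebesgue. (u n x)\<^sup>2) \<le> K"
    and bg: "\<And>n. (LINT x|lebesgue. (g n x)\<^sup>2) \<le> K"
  shows "\<exists>r w h. strict_mono r \<and> H1pair w h \<and> (\<forall>x. (\<lambda>n. u (r n) x) \<longlonglongrightarrow> w x) \<and>
    (\<lambda>n. LINT x|lebesgue. g (r n) x * h x) \<longlonglongrightarrow> (LINT x|lebesgue. (h x)\<^sup>2)"
proof -
  have K0: "0 \<le> K" by (rule order_trans[OF _ bu[of 0]]) simp
  have sup: "norm (u n x) \<le> sqrt (4 * K)" for n x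
  proof -
    have "(u n x)\<^sup>2 \<le> 4 * K" using H1pair_sup[OF u, of n x] bu[of n] bg[of n] by argo
    then have "sqrt ((u n x)\<^sup>2) \<le> sqrt (4 * K)" by (rule real_sqrt_le_mono)
    then show ?thesis by simp
  qed
  obtain r where r: "strict_mono (r::nat\<Rightarrow>nat)" "\<And>x. x \<in> \<rat> \<Longrightarrow> \<exists>l. (\<lambda>n. u (r n) x) \<longlonglongrightarrow> l"
    using function_convergent_subsequence[OF countable_rat, of u "sqrt (4 * K)"] sup by blast
  have "\<exists>l. (\<lambda>n. u (r n) x) \<longlonglongrightarrow> l" for x
  proof -
    have "Cauchy (\<lambda>n. u (r n) x)"
    proof (rule metric_CauchyI)
      fix e :: real assume e: "0 < e"
      \<comment> \<open>By the Hoelder bound, points within this distance have values within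
        \<open>e / 4\<close>, uniformly in \<open>n\<close>.\<close>
      define \<delta> where "\<delta> = (e / 4)\<^sup>2 / (K + 1)"
      have "0 < \<delta>" using e K0 by (simp add: \<delta>_def)
      then obtain q where q: "q \<in> \<rat>" "x < q" "q < x + \<delta>" using Rats_dense_in_real[of x "x + \<delta>"] by auto
      have close: "\<bar>u n x - u n q\<bar> \<le> e / 4" for n
      proof -
        have "(u n x - u n q)\<^sup>2 \<le> \<bar>x - q\<bar> * (LINT t|lebesgue. (g n t)\<^sup>2)" by (rule primitive_Hoelder_global[OF u])
        also have "\<dots> \<le> \<delta> * (K + 1)" using q bg[of n] K0 \<open>0 < \<delta>\<close> by (intro mult_mono) auto
        also have "\<dots> = (e / 4)\<^sup>2" using K0 by (simp add: \<delta>_def)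
        finally show ?thesis using e by (metis abs_le_square_iff abs_of_pos zero_less_divide_iff zero_less_numeral)
      qed
      have "Cauchy (\<lambda>n. u (r n) q)" using r(2)[OF q(1)] LIMSEQ_imp_Cauchy by blast
      then obtain M where M: "\<And>m n. M \<le> m \<Longrightarrow> M \<le> n \<Longrightarrow> dist (u (r m) q) (u (r n) q) < e / 4"
        using metric_CauchyD[of "\<lambda>n. u (r n) q" "e/4"] e by auto
      show "\<exists>M. \<forall>m\<ge>M. \<forall>n\<ge>M. dist (u (r m) x) (u (r n) x) < e"
      proof (intro exI allI impI)
        fix m n assume "M \<le> m" "M \<le> n"
        from M[OF this] show "dist (u (r m) x) (u (r n) x) < e"
          using close[of "r m"] close[of "r n"] e unfolding dist_real_def abs_less_iff abs_le_iff by argo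
      qed
    qed
    then show ?thesis by (simp add: Cauchy_convergent_iff convergent_def)
  qed
  then obtain w where w: "\<And>x. (\<lambda>n. u (r n) x) \<longlonglongrightarrow> w x" by metis
  obtain h where h: "H1pair w h"
    using H1pair_closure[of "\<lambda>n. u (r n)" "\<lambda>n. g (r n)" K w] u bu bg w by blast
  have "bounded (range (\<lambda>n. LINT x|lebesgue. g (r n) x * h x))"
  proof (rule boundedI)
    fix y assume "y \<in> range (\<lambda>n. LINT x|lebesgue. g (r n) x * h x)"
    then obtain n where y: "y = (LINT x|lebesgue. g (r n) x * h x)" by blast
    have "y\<^sup>2 \<le> (LINT x|lebesgue. (g (r n) x)\<^sup>2) * (LINT x|lebesgue. (h x)\<^sup>2)"
      unfolding y by (rule integral_Cauchy_Schwarz[OF H1pairD(3)[OF u] H1pairD(3)[OF h]])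
    also have "\<dots> \<le> K * (LINT x|lebesgue. (h x)\<^sup>2)" by (rule mult_right_mono[OF bg]) simp
    finally have "sqrt (y\<^sup>2) \<le> sqrt (K * (LINT x|lebesgue. (h x)\<^sup>2))" by (rule real_sqrt_le_mono)
    then show "norm y \<le> sqrt (K * (LINT x|lebesgue. (h x)\<^sup>2))" by simp
  qed
  from bounded_imp_convergent_subsequence[OF this]
  obtain L t where t: "strict_mono (t :: nat \<Rightarrow> nat)" "((\<lambda>n. LINT x|lebesgue. g (r n) x * h x) \<circ> t) \<longlonglongrightarrow> L" by blast
  then have L: "(\<lambda>n. LINT x|lebesgue. g (r (t n)) x * h x) \<longlonglongrightarrow> L" by (simp add: o_def)
  have wt: "(\<lambda>n. u (r (t n)) x) \<longlonglongrightarrow> w x" for x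
    using LIMSEQ_subseq_LIMSEQ[OF w t(1)] by (simp add: o_def)
  \<comment> \<open>Along the further subsequence another derivative of the same \<open>w\<close>
    may be returned; it equals \<open>h\<close> almost everywhere, and this identifies the
    limit.\<close>
  obtain h' where h': "H1pair w h'" "\<And>k L. sq_integrable k \<Longrightarrow> (\<lambda>n. LINT x|lebesgue. g (r (t n)) x * k x) \<longlonglongrightarrow> L
       \<Longrightarrow> L = (LINT x|lebesgue. h' x * k x)"
    using H1pair_closure[of "\<lambda>n. u (r (t n))" "\<lambda>n. g (r (t n))" K w] u bu bg wt by blast
  have "L = (LINT x|lebesgue. h' x * h x)" by (rule h'(2)[OF H1pairD(3)[OF h] L])
  also have "\<dots> = (LINT x|lebesgue. (h x)\<^sup>2)"
  proof (rule integral_cong_AE)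
    show "(\<lambda>x. h' x * h x) \<in> borel_measurable lebesgue" "(\<lambda>x. (h x)\<^sup>2) \<in> borel_measurable lebesgue"
      using H1pairD(5)[OF h] H1pairD(5)[OF h'(1)] by measurable
    show "AE x in lebesgue. h' x * h x = (h x)\<^sup>2"
      using primitive_unique[OF H1pairD(1)[OF h] H1pairD(1)[OF h'(1)]]
      by eventually_elim (simp add: power2_eq_square)
  qed
  finally have "(\<lambda>n. LINT x|lebesgue. g (r (t n)) x * h x) \<longlonglongrightarrow> (LINT x|lebesgue. (h x)\<^sup>2)" using L by simp
  moreover have "strict_mono (\<lambda>n. r (t n))" using strict_mono_compose[OF r(1) t(1)] by (simp add: o_def)
  ultimately show ?thesis using h wt by blast
qed

subsection \<open>Concentration compactness\<close>

definition nlin :: "(real \<Rightarrow> real) \<Rightarrow> real \<Rightarrow> (real \<Rightarrow> real) \<Rightarrow> real" where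
  "nlin \<Gamma> r u = (LINT x|lebesgue. \<Gamma> x * \<bar>u x\<bar> powr r)"

text \<open>Trades the excess power for a sup bound: the nonlinear term becomes a small multiple of
  an L^2 norm wherever the function is small.\<close>

lemma powr_le_square:
  fixes y B r :: real
  assumes "\<bar>y\<bar> \<le> B" "2 \<le> r" shows "\<bar>y\<bar> powr r \<le> B powr (r - 2) * y\<^sup>2"
proof (cases "y = 0")
  case False
  have "\<bar>y\<bar> powr r = \<bar>y\<bar> powr (r - 2) * \<bar>y\<bar> powr 2" by (subst powr_add[symmetric]) simp
  also have "\<bar>y\<bar> powr 2 = y\<^sup>2" using False by simp
  also have "\<bar>y\<bar> powr (r - 2) * y\<^sup>2 \<le> B powr (r - 2) * y\<^sup>2"
    using assms by (intro mult_right_mono powr_mono2) auto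
  finally show ?thesis .
qed simp

lemma powr_borel:
  fixes u :: "real \<Rightarrow> real"
  assumes "u \<in> borel_measurable lebesgue" shows "(\<lambda>x. \<bar>u x\<bar> powr r) \<in> borel_measurable lebesgue"
  using assms by measurable

lemma powr_integrable:
  assumes u: "sq_integrable u" and b: "\<And>x. \<bar>u x\<bar> \<le> B" and r: "2 \<le> r"
  shows "integrable lebesgue (\<lambda>x. \<bar>u x\<bar> powr r)"
proof (rule Bochner_Integration.integrable_bound)
  show "integrable lebesgue (\<lambda>x. B powr (r - 2) * (u x)\<^sup>2)"
    using sq_integrable_square[OF u] by simp
  show "(\<lambda>x. \<bar>u x\<bar> powr r) \<in> borel_measurable lebesgue" by (rule powr_borel[OF sq_integrable_borel[OF u]])
  show "AE x in lebesgue. norm (\<bar>u x\<bar> powr r) \<le> norm (B powr (r - 2) * (u x)\<^sup>2)"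
    using powr_le_square[OF b r] by (intro AE_I2) simp
qed

lemma H1pair_bounded:
  assumes h: "H1pair u g" shows "\<exists>B\<ge>0. \<forall>x. \<bar>u x\<bar> \<le> B"
proof -
  let ?B = "sqrt (2 * ((LINT t|lebesgue. (u t)\<^sup>2) + (LINT t|lebesgue. (g t)\<^sup>2)))"
  have "\<bar>u x\<bar> \<le> ?B" for x using real_sqrt_le_mono[OF H1pair_sup[OF h, of x]] by simp
  then show ?thesis by (intro exI[of _ ?B]) simp
qed

lemma H1pair_powr_integrable:
  assumes "H1pair u g" "2 \<le> r" shows "integrable lebesgue (\<lambda>x. \<bar>u x\<bar> powr r)"
  using H1pair_bounded[OF assms(1)] powr_integrable[OF H1pairD(2)[OF assms(1)] _ assms(2)] by metis

lemma nlin_integrable: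
  assumes "bdd_by M \<Gamma>" "H1pair u g" "2 \<le> r"
  shows "integrable lebesgue (\<lambda>x. \<Gamma> x * \<bar>u x\<bar> powr r)"
  by (rule bdd_mult_integrable[OF assms(1) H1pair_powr_integrable[OF assms(2,3)]])

lemma nlin_le:
  assumes G: "bdd_by M \<Gamma>" and u: "H1pair u g" and r: "2 \<le> r" and b: "\<And>x. \<bar>u x\<bar> \<le> B"
  shows "nlin \<Gamma> r u \<le> M * B powr (r - 2) * (LINT x|lebesgue. (u x)\<^sup>2)"
proof -
  have "nlin \<Gamma> r u \<le> (LINT x|lebesgue. M * B powr (r - 2) * (u x)\<^sup>2)"
    unfolding nlin_def
  proof (rule integral_mono[OF nlin_integrable[OF G u r]])
    show "integrable lebesgue (\<lambda>x. M * B powr (r - 2) * (u x)\<^sup>2)"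
      by (intro integrable_mult_right H1pairD[OF u])
    fix x
    have "\<Gamma> x * \<bar>u x\<bar> powr r \<le> M * \<bar>u x\<bar> powr r"
      using bdd_by_abs[OF G, of x] by (intro mult_right_mono) auto
    also have "\<dots> \<le> M * (B powr (r - 2) * (u x)\<^sup>2)"
      by (intro mult_left_mono powr_le_square b r bdd_by_nonneg[OF G])
    finally show "\<Gamma> x * \<bar>u x\<bar> powr r \<le> M * B powr (r - 2) * (u x)\<^sup>2" by (simp add: mult.assoc)
  qed
  then show ?thesis by simp
qed

lemma nlin_cmult:
  assumes "0 \<le> c" shows "nlin \<Gamma> r (\<lambda>x. c * u x) = c powr r * nlin \<Gamma> r u"
proof -
  have "nlin \<Gamma> r (\<lambda>x. c * u x) = (LINT x|lebesgue. c powr r * (\<Gamma> x * \<bar>u x\<bar> powr r))"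
    unfolding nlin_def using assms
    by (intro Bochner_Integration.integral_cong) (auto simp: abs_mult powr_mult)
  then show ?thesis by (simp add: nlin_def)
qed

lemma nlin_shift: "nlin (\<lambda>x. \<Gamma> (x + t)) r (\<lambda>x. u (x + t)) = nlin \<Gamma> r u"
  unfolding nlin_def using integral_shift[of "\<lambda>x. \<Gamma> x * \<bar>u x\<bar> powr r" t] .

lemma nlin_reflect: "nlin (\<lambda>x. \<Gamma> (- x)) r (\<lambda>x. u (- x)) = nlin \<Gamma> r u"
  unfolding nlin_def using integral_reflect[of "\<lambda>x. \<Gamma> x * \<bar>u x\<bar> powr r"] .

lemma powr_diff_le:
  fixes x y r :: real
  assumes "0 \<le> x" "x \<le> y" "1 \<le> r" shows "y powr r - x powr r \<le> r * y powr (r - 1) * (y - x)"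
proof (cases "x = y \<or> x = 0")
  case True
  have "y powr r \<le> r * y powr (r - 1) * y" if "x = 0"
  proof (cases "y = 0")
    case False
    then have "y powr r = y powr (r - 1) * y" using assms powr_mult_base[of y "r - 1"] by (simp add: mult.commute)
    moreover have "1 * (y powr (r - 1) * y) \<le> r * (y powr (r - 1) * y)"
      using assms by (intro mult_right_mono) auto
    ultimately show ?thesis by (simp add: mult.assoc)
  qed simp
  then show ?thesis using True assms by auto
next
  case False
  then have "x < y" "0 < x" using assms by auto
  have d: "((\<lambda>z. z powr r) has_real_derivative r * t powr (r - 1)) (at t)" if "x \<le> t" for t
    using that \<open>0 < x\<close> by (intro has_real_derivative_powr) auto
  obtain z where z: "x < z" "z < y" "y powr r - x powr r = (y - x) * (r * z powr (r - 1))"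
    using MVT2[OF \<open>x < y\<close>, of "\<lambda>z. z powr r" "\<lambda>z. r * z powr (r - 1)"] d by blast
  have "z powr (r - 1) \<le> y powr (r - 1)" using z \<open>0 < x\<close> assms by (intro powr_mono2) auto
  then have "(y - x) * (r * z powr (r - 1)) \<le> (y - x) * (r * y powr (r - 1))"
    using assms by (intro mult_left_mono) auto
  then show ?thesis using z(3) by (simp add: mult_ac)
qed

text \<open>A quantitative Brezis-Lieb estimate: the interaction is at most a multiple of
  \<open>|a| |b|\<close>, whose integral tends to 0. By symmetry \<open>|b| \<le> |a|\<close>; then
  the mean value theorem handles the increment from \<open>|a|\<close> to \<open>|a + b|\<close>,
  and the power of \<open>|b|\<close> itself is absorbed.\<close>

lemma powr_split_bound:
  fixes a b B r :: real
  assumes r: "2 \<le> r" and a: "\<bar>a\<bar> \<le> B" and b: "\<bar>b\<bar> \<le> B"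
  shows "\<bar>\<bar>a + b\<bar> powr r - \<bar>a\<bar> powr r - \<bar>b\<bar> powr r\<bar> \<le> (r * 2 powr (r - 1) + 1) * B powr (r - 2) * (\<bar>a\<bar> * \<bar>b\<bar>)"
proof -
  have *: "\<bar>\<bar>a + b\<bar> powr r - \<bar>a\<bar> powr r - \<bar>b\<bar> powr r\<bar> \<le> (r * 2 powr (r - 1) + 1) * B powr (r - 2) * (\<bar>a\<bar> * \<bar>b\<bar>)"
    if a: "\<bar>a\<bar> \<le> B" and ba: "\<bar>b\<bar> \<le> \<bar>a\<bar>" for a b
  proof (cases "a = 0")
    case True then show ?thesis using ba by simp
  next
    case False
    \<comment> \<open>The larger endpoint of the interval for the mean value bound; it is at most
      twice \<open>|a|\<close>.\<close>
    define m where "m = max \<bar>a + b\<bar> \<bar>a\<bar>"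
    have m: "0 \<le> m" "m \<le> 2 * \<bar>a\<bar>" using ba by (auto simp: m_def)
    have "\<bar>\<bar>a + b\<bar> powr r - \<bar>a\<bar> powr r\<bar> \<le> r * m powr (r - 1) * \<bar>\<bar>a + b\<bar> - \<bar>a\<bar>\<bar>"
    proof (cases "\<bar>a\<bar> \<le> \<bar>a + b\<bar>")
      case True
      then have "\<bar>a\<bar> powr r \<le> \<bar>a + b\<bar> powr r" using r by (intro powr_mono2) auto
      moreover have "m = \<bar>a + b\<bar>" using True by (simp add: m_def)
      ultimately show ?thesis using powr_diff_le[of "\<bar>a\<bar>" "\<bar>a + b\<bar>" r] True r by simp
    next
      case False
      then have "\<bar>a + b\<bar> powr r \<le> \<bar>a\<bar> powr r" using r by (intro powr_mono2) auto
      moreover have "m = \<bar>a\<bar>" using False by (simp add: m_def)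
      ultimately show ?thesis using powr_diff_le[of "\<bar>a + b\<bar>" "\<bar>a\<bar>" r] False r by simp
    qed
    also have "\<dots> \<le> r * (2 * \<bar>a\<bar>) powr (r - 1) * \<bar>b\<bar>"
      using m r by (intro mult_mono powr_mono2) auto
    also have "(2 * \<bar>a\<bar>) powr (r - 1) = 2 powr (r - 1) * (\<bar>a\<bar> powr (r - 2) * \<bar>a\<bar>)"
    proof -
      have "\<bar>a\<bar> powr (r - 2) * \<bar>a\<bar> = \<bar>a\<bar> powr (r - 1)"
        using powr_mult_base[of "\<bar>a\<bar>" "r - 2"] by (simp add: mult.commute)
      then show ?thesis by (simp add: powr_mult)
    qed
    also have "r * (2 powr (r - 1) * (\<bar>a\<bar> powr (r - 2) * \<bar>a\<bar>)) * \<bar>b\<bar> = r * 2 powr (r - 1) * (\<bar>a\<bar> powr (r - 2) * (\<bar>a\<bar> * \<bar>b\<bar>))"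
      by (simp add: mult_ac)
    also have "\<dots> \<le> r * 2 powr (r - 1) * (B powr (r - 2) * (\<bar>a\<bar> * \<bar>b\<bar>))"
      using a r by (intro mult_left_mono mult_right_mono powr_mono2) auto
    finally have 1: "\<bar>\<bar>a + b\<bar> powr r - \<bar>a\<bar> powr r\<bar> \<le> r * 2 powr (r - 1) * (B powr (r - 2) * (\<bar>a\<bar> * \<bar>b\<bar>))" .
    have "\<bar>b\<bar> powr r \<le> B powr (r - 2) * b\<^sup>2" using powr_le_square[of b B r] a ba r by linarith
    also have "\<dots> \<le> B powr (r - 2) * (\<bar>a\<bar> * \<bar>b\<bar>)"
    proof (rule mult_left_mono)
      have "\<bar>b\<bar> * \<bar>b\<bar> \<le> \<bar>a\<bar> * \<bar>b\<bar>" by (rule mult_right_mono[OF ba]) simp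
      then show "b\<^sup>2 \<le> \<bar>a\<bar> * \<bar>b\<bar>" by (simp add: power2_eq_square)
    qed simp
    finally have 2: "\<bar>b\<bar> powr r \<le> B powr (r - 2) * (\<bar>a\<bar> * \<bar>b\<bar>)" .
    have 3: "0 \<le> \<bar>b\<bar> powr r" by simp
    have "\<bar>\<bar>a + b\<bar> powr r - \<bar>a\<bar> powr r - \<bar>b\<bar> powr r\<bar> \<le> r * 2 powr (r - 1) * (B powr (r - 2) * (\<bar>a\<bar> * \<bar>b\<bar>)) + B powr (r - 2) * (\<bar>a\<bar> * \<bar>b\<bar>)"
    proof -
      have "\<bar>X - Y - Z\<bar> \<le> P + Q" if "\<bar>X - Y\<bar> \<le> P" "Z \<le> Q" "0 \<le> Z" for X Y Z P Q :: real
        using that by linarith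
      from this[OF 1 2 3] show ?thesis .
    qed
    then show ?thesis by (simp only: distrib_right mult_1_left mult.assoc)
  qed
  show ?thesis
  proof (cases "\<bar>b\<bar> \<le> \<bar>a\<bar>")
    case True show ?thesis by (rule *[OF a True])
  next
    case False
    then have "\<bar>a\<bar> \<le> \<bar>b\<bar>" by simp
    from *[OF b this]
    have F: "\<bar>\<bar>b + a\<bar> powr r - \<bar>b\<bar> powr r - \<bar>a\<bar> powr r\<bar> \<le> (r * 2 powr (r - 1) + 1) * B powr (r - 2) * (\<bar>b\<bar> * \<bar>a\<bar>)" .
    have e1: "\<bar>a + b\<bar> powr r - \<bar>a\<bar> powr r - \<bar>b\<bar> powr r = \<bar>b + a\<bar> powr r - \<bar>b\<bar> powr r - \<bar>a\<bar> powr r"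
      by (simp add: add.commute)
    have e2: "\<bar>a\<bar> * \<bar>b\<bar> = \<bar>b\<bar> * \<bar>a\<bar>" by (rule mult.commute)
    show ?thesis unfolding e1 e2 by (rule F)
  qed
qed

text \<open>The part of \<open>|h||w|\<close> above \<open>\<eta> h\<^sup>2\<close> is dominated by \<open>w\<^sup>2/(4\<eta>)\<close>, so no tightness is needed.\<close>

lemma tendsto_integral_cross_zero:
  assumes h: "\<And>n::nat. sq_integrable (h n)" and K: "\<And>n. (LINT x|lebesgue. (h n x)\<^sup>2) \<le> K"
    and l: "\<And>x. (\<lambda>n. h n x) \<longlonglongrightarrow> 0" and w: "sq_integrable w"
  shows "(\<lambda>n. LINT x|lebesgue. \<bar>h n x\<bar> * \<bar>w x\<bar>) \<longlonglongrightarrow> 0"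
proof (rule LIMSEQ_I)
  fix e :: real assume e: "0 < e"
  have K0: "0 \<le> K" by (rule order_trans[OF _ K[of 0]]) simp
  define \<eta> where "\<eta> = e / (2 * (K + 1))"
  have eta: "0 < \<eta>" using e K0 by (simp add: \<eta>_def)
  define p where "p n x = max 0 (\<bar>h n x\<bar> * \<bar>w x\<bar> - \<eta> * (h n x)\<^sup>2)" for n x
  have hm [measurable]: "h n \<in> borel_measurable lebesgue" for n using h sq_integrable_borel by blast
  have wm [measurable]: "w \<in> borel_measurable lebesgue" using w by (rule sq_integrable_borel)
  have pm: "p n \<in> borel_measurable lebesgue" for n unfolding p_def by measurable
  have pb: "\<bar>p n x\<bar> \<le> (w x)\<^sup>2 / (4 * \<eta>)" for n x
  proof -
    have *: "4 * \<eta> * (a * b - \<eta> * a\<^sup>2) \<le> b\<^sup>2" for a b :: real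
      using zero_le_power2[of "2 * \<eta> * a - b"] by (simp add: power2_eq_square algebra_simps)
    have "4 * \<eta> * (\<bar>h n x\<bar> * \<bar>w x\<bar> - \<eta> * (h n x)\<^sup>2) \<le> (w x)\<^sup>2"
      using *[of "\<bar>h n x\<bar>" "\<bar>w x\<bar>"] by simp
    then have "\<bar>h n x\<bar> * \<bar>w x\<bar> - \<eta> * (h n x)\<^sup>2 \<le> (w x)\<^sup>2 / (4 * \<eta>)"
      using eta by (simp add: pos_le_divide_eq mult.commute)
    moreover have "0 \<le> (w x)\<^sup>2 / (4 * \<eta>)" using eta by simp
    ultimately show ?thesis by (simp add: p_def)
  qed
  have wi: "integrable lebesgue (\<lambda>x. (w x)\<^sup>2 / (4 * \<eta>))" using sq_integrable_square[OF w] by simp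
  have pl: "(\<lambda>n. LINT x|lebesgue. p n x) \<longlonglongrightarrow> (LINT x|(lebesgue::real measure). 0)"
  proof (rule integral_dominated_convergence[OF _ pm wi])
    show "AE x in lebesgue. (\<lambda>n. p n x) \<longlonglongrightarrow> 0"
    proof (rule AE_I2)
      fix x
      have "(\<lambda>n. max 0 (\<bar>h n x\<bar> * \<bar>w x\<bar> - \<eta> * (h n x)\<^sup>2)) \<longlonglongrightarrow> max 0 (\<bar>0\<bar> * \<bar>w x\<bar> - \<eta> * 0\<^sup>2)"
        by (intro tendsto_intros l)
      then show "(\<lambda>n. p n x) \<longlonglongrightarrow> 0" by (simp add: p_def)
    qed
    show "AE x in lebesgue. norm (p n x) \<le> (w x)\<^sup>2 / (4 * \<eta>)" for n using pb by simp
  qed simp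
  have pi: "integrable lebesgue (p n)" for n
    by (rule Bochner_Integration.integrable_bound[OF wi pm]) (use pb eta in \<open>auto intro!: AE_I2\<close>)
  obtain N where N: "\<And>n. N \<le> n \<Longrightarrow> \<bar>LINT x|lebesgue. p n x\<bar> < e / 2"
    using LIMSEQ_D[OF pl, of "e/2"] e by auto
  have hi: "integrable lebesgue (\<lambda>x. \<bar>h n x\<bar> * \<bar>w x\<bar>)" for n
    using integrable_abs[OF sq_integrable_mult[OF h w]] by (simp add: abs_mult)
  show "\<exists>N. \<forall>n\<ge>N. norm ((LINT x|lebesgue. \<bar>h n x\<bar> * \<bar>w x\<bar>) - 0) < e"
  proof (intro exI allI impI)
    fix n assume n: "N \<le> n"
    have "(LINT x|lebesgue. \<bar>h n x\<bar> * \<bar>w x\<bar>) \<le> (LINT x|lebesgue. \<eta> * (h n x)\<^sup>2 + p n x)"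
    proof (rule integral_mono[OF hi])
      show "integrable lebesgue (\<lambda>x. \<eta> * (h n x)\<^sup>2 + p n x)"
        by (intro Bochner_Integration.integrable_add integrable_mult_right sq_integrable_square h pi)
      show "\<bar>h n x\<bar> * \<bar>w x\<bar> \<le> \<eta> * (h n x)\<^sup>2 + p n x" for x by (auto simp: p_def)
    qed
    also have "\<dots> = \<eta> * (LINT x|lebesgue. (h n x)\<^sup>2) + (LINT x|lebesgue. p n x)"
      using pi sq_integrable_square[OF h] by simp
    also have "\<eta> * (LINT x|lebesgue. (h n x)\<^sup>2) \<le> \<eta> * K" using K eta by (intro mult_left_mono) auto
    also have "\<eta> * K \<le> e / 2" using e K0 by (simp add: \<eta>_def field_simps)
    finally have "(LINT x|lebesgue. \<bar>h n x\<bar> * \<bar>w x\<bar>) < e" using N[OF n] by linarith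
    moreover have "0 \<le> (LINT x|lebesgue. \<bar>h n x\<bar> * \<bar>w x\<bar>)" by (intro integral_nonneg_AE AE_I2) simp
    ultimately show "norm ((LINT x|lebesgue. \<bar>h n x\<bar> * \<bar>w x\<bar>) - 0) < e" by simp
  qed
qed

lemma H1pair_integral_pos:
  assumes h: "H1pair u g" and x: "u x \<noteq> 0" shows "0 < (LINT x|lebesgue. (u x)\<^sup>2)"
proof (rule ccontr)
  assume "\<not> ?thesis"
  moreover have "0 \<le> (LINT x|lebesgue. (u x)\<^sup>2)" by simp
  ultimately have "(LINT x|lebesgue. (u x)\<^sup>2) = 0" by linarith
  then have "AE x in lebesgue. (u x)\<^sup>2 = 0"
    by (subst integral_nonneg_eq_0_iff_AE[symmetric, OF H1pairD(6)[OF h]]) simp_all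
  then have "AE x in lebesgue. u x = 0" by simp
  then have "u = (\<lambda>x. 0)"
    by (intro continuous_AE_eq H1pairD(8)[OF h]) auto
  then show False using x by simp
qed

lemma bdd_tendsto_integral:
  fixes U :: "nat \<Rightarrow> real \<Rightarrow> real"
  assumes U: "\<And>n. bdd_by K (U n)" and l: "\<And>x. (\<lambda>n. U n x) \<longlonglongrightarrow> V x" and f: "integrable lebesgue f"
  shows "bdd_by K V" "(\<lambda>n. LINT x|lebesgue. U n x * f x) \<longlonglongrightarrow> (LINT x|lebesgue. V x * f x)"
proof -
  have Um [measurable]: "U n \<in> borel_measurable lebesgue" for n using U by (simp add: bdd_by_def)
  have Vm [measurable]: "V \<in> borel_measurable lebesgue"
    by (rule borel_measurable_LIMSEQ_real[OF l Um])
  have fm [measurable]: "f \<in> borel_measurable lebesgue" using f by (rule borel_measurable_integrable)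
  have "\<bar>V x\<bar> \<le> K" for x
    by (rule LIMSEQ_le_const2[OF tendsto_rabs[OF l]]) (use bdd_by_abs[OF U] in blast)
  then show "bdd_by K V" using Vm by (simp add: bdd_by_def)
  show "(\<lambda>n. LINT x|lebesgue. U n x * f x) \<longlonglongrightarrow> (LINT x|lebesgue. V x * f x)"
  proof (rule integral_dominated_convergence)
    show "integrable lebesgue (\<lambda>x. K * \<bar>f x\<bar>)" using f by simp
    show "(\<lambda>x. V x * f x) \<in> borel_measurable lebesgue" "(\<lambda>x. U n x * f x) \<in> borel_measurable lebesgue" for n
      by measurable
    show "AE x in lebesgue. (\<lambda>n. U n x * f x) \<longlonglongrightarrow> V x * f x" by (intro AE_I2 tendsto_mult l tendsto_const)
    show "AE x in lebesgue. norm (U n x * f x) \<le> K * \<bar>f x\<bar>" for n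
      using bdd_by_abs[OF U] by (intro AE_I2) (simp add: abs_mult mult_right_mono)
  qed
qed

lemma qform_tendsto:
  fixes U :: "nat \<Rightarrow> real \<Rightarrow> real"
  assumes U: "\<And>n. bdd_by K (U n)" and l: "\<And>x. (\<lambda>n. U n x) \<longlonglongrightarrow> V x" and u: "H1pair u g"
  shows "(\<lambda>n. qform (U n) u g) \<longlonglongrightarrow> qform V u g"
proof -
  have V: "bdd_by K V" and lim: "(\<lambda>n. LINT x|lebesgue. U n x * (u x)\<^sup>2) \<longlonglongrightarrow> (LINT x|lebesgue. V x * (u x)\<^sup>2)"
    using bdd_tendsto_integral[OF U l H1pairD(6)[OF u]] by auto
  show ?thesis unfolding qform_split[OF U u] qform_split[OF V u] by (intro tendsto_add tendsto_const lim)
qed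

lemma nlin_tendsto:
  fixes \<Gamma> :: "nat \<Rightarrow> real \<Rightarrow> real"
  assumes G: "\<And>n. bdd_by M (\<Gamma> n)" and l: "\<And>x. (\<lambda>n. \<Gamma> n x) \<longlonglongrightarrow> \<Delta> x" and u: "H1pair u g" and r: "2 \<le> r"
  shows "(\<lambda>n. nlin (\<Gamma> n) r u) \<longlonglongrightarrow> nlin \<Delta> r u"
  unfolding nlin_def by (rule bdd_tendsto_integral(2)[OF G l H1pair_powr_integrable[OF u r]])

text \<open>On the open unit interval \<open>t powr q < t\<close>, so a genuine splitting of unit
  mass gives a sum below 1.\<close>

lemma superadditivity_strict:
  fixes \<alpha> q :: real
  assumes "0 < \<alpha>" "\<alpha> \<le> 1" "1 < q" "1 \<le> \<alpha> powr q + (1 - \<alpha>) powr q" shows "\<alpha> = 1"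
proof (rule ccontr)
  assume "\<alpha> \<noteq> 1"
  then have a: "0 < \<alpha>" "\<alpha> < 1" using assms by auto
  have *: "t powr q < t" if "0 < t" "t < 1" for t :: real
    using powr_less_mono'[of t 1 q] that assms(3) by simp
  show False using *[of \<alpha>] *[of "1 - \<alpha>"] a assms(4) by simp
qed

text \<open>The coefficients depend on \<open>n\<close> because translating the functions moves the
  interface. They are uniformly bounded and converge pointwise, so integrals against the fixed
  profile converge; the remainder is compared through the inequality with the common constant
  \<open>S\<close>.\<close>

lemma maximizing_profile:
  fixes U \<Gamma> :: "nat \<Rightarrow> real \<Rightarrow> real"
  assumes U: "\<And>n. bdd_by K (U n)" "\<And>x. (\<lambda>n. U n x) \<longlonglongrightarrow> V x"
    and G: "\<And>n. bdd_by M (\<Gamma> n)" "\<And>x. (\<lambda>n. \<Gamma> n x) \<longlonglongrightarrow> \<Delta> x"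
    and \<delta>: "0 < \<delta>" "\<And>n u g. H1pair u g \<Longrightarrow> \<delta> * ((LINT x|lebesgue. (u x)\<^sup>2) + (LINT x|lebesgue. (g x)\<^sup>2)) \<le> qform (U n) u g"
    and r: "2 < r" and S: "0 < S" "\<And>n u g. H1pair u g \<Longrightarrow> nlin (\<Gamma> n) r u \<le> S * qform (U n) u g powr (r / 2)"
    and v: "\<And>n. H1pair (v n) (g n)" "\<And>n. qform (U n) (v n) (g n) = 1" "(\<lambda>n. nlin (\<Gamma> n) r (v n)) \<longlonglongrightarrow> S"
    and w: "H1pair w h" "\<And>x. (\<lambda>n. v n x) \<longlonglongrightarrow> w x" "(\<lambda>n. LINT x|lebesgue. g n x * h x) \<longlonglongrightarrow> (LINT x|lebesgue. (h x)\<^sup>2)"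
    and w0: "w x0 \<noteq> 0"
  shows "qform V w h = 1" "nlin \<Delta> r w = S"
proof -
  have r2: "2 \<le> r" using r by simp
  have nn: "0 \<le> (LINT x|lebesgue. (f x)\<^sup>2)" for f :: "real \<Rightarrow> real" by simp
  have V: "bdd_by K V" by (rule bdd_tendsto_integral(1)[OF U, of "\<lambda>x. 0"]) simp
  define \<alpha> where "\<alpha> = qform V w h"
  define \<beta> where "\<beta> = nlin \<Delta> r w"
  have al: "(\<lambda>n. qform (U n) w h) \<longlonglongrightarrow> \<alpha>" unfolding \<alpha>_def by (rule qform_tendsto[OF U w(1)])
  have bl: "(\<lambda>n. nlin (\<Gamma> n) r w) \<longlonglongrightarrow> \<beta>" unfolding \<beta>_def by (rule nlin_tendsto[OF G w(1) r2])
  define z where "z n x = v n x - w x" for n x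
  have zH: "H1pair (z n) (\<lambda>x. g n x - h x)" for n unfolding z_def by (rule H1pair_diff[OF v(1) w(1)])
  have vb: "(LINT x|lebesgue. (v n x)\<^sup>2) + (LINT x|lebesgue. (g n x)\<^sup>2) \<le> 1 / \<delta>" for n
    using \<delta>(2)[OF v(1), of n n] \<delta>(1) unfolding v(2) by (simp add: field_simps)
  have zb: "(LINT x|lebesgue. (z n x)\<^sup>2) \<le> 2 * (1 / \<delta>) + 2 * (LINT x|lebesgue. (w x)\<^sup>2)" for n
  proof -
    have "(LINT x|lebesgue. (z n x)\<^sup>2) \<le> 2 * (LINT x|lebesgue. (v n x)\<^sup>2) + 2 * (LINT x|lebesgue. (w x)\<^sup>2)"
      unfolding z_def parallelogram_L2[OF H1pairD(2)[OF v(1)] H1pairD(2)[OF w(1)]] by simp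
    then show ?thesis using vb[of n] nn[of "g n"] by argo
  qed
  have zl: "(\<lambda>n. z n x) \<longlonglongrightarrow> 0" for x unfolding z_def using tendsto_diff[OF w(2) tendsto_const, of x "w x"] by simp
  have cross: "(\<lambda>n. LINT x|lebesgue. \<bar>z n x\<bar> * \<bar>w x\<bar>) \<longlonglongrightarrow> 0"
    by (rule tendsto_integral_cross_zero[OF H1pairD(2)[OF zH] zb zl H1pairD(2)[OF w(1)]])
  have ci: "integrable lebesgue (\<lambda>x. \<bar>z n x\<bar> * \<bar>w x\<bar>)" for n
    using integrable_abs[OF sq_integrable_mult[OF H1pairD(2)[OF zH] H1pairD(2)[OF w(1)]]] by (simp add: abs_mult)
  have pot: "(\<lambda>n. LINT x|lebesgue. U n x * (z n x * w x)) \<longlonglongrightarrow> 0"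
  proof (rule Lim_null_comparison[OF always_eventually tendsto_mult_right_zero[OF cross]], rule allI)
    fix n
    have i: "integrable lebesgue (\<lambda>x. U n x * (z n x * w x))"
      by (intro bdd_mult_integrable[OF U(1)] sq_integrable_mult H1pairD(2)[OF zH] H1pairD(2)[OF w(1)])
    have "norm (LINT x|lebesgue. U n x * (z n x * w x)) \<le> (LINT x|lebesgue. norm (U n x * (z n x * w x)))"
      by (rule integral_norm_bound)
    also have "\<dots> \<le> (LINT x|lebesgue. K * (\<bar>z n x\<bar> * \<bar>w x\<bar>))"
      using bdd_by_abs[OF U(1), of n] by (intro integral_mono integrable_norm i integrable_mult_right ci) (auto simp: abs_mult intro!: mult_right_mono)
    finally show "norm (LINT x|lebesgue. U n x * (z n x * w x)) \<le> K * (LINT x|lebesgue. \<bar>z n x\<bar> * \<bar>w x\<bar>)" by simp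
  qed
  \<comment> \<open>The derivative part converges by the pairing with \<open>h\<close>; the
    potential part is split into the vanishing cross term and an integral against the fixed
    \<open>w\<close>.\<close>
  have bform_lim: "(\<lambda>n. bform (U n) (v n) (g n) w h) \<longlonglongrightarrow> \<alpha>"
  proof -
    have eq: "bform (U n) (v n) (g n) w h = (LINT x|lebesgue. g n x * h x) + ((LINT x|lebesgue. U n x * (z n x * w x)) + (LINT x|lebesgue. U n x * (w x)\<^sup>2))" for n
    proof -
      have i: "integrable lebesgue (\<lambda>x. g n x * h x)" "integrable lebesgue (\<lambda>x. U n x * (z n x * w x))" "integrable lebesgue (\<lambda>x. U n x * (w x)\<^sup>2)"
        by (intro bdd_mult_integrable[OF U(1)] sq_integrable_mult H1pairD[OF zH] H1pairD[OF w(1)] H1pairD[OF v(1)])+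
      have "bform (U n) (v n) (g n) w h = (LINT x|lebesgue. g n x * h x + (U n x * (z n x * w x) + U n x * (w x)\<^sup>2))"
        unfolding bform_def by (rule Bochner_Integration.integral_cong) (auto simp: z_def power2_eq_square algebra_simps)
      then show ?thesis using i by simp
    qed
    have 1: "(\<lambda>n. LINT x|lebesgue. U n x * (w x)\<^sup>2) \<longlonglongrightarrow> (LINT x|lebesgue. V x * (w x)\<^sup>2)"
      by (rule bdd_tendsto_integral(2)[OF U H1pairD(6)[OF w(1)]])
    have "(\<lambda>n. bform (U n) (v n) (g n) w h) \<longlonglongrightarrow> (LINT x|lebesgue. (h x)\<^sup>2) + (0 + (LINT x|lebesgue. V x * (w x)\<^sup>2))"
      unfolding eq by (intro tendsto_add w(3) pot 1)
    then show ?thesis unfolding \<alpha>_def qform_split[OF V w(1)] by simp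
  qed
  have qz: "qform (U n) (z n) (\<lambda>x. g n x - h x) = 1 - 2 * bform (U n) (v n) (g n) w h + qform (U n) w h" for n
    using qform_add[OF U(1) v(1) w(1), of n n "-1"] v(2)[of n] by (simp add: z_def[abs_def])
  have ql: "(\<lambda>n. qform (U n) (z n) (\<lambda>x. g n x - h x)) \<longlonglongrightarrow> 1 - \<alpha>"
  proof -
    have "(\<lambda>n. 1 - 2 * bform (U n) (v n) (g n) w h + qform (U n) w h) \<longlonglongrightarrow> 1 - 2 * \<alpha> + \<alpha>"
      by (intro tendsto_intros bform_lim al)
    then show ?thesis unfolding qz by simp
  qed
  have qz0: "0 \<le> qform (U n) u k" if "H1pair u k" for n u k
  proof -
    have "0 \<le> \<delta> * ((LINT x|lebesgue. (u x)\<^sup>2) + (LINT x|lebesgue. (k x)\<^sup>2))" using \<delta>(1) by simp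
    then show ?thesis using \<delta>(2)[OF that, of n] by linarith
  qed
  obtain B1 where B1: "\<And>x. \<bar>w x\<bar> \<le> B1" using H1pair_bounded[OF w(1)] by blast
  \<comment> \<open>A common bound for \<open>w\<close> and the remainders;
    \<open>sqrt (2 / \<delta>)\<close> bounds \<open>v n\<close> by the sup estimate and the
    normalisation of the form.\<close>
  define B where "B = max B1 (sqrt (2 / \<delta>) + B1)"
  have wB: "\<bar>w x\<bar> \<le> B" for x using B1[of x] by (simp add: B_def)
  have zB: "\<bar>z n x\<bar> \<le> B" for n x
  proof -
    have "(v n x)\<^sup>2 \<le> 2 / \<delta>" using H1pair_sup[OF v(1), of n x] vb[of n] by argo
    then have "\<bar>v n x\<bar> \<le> sqrt (2 / \<delta>)" using real_sqrt_le_mono by fastforce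
    then show ?thesis using B1[of x] unfolding z_def B_def by linarith
  qed
  define C where "C = (r * 2 powr (r - 1) + 1) * B powr (r - 2)"
  have M0: "0 \<le> M" using bdd_by_nonneg[OF G(1)] .
  have diff: "(\<lambda>n. nlin (\<Gamma> n) r (v n) - nlin (\<Gamma> n) r (z n) - nlin (\<Gamma> n) r w) \<longlonglongrightarrow> 0"
  proof (rule Lim_null_comparison[OF always_eventually tendsto_mult_right_zero[OF cross]], rule allI)
    fix n
    have i: "integrable lebesgue (\<lambda>x. \<Gamma> n x * \<bar>v n x\<bar> powr r)" "integrable lebesgue (\<lambda>x. \<Gamma> n x * \<bar>z n x\<bar> powr r)" "integrable lebesgue (\<lambda>x. \<Gamma> n x * \<bar>w x\<bar> powr r)"
      by (rule nlin_integrable[OF G(1) v(1) r2], rule nlin_integrable[OF G(1) zH r2], rule nlin_integrable[OF G(1) w(1) r2])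
    let ?f = "\<lambda>x. \<Gamma> n x * \<bar>v n x\<bar> powr r - \<Gamma> n x * \<bar>z n x\<bar> powr r - \<Gamma> n x * \<bar>w x\<bar> powr r"
    have fi: "integrable lebesgue ?f" using i by (intro Bochner_Integration.integrable_diff)
    have "norm (nlin (\<Gamma> n) r (v n) - nlin (\<Gamma> n) r (z n) - nlin (\<Gamma> n) r w) = norm (LINT x|lebesgue. ?f x)"
      unfolding nlin_def using i by simp
    also have "\<dots> \<le> (LINT x|lebesgue. norm (?f x))" by (rule integral_norm_bound)
    also have "\<dots> \<le> (LINT x|lebesgue. M * C * (\<bar>z n x\<bar> * \<bar>w x\<bar>))"
    proof (intro integral_mono integrable_norm fi integrable_mult_right ci)
      fix x
      have "norm (?f x) = \<bar>\<Gamma> n x\<bar> * \<bar>\<bar>z n x + w x\<bar> powr r - \<bar>z n x\<bar> powr r - \<bar>w x\<bar> powr r\<bar>"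
        by (simp add: z_def abs_mult[symmetric] algebra_simps)
      also have "\<dots> \<le> M * (C * (\<bar>z n x\<bar> * \<bar>w x\<bar>))"
        unfolding C_def using bdd_by_abs[OF G(1)] M0 by (intro mult_mono powr_split_bound r2 zB wB) auto
      finally show "norm (?f x) \<le> M * C * (\<bar>z n x\<bar> * \<bar>w x\<bar>)" by (simp add: mult.assoc)
    qed
    finally show "norm (nlin (\<Gamma> n) r (v n) - nlin (\<Gamma> n) r (z n) - nlin (\<Gamma> n) r w) \<le> M * C * (LINT x|lebesgue. \<bar>z n x\<bar> * \<bar>w x\<bar>)" by simp
  qed
  have nl: "(\<lambda>n. nlin (\<Gamma> n) r (z n)) \<longlonglongrightarrow> S - \<beta>"
    using tendsto_diff[OF tendsto_diff[OF v(3) bl] diff] by simp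
  have a1: "\<alpha> \<le> 1" using LIMSEQ_le_const[OF ql, of 0] qz0[OF zH] by auto
  have a0: "0 < \<alpha>"
  proof -
    have "\<delta> * ((LINT x|lebesgue. (w x)\<^sup>2) + (LINT x|lebesgue. (h x)\<^sup>2)) \<le> \<alpha>"
      using LIMSEQ_le_const[OF al] \<delta>(2)[OF w(1)] by blast
    moreover have "0 < \<delta> * ((LINT x|lebesgue. (w x)\<^sup>2) + (LINT x|lebesgue. (h x)\<^sup>2))"
      using H1pair_integral_pos[OF w(1) w0] nn[of h] \<delta>(1) by (simp add: add_pos_nonneg)
    ultimately show ?thesis by linarith
  qed
  have plim: "(\<lambda>n. S * qform (U n) (f n) (k n) powr (r / 2)) \<longlonglongrightarrow> S * l powr (r / 2)"
    if "(\<lambda>n. qform (U n) (f n) (k n)) \<longlonglongrightarrow> l" "\<And>n. H1pair (f n) (k n)" for f k l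
    using r qz0[OF that(2)] by (intro tendsto_mult tendsto_const tendsto_powr' that(1)) auto
  \<comment> \<open>Profile and remainder each satisfy the optimal inequality. Their values add up
    to \<open>S\<close>, their form values to 1, so nothing can be left in the remainder.\<close>
  have b1: "\<beta> \<le> S * \<alpha> powr (r / 2)"
    by (rule LIMSEQ_le[OF bl plim[of "\<lambda>n. w" "\<lambda>n. h", OF al w(1)]]) (use S(2)[OF w(1)] in blast)
  have b2: "S - \<beta> \<le> S * (1 - \<alpha>) powr (r / 2)"
    by (rule LIMSEQ_le[OF nl plim[of z "\<lambda>n x. g n x - h x", OF ql zH]]) (use S(2)[OF zH] in blast)
  have "S * 1 \<le> S * (\<alpha> powr (r / 2) + (1 - \<alpha>) powr (r / 2))" using b1 b2 by (simp add: algebra_simps)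
  then have "1 \<le> \<alpha> powr (r / 2) + (1 - \<alpha>) powr (r / 2)" using S(1) by (rule mult_left_le_imp_le)
  then have \<alpha>1: "\<alpha> = 1" using superadditivity_strict[OF a0 a1, of "r / 2"] r by simp
  then show "qform V w h = 1" by (simp add: \<alpha>_def)
  show "nlin \<Delta> r w = S" using b1 b2 \<alpha>1 by (simp add: \<beta>_def)
qed

text \<open>A monotone sequence of integers either becomes constant or is unbounded. Applied to the
  translations, the three cases correspond to the three limit problems.\<close>

lemma int_subsequence:
  fixes k :: "nat \<Rightarrow> int"
  shows "\<exists>s. strict_mono s \<and> ((\<exists>c. \<forall>\<^sub>F n in sequentially. k (s n) = c) \<or>
    (\<forall>N. \<forall>\<^sub>F n in sequentially. N \<le> k (s n)) \<or> (\<forall>N. \<forall>\<^sub>F n in sequentially. k (s n) \<le> N))"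
proof -
  have mono: "(\<exists>c. \<forall>\<^sub>F n in sequentially. f n = c) \<or> (\<forall>N. \<forall>\<^sub>F n in sequentially. N \<le> f n)"
    if inc: "incseq f" for f :: "nat \<Rightarrow> int"
  proof (cases "\<forall>N. \<exists>n. N \<le> f n")
    case True
    have "\<forall>\<^sub>F n in sequentially. N \<le> f n" for N
    proof -
      obtain n0 where "N \<le> f n0" using True by blast
      then have "N \<le> f n" if "n0 \<le> n" for n using incseqD[OF inc that] by linarith
      then show ?thesis by (rule eventually_sequentiallyI)
    qed
    then show ?thesis by blast
  next
    case False
    then obtain N where N: "\<And>n. f n < N" by (meson not_le)
    have "range f \<subseteq> {f 0..N}" by (rule image_subsetI) (use N[THEN less_imp_le] incseqD[OF inc, of 0] in auto)
    then have fin: "finite (range f)" by (rule finite_subset) simp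
    then have "Max (range f) \<in> range f" by (intro Max_in) auto
    then obtain n0 where n0: "Max (range f) = f n0" by (rule imageE)
    have "f n = f n0" if "n0 \<le> n" for n
      using incseqD[OF inc that] Max_ge[OF fin, of "f n"] n0 by simp
    then have "\<forall>\<^sub>F n in sequentially. f n = f n0" by (rule eventually_sequentiallyI)
    then show ?thesis by blast
  qed
  obtain s where s: "strict_mono s" "monoseq (\<lambda>n. k (s n))" using seq_monosub[of k] by blast
  show ?thesis
  proof (cases "incseq (\<lambda>n. k (s n))")
    case True
    then show ?thesis using mono[OF True] s(1) by blast
  next
    case False
    then have "incseq (\<lambda>n. - k (s n))" using s(2) by (auto simp: monoseq_iff incseq_def decseq_def)
    from mono[OF this] show ?thesis
    proof
      assume "\<exists>c. \<forall>\<^sub>F n in sequentially. - k (s n) = c"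
      then obtain c where "\<forall>\<^sub>F n in sequentially. - k (s n) = c" by blast
      then have "\<forall>\<^sub>F n in sequentially. k (s n) = - c" by eventually_elim simp
      then show ?thesis using s(1) by blast
    next
      assume a: "\<forall>N. \<forall>\<^sub>F n in sequentially. N \<le> - k (s n)"
      have "\<forall>\<^sub>F n in sequentially. k (s n) \<le> N" for N
        using a[rule_format, of "- N"] by eventually_elim simp
      then show ?thesis using s(1) by blast
    qed
  qed
qed

lemma sq_integrable_compact_support:
  assumes c: "continuous_on UNIV f" and z: "\<And>x. x \<notin> {a..b} \<Longrightarrow> f x = 0"
  shows "sq_integrable f"
  unfolding sq_integrable_def
  using compact_support_integrable[OF locally_integrable_continuous[OF c] c z] borel_measurable_lebesgue_continuous[OF c]
  by (simp add: power2_eq_square)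

text \<open>Makes the supremum positive although the coefficient may change sign. A nonnegative test
  \<open>\<psi>\<close> with positive integral against \<open>\<Gamma>\<close> exists; its r-th root
  has the right nonlinear term but is merely continuous, hence the mollification.\<close>

lemma nlin_positive_exists:
  assumes G: "bdd_by M \<Gamma>" and pos: "\<not> (AE x in lebesgue. \<Gamma> x \<le> 0)" and r: "2 < r"
  shows "\<exists>u g. H1pair u g \<and> 0 < nlin \<Gamma> r u"
proof -
  have Gl: "locally_integrable \<Gamma>"
    unfolding locally_integrable_def set_integrable_def
  proof (intro allI)
    fix a b :: real
    from bdd_mult_integrable[OF G integrable_indicator_Icc] show "integrable lebesgue (\<lambda>x. indicator {a..b} x *\<^sub>R \<Gamma> x)"
      by (simp add: mult.commute)
  qed
  obtain \<psi> R where c: "continuous_on UNIV \<psi>" and p0: "\<And>x. 0 \<le> \<psi> x" and z: "\<And>x. x \<notin> {-R..R} \<Longrightarrow> \<psi> x = 0"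
    and i: "0 < (LINT x|lebesgue. \<psi> x * \<Gamma> x)"
  proof (rule ccontr)
    assume no: "\<not> thesis"
    have "AE x in lebesgue. \<Gamma> x \<le> 0"
    proof (rule AE_nonpos_of_test[OF Gl])
      fix \<psi> :: "real \<Rightarrow> real" and R
      assume a: "continuous_on UNIV \<psi>" "\<And>x. 0 \<le> \<psi> x" "\<And>x. x \<notin> {-R..R} \<Longrightarrow> \<psi> x = 0"
      show "(LINT x|lebesgue. \<psi> x * \<Gamma> x) \<le> 0"
      proof (rule ccontr)
        assume "\<not> ?thesis"
        then have "0 < (LINT x|lebesgue. \<psi> x * \<Gamma> x)" by simp
        then show False using no that[OF a] by blast
      qed
    qed
    then show False using pos by blast
  qed
  define f where "f x = \<psi> x powr (1 / r)" for x
  have fc: "continuous_on UNIV f"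
    unfolding f_def using r p0 by (intro continuous_on_powr' c continuous_on_const) auto
  have fz: "f x = 0" if "x \<notin> {-R..R}" for x using z[OF that] by (simp add: f_def)
  have fr: "\<bar>f x\<bar> powr r = \<psi> x" for x using r p0[of x] by (simp add: f_def powr_powr)
  obtain \<phi> \<phi>' :: "nat \<Rightarrow> real \<Rightarrow> real" where m:
    "\<And>n x. (\<phi> n has_real_derivative \<phi>' n x) (at x)" "\<And>n. continuous_on UNIV (\<phi>' n)"
    "\<And>n x. x \<notin> {-R-1..R+1} \<Longrightarrow> \<phi> n x = 0" "\<And>n x. x \<notin> {-R-1..R+1} \<Longrightarrow> \<phi>' n x = 0"
    "\<And>n x. \<exists>y. \<phi> n x = f y" "\<And>x. (\<lambda>n. \<phi> n x) \<longlonglongrightarrow> f x"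
    by (rule mollify[of f R, OF fc fz]) blast+
  have prim: "primitive (\<phi> n) (\<phi>' n)" for n by (rule primitive_C1[OF m(1,2)])
  have H: "H1pair (\<phi> n) (\<phi>' n)" for n
    unfolding H1pair_def using prim sq_integrable_compact_support[OF primitive_continuous[OF prim] m(3)]
      sq_integrable_compact_support[OF m(2) m(4)] by blast
  obtain B where B: "B \<ge> 0" "\<And>x. x \<in> {-R..R} \<Longrightarrow> \<bar>f x\<bar> \<le> B" using continuous_bounded_interval[OF fc] by metis
  have fB: "\<bar>f x\<bar> \<le> B" for x using B fz[of x] by (cases "x \<in> {-R..R}") auto
  have B': "\<bar>\<phi> n x\<bar> \<le> B" for n x using m(5)[of n x] fB by auto
  have Gm [measurable]: "\<Gamma> \<in> borel_measurable lebesgue" using G by (rule bdd_by_borel)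
  have "(\<lambda>n. LINT x|lebesgue. \<Gamma> x * \<bar>\<phi> n x\<bar> powr r) \<longlonglongrightarrow> (LINT x|lebesgue. \<Gamma> x * \<bar>f x\<bar> powr r)"
  proof (rule integral_dominated_convergence)
    show "integrable lebesgue (\<lambda>x. M * B powr r * indicator {-R-1..R+1} x)"
      by (intro integrable_mult_right integrable_indicator_Icc)
    show "(\<lambda>x. \<Gamma> x * \<bar>f x\<bar> powr r) \<in> borel_measurable lebesgue" "(\<lambda>x. \<Gamma> x * \<bar>\<phi> n x\<bar> powr r) \<in> borel_measurable lebesgue" for n
      using powr_borel[OF borel_measurable_lebesgue_continuous[OF fc]] powr_borel[OF primitive_borel[OF prim]] by measurable
    show "AE x in lebesgue. (\<lambda>n. \<Gamma> x * \<bar>\<phi> n x\<bar> powr r) \<longlonglongrightarrow> \<Gamma> x * \<bar>f x\<bar> powr r"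
      using r by (intro AE_I2 tendsto_mult tendsto_const tendsto_powr' tendsto_rabs m(6)) auto
    show "AE x in lebesgue. norm (\<Gamma> x * \<bar>\<phi> n x\<bar> powr r) \<le> M * B powr r * indicator {-R-1..R+1} x" for n
    proof (rule AE_I2)
      fix x
      show "norm (\<Gamma> x * \<bar>\<phi> n x\<bar> powr r) \<le> M * B powr r * indicator {-R-1..R+1} x"
      proof (cases "x \<in> {-R-1..R+1}")
        case True
        have "\<bar>\<phi> n x\<bar> powr r \<le> B powr r" using B' r by (intro powr_mono2) auto
        then have "\<bar>\<Gamma> x\<bar> * \<bar>\<phi> n x\<bar> powr r \<le> M * B powr r"
          using bdd_by_abs[OF G] bdd_by_nonneg[OF G] by (intro mult_mono) auto
        then show ?thesis using True by (simp add: abs_mult)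
      next
        case False
        then show ?thesis using m(3)[OF False] by simp
      qed
    qed
  qed
  then have "(\<lambda>n. nlin \<Gamma> r (\<phi> n)) \<longlonglongrightarrow> (LINT x|lebesgue. \<psi> x * \<Gamma> x)"
    unfolding nlin_def fr by (simp add: mult.commute)
  then have "\<forall>\<^sub>F n in sequentially. 0 < nlin \<Gamma> r (\<phi> n)" using i by (rule order_tendstoD(1))
  then obtain n where "0 < nlin \<Gamma> r (\<phi> n)" by (meson eventually_sequentially order_refl)
  then show ?thesis using H by blast
qed

section \<open>Translations and their limits\<close>

lemma qform_unshift: "qform (\<lambda>x. U (x + t)) u g = qform U (\<lambda>x. u (x - t)) (\<lambda>x. g (x - t))"
  using qform_shift[of U t "\<lambda>x. u (x - t)" "\<lambda>x. g (x - t)"] by simp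

lemma nlin_unshift: "nlin (\<lambda>x. \<Gamma> (x + t)) r u = nlin \<Gamma> r (\<lambda>x. u (x - t))"
  using nlin_shift[of \<Gamma> t r "\<lambda>x. u (x - t)"] by simp

lemma H1pair_shift_minus: "H1pair u g \<Longrightarrow> H1pair (\<lambda>x. u (x - t)) (\<lambda>x. g (x - t))"
  using H1pair_shift[of u g "- t"] by simp

lemma coercive_shift:
  assumes c: "\<And>u g. H1pair u g \<Longrightarrow> \<delta> * ((LINT x|lebesgue. (u x)\<^sup>2) + (LINT x|lebesgue. (g x)\<^sup>2)) \<le> qform U u g"
    and u: "H1pair u g"
  shows "\<delta> * ((LINT x|lebesgue. (u x)\<^sup>2) + (LINT x|lebesgue. (g x)\<^sup>2)) \<le> qform (\<lambda>x. U (x + t)) u g"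
  using c[OF H1pair_shift_minus[OF u, of t]] integral_shift[of "\<lambda>x. (u x)\<^sup>2" "- t"] integral_shift[of "\<lambda>x. (g x)\<^sup>2" "- t"]
  unfolding qform_unshift by simp

text \<open>Translations preserve the coercivity constant. Moving the interface to infinity
  therefore transfers it from the interface operator to the periodic ones.\<close>

lemma coercive_limit:
  assumes U: "bdd_by K U" and l: "\<And>x. (\<lambda>n. U (x + t n)) \<longlonglongrightarrow> V x"
    and c: "\<And>u g. H1pair u g \<Longrightarrow> \<delta> * ((LINT x|lebesgue. (u x)\<^sup>2) + (LINT x|lebesgue. (g x)\<^sup>2)) \<le> qform U u g"
    and u: "H1pair u g"
  shows "\<delta> * ((LINT x|lebesgue. (u x)\<^sup>2) + (LINT x|lebesgue. (g x)\<^sup>2)) \<le> qform V u g"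
  by (rule LIMSEQ_le_const[OF qform_tendsto[OF bdd_by_shift[OF U] l u]])
    (use coercive_shift[OF c u] in blast)

lemma interface_limit:
  fixes k :: "nat \<Rightarrow> int"
  assumes 1: "\<And>x. 0 < x \<Longrightarrow> U x = U1 x" and p: "\<And>x k. U1 (x + real_of_int k) = U1 x"
    and k: "\<And>N. \<forall>\<^sub>F n in sequentially. N \<le> k n"
  shows "(\<lambda>n. U (x + real_of_int (k n))) \<longlonglongrightarrow> U1 x"
proof (rule tendsto_eventually)
  show "\<forall>\<^sub>F n in sequentially. U (x + real_of_int (k n)) = U1 x"
    \<comment> \<open>This threshold is strictly larger than \<open>-x\<close>, as needed because
      \<open>U\<close> is prescribed only to the right of 0.\<close>
    using k[of "\<lfloor>- x\<rfloor> + 1"]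
  proof eventually_elim
    case (elim n)
    then have "0 < x + real_of_int (k n)" by linarith
    then show ?case using 1 p by simp
  qed
qed

lemma interface_limit':
  fixes k :: "nat \<Rightarrow> int"
  assumes 1: "\<And>x. x < 0 \<Longrightarrow> U x = U2 x" and p: "\<And>x k. U2 (x + real_of_int k) = U2 x"
    and k: "\<And>N. \<forall>\<^sub>F n in sequentially. k n \<le> N"
  shows "(\<lambda>n. U (x + real_of_int (k n))) \<longlonglongrightarrow> U2 x"
proof (rule tendsto_eventually)
  show "\<forall>\<^sub>F n in sequentially. U (x + real_of_int (k n)) = U2 x"
    using k[of "\<lceil>- x\<rceil> - 1"]
  proof eventually_elim
    case (elim n)
    then have "x + real_of_int (k n) < 0" by linarith
    then show ?case using 1 p by simp
  qed
qed

lemma maximizer_dichotomy: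
  assumes U: "bdd_by K U" and U1: "\<And>x. 0 < x \<Longrightarrow> U x = U1 x" and U2: "\<And>x. x < 0 \<Longrightarrow> U x = U2 x"
    and pU1: "\<And>x k. U1 (x + real_of_int k) = U1 x" and pU2: "\<And>x k. U2 (x + real_of_int k) = U2 x"
    and G: "bdd_by M \<Gamma>" and G1: "\<And>x. 0 < x \<Longrightarrow> \<Gamma> x = \<Gamma>1 x" and G2: "\<And>x. x < 0 \<Longrightarrow> \<Gamma> x = \<Gamma>2 x"
    and pG1: "\<And>x k. \<Gamma>1 (x + real_of_int k) = \<Gamma>1 x" and pG2: "\<And>x k. \<Gamma>2 (x + real_of_int k) = \<Gamma>2 x"
    and d0: "0 < \<delta>" and d: "\<And>u g. H1pair u g \<Longrightarrow> \<delta> * ((LINT x|lebesgue. (u x)\<^sup>2) + (LINT x|lebesgue. (g x)\<^sup>2)) \<le> qform U u g"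
    and r: "2 < r" and ex: "\<exists>u g. H1pair u g \<and> 0 < nlin \<Gamma> r u"
  shows "\<exists>S>0. (\<forall>u g. H1pair u g \<longrightarrow> nlin \<Gamma> r u \<le> S * qform U u g powr (r / 2)) \<and>
    (\<exists>w h. H1pair w h \<and> ((qform U w h = 1 \<and> nlin \<Gamma> r w = S) \<or> (qform U1 w h = 1 \<and> nlin \<Gamma>1 r w = S) \<or>
      (qform U2 w h = 1 \<and> nlin \<Gamma>2 r w = S)))"
proof -
  have r2: "2 \<le> r" using r by simp
  have M0: "0 \<le> M" using bdd_by_nonneg[OF G] .
  have nn: "0 \<le> (LINT x|lebesgue. (f x)\<^sup>2)" for f :: "real \<Rightarrow> real" by simp
  define D where "D = {nlin \<Gamma> r u |u g. H1pair u g \<and> qform U u g = 1}"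
  have norm1: "(LINT x|lebesgue. (u x)\<^sup>2) + (LINT x|lebesgue. (g x)\<^sup>2) \<le> 1 / \<delta>" if "H1pair u g" "qform U u g = 1" for u g
    using d[OF that(1)] that(2) d0 by (simp add: field_simps)
  have norm2: "(LINT x|lebesgue. (u x)\<^sup>2) \<le> 1 / \<delta>" "(LINT x|lebesgue. (g x)\<^sup>2) \<le> 1 / \<delta>" if "H1pair u g" "qform U u g = 1" for u g
    using norm1[OF that] nn[of u] nn[of g] by linarith+
  have small: "nlin \<Gamma> r u \<le> M * B powr (r - 2) / \<delta>" if "H1pair u g" "qform U u g = 1" "\<And>x. \<bar>u x\<bar> \<le> B" for u g B
  proof -
    have "nlin \<Gamma> r u \<le> M * B powr (r - 2) * (LINT x|lebesgue. (u x)\<^sup>2)" by (rule nlin_le[OF G that(1) r2 that(3)])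
    also have "\<dots> \<le> M * B powr (r - 2) * (1 / \<delta>)" using norm2(1)[OF that(1,2)] M0 by (intro mult_left_mono) auto
    finally show ?thesis by simp
  qed
  have sup1: "\<bar>u x\<bar> \<le> sqrt (2 / \<delta>)" if "H1pair u g" "qform U u g = 1" for u g x
  proof -
    have "(u x)\<^sup>2 \<le> 2 / \<delta>" using H1pair_sup[OF that(1), of x] norm1[OF that] by argo
    from real_sqrt_le_mono[OF this] show ?thesis by simp
  qed
  have Dbdd: "bdd_above D"
    by (rule bdd_aboveI[of _ "M * sqrt (2 / \<delta>) powr (r - 2) / \<delta>"]) (use small sup1 in \<open>auto simp: D_def\<close>)
  define S where "S = Sup D"
  have qpos: "0 < qform U u g" if "H1pair u g" "u x \<noteq> 0" for u g x
  proof -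
    have "0 < \<delta> * ((LINT x|lebesgue. (u x)\<^sup>2) + (LINT x|lebesgue. (g x)\<^sup>2))"
      using H1pair_integral_pos[OF that] nn[of g] d0 by (simp add: add_pos_nonneg)
    then show ?thesis using d[OF that(1)] by linarith
  qed
  have scale: "nlin \<Gamma> r u / qform U u g powr (r / 2) \<in> D" if u: "H1pair u g" and x: "u x \<noteq> 0" for u g x
  proof -
    let ?q = "qform U u g"
    have q: "0 < ?q" by (rule qpos[OF u x])
    define c where "c = 1 / sqrt ?q"
    have c: "0 < c" "c\<^sup>2 = 1 / ?q" using q by (auto simp: c_def power_divide)
    have "H1pair (\<lambda>x. c * u x) (\<lambda>x. c * g x)" by (rule H1pair_cmult[OF u])
    moreover have "qform U (\<lambda>x. c * u x) (\<lambda>x. c * g x) = 1" using q by (simp add: qform_cmult c)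
    ultimately have "nlin \<Gamma> r (\<lambda>x. c * u x) \<in> D" unfolding D_def by blast
    also have "nlin \<Gamma> r (\<lambda>x. c * u x) = c powr r * nlin \<Gamma> r u" using c by (simp add: nlin_cmult)
    also have "c powr r = 1 / ?q powr (r / 2)"
      using q by (simp add: c_def powr_divide powr_half_sqrt[symmetric] powr_powr)
    finally show ?thesis by simp
  qed
  have S0: "0 < S"
  proof -
    obtain u g where u: "H1pair u g" "0 < nlin \<Gamma> r u" using ex by blast
    have "\<exists>x. u x \<noteq> 0"
    proof (rule ccontr)
      assume "\<not> ?thesis"
      then have "nlin \<Gamma> r u = 0" by (simp add: nlin_def)
      then show False using u(2) by simp
    qed
    then obtain x where x: "u x \<noteq> 0" by blast
    have "0 < nlin \<Gamma> r u / qform U u g powr (r / 2)" using u(2) qpos[OF u(1) x] by simp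
    also have "\<dots> \<le> S" unfolding S_def by (rule cSup_upper[OF scale[OF u(1) x] Dbdd])
    finally show ?thesis .
  qed
  have Sle: "nlin \<Gamma> r u \<le> S * qform U u g powr (r / 2)" if u: "H1pair u g" for u g
  proof (cases "\<exists>x. u x \<noteq> 0")
    case True
    then obtain x where x: "u x \<noteq> 0" by blast
    have "nlin \<Gamma> r u / qform U u g powr (r / 2) \<le> S" unfolding S_def by (rule cSup_upper[OF scale[OF u x] Dbdd])
    then show ?thesis using qpos[OF u x] by (simp add: pos_divide_le_eq)
  next
    case False
    then have "nlin \<Gamma> r u = 0" by (simp add: nlin_def)
    then show ?thesis using S0 by simp
  qed
  have Dne: "D \<noteq> {}"
  proof
    assume "D = {}"
    obtain u g where u: "H1pair u g" "0 < nlin \<Gamma> r u" using ex by blast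
    then have "u = (\<lambda>x. 0)" using scale[OF u(1)] \<open>D = {}\<close> by auto
    then show False using u(2) by (simp add: nlin_def)
  qed
  \<comment> \<open>The deficit never exceeds \<open>S / 2\<close>, already for
    \<open>n = 0\<close>; the exclusion of vanishing below uses this for every \<open>n\<close>.
    Function and derivative are packed into one pair for a single choice.\<close>
  have "\<exists>p. H1pair (fst p) (snd p) \<and> qform U (fst p) (snd p) = 1 \<and> S - S / (2 * real (Suc n)) < nlin \<Gamma> r (fst p)" for n
  proof -
    have "S - S / (2 * real (Suc n)) < Sup D" using S0 unfolding S_def[symmetric] by simp
    then obtain y where "y \<in> D" "S - S / (2 * real (Suc n)) < y" using less_cSupD[OF Dne] by blast
    then obtain u g where "H1pair u g" "qform U u g = 1" "S - S / (2 * real (Suc n)) < nlin \<Gamma> r u" by (auto simp: D_def)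
    then show ?thesis by (intro exI[of _ "(u, g)"]) simp
  qed
  then have "\<forall>n. \<exists>p. H1pair (fst p) (snd p) \<and> qform U (fst p) (snd p) = 1 \<and> S - S / (2 * real (Suc n)) < nlin \<Gamma> r (fst p)" by blast
  from choice[OF this] obtain p where p: "\<forall>n. H1pair (fst (p n)) (snd (p n)) \<and> qform U (fst (p n)) (snd (p n)) = 1 \<and>
    S - S / (2 * real (Suc n)) < nlin \<Gamma> r (fst (p n))" by blast
  define u g where "u n = fst (p n)" and "g n = snd (p n)" for n
  have u: "H1pair (u n) (g n)" "qform U (u n) (g n) = 1" "S - S / (2 * real (Suc n)) < nlin \<Gamma> r (u n)" for n
    using p by (simp_all add: u_def g_def)
  have ulim: "(\<lambda>n. nlin \<Gamma> r (u n)) \<longlonglongrightarrow> S"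
  proof (rule tendsto_sandwich[OF _ _ _ tendsto_const])
    have "(\<lambda>n. S - S / 2 * (1 / real (Suc n))) \<longlonglongrightarrow> S - S / 2 * 0"
      by (intro tendsto_intros lim_1_over_n[THEN LIMSEQ_Suc])
    then show "(\<lambda>n. S - S / (2 * real (Suc n))) \<longlonglongrightarrow> S" by simp
    show "\<forall>\<^sub>F n in sequentially. S - S / (2 * real (Suc n)) \<le> nlin \<Gamma> r (u n)" using u(3) by (simp add: less_imp_le)
    show "\<forall>\<^sub>F n in sequentially. nlin \<Gamma> r (u n) \<le> S" using Sle[OF u(1)] u(2) by simp
  qed
  have "\<exists>c>0. \<forall>n. \<exists>x. c < \<bar>u n x\<bar>"
  proof -
    \<comment> \<open>If \<open>|u n|\<close> stayed below \<open>c\<close>, the nonlinear term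
      would be at most \<open>M * c powr (r - 2) / \<delta>\<close>, hence at most
      \<open>S / 2\<close>. Writing \<open>M + 1\<close> avoids a division by zero.\<close>
    define c where "c = (S * \<delta> / (2 * (M + 1))) powr (1 / (r - 2))"
    have b: "0 < S * \<delta> / (2 * (M + 1))" using S0 d0 M0 by simp
    have c: "0 < c" unfolding c_def powr_gt_zero using b by linarith
    have cr: "c powr (r - 2) = S * \<delta> / (2 * (M + 1))"
    proof -
      have "c powr (r - 2) = (S * \<delta> / (2 * (M + 1))) powr 1" unfolding c_def powr_powr using r by simp
      then show ?thesis using b by (simp only: powr_one less_imp_le)
    qed
    have "\<exists>x. c < \<bar>u n x\<bar>" for n
    proof (rule ccontr)
      assume "\<not> ?thesis"
      then have "nlin \<Gamma> r (u n) \<le> M * c powr (r - 2) / \<delta>" by (intro small[OF u(1,2)]) (simp add: not_less)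
      also have "\<dots> = M / (M + 1) * (S / 2)"
      proof -
        have "m * (S * \<delta> / (2 * m')) / \<delta> = m / m' * (S / 2)" for m m'
          using d0 by simp
        then show ?thesis unfolding cr .
      qed
      also have "\<dots> \<le> 1 * (S / 2)" using M0 S0 by (intro mult_right_mono) auto
      also have "\<dots> \<le> S - S / (2 * real (Suc n))"
      proof -
        have "S / (2 * real (Suc n)) \<le> S / 2" using S0 by (intro divide_left_mono) auto
        then show ?thesis by simp
      qed
      finally show False using u(3)[of n] by simp
    qed
    then show ?thesis using c by blast
  qed
  then obtain c y where c: "0 < c" "\<And>n. c < \<bar>u n (y n)\<bar>" by metis
  \<comment> \<open>Rounding to an integer keeps the periodic coefficients in place under the
    translation.\<close>
  define k where "k n = \<lfloor>y n\<rfloor>" for n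
  obtain s where s: "strict_mono s" and sk: "(\<exists>c. \<forall>\<^sub>F n in sequentially. k (s n) = c) \<or>
    (\<forall>N. \<forall>\<^sub>F n in sequentially. N \<le> k (s n)) \<or> (\<forall>N. \<forall>\<^sub>F n in sequentially. k (s n) \<le> N)"
    using int_subsequence[of k] by blast
  define v where "v n x = u (s n) (x + real_of_int (k (s n)))" for n x
  define v' where "v' n x = g (s n) (x + real_of_int (k (s n)))" for n x
  have vH: "H1pair (v n) (v' n)" for n unfolding v_def v'_def by (rule H1pair_shift[OF u(1)])
  have vq: "qform (\<lambda>x. U (x + real_of_int (k (s n)))) (v n) (v' n) = 1" for n
    unfolding v_def v'_def qform_shift by (rule u(2))
  have vn: "nlin (\<lambda>x. \<Gamma> (x + real_of_int (k (s n)))) r (v n) = nlin \<Gamma> r (u (s n))" for n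
    unfolding v_def by (rule nlin_shift)
  have v2: "(LINT x|lebesgue. (v n x)\<^sup>2) \<le> 1 / \<delta>" "(LINT x|lebesgue. (v' n x)\<^sup>2) \<le> 1 / \<delta>" for n
    unfolding v_def v'_def
    using integral_shift[of "\<lambda>x. (u (s n) x)\<^sup>2"] integral_shift[of "\<lambda>x. (g (s n) x)\<^sup>2"] norm2[OF u(1,2)] by simp_all
  obtain t w h where t: "strict_mono t" and w: "H1pair w h" "\<And>x. (\<lambda>n. v (t n) x) \<longlonglongrightarrow> w x"
      "(\<lambda>n. LINT x|lebesgue. v' (t n) x * h x) \<longlonglongrightarrow> (LINT x|lebesgue. (h x)\<^sup>2)"
    using H1pair_weak_compactness[of v v' "1 / \<delta>", OF vH v2] by blast
  have "\<exists>x0. w x0 \<noteq> 0"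
  proof -
    \<comment> \<open>After the translation the points of large values lie in the unit interval and
      accumulate at some \<open>l\<close>; the uniform Hoelder bound carries the lower bound
      \<open>c\<close> over to \<open>w l\<close>.\<close>
    define z where "z n = y (s (t n)) - real_of_int (k (s (t n)))" for n
    have zI: "z n \<in> {0..1}" for n unfolding z_def k_def by (simp add: algebra_simps) linarith
    obtain l e where e: "strict_mono (e :: nat \<Rightarrow> nat)" "(z \<circ> e) \<longlonglongrightarrow> l"
      using compact_Icc[of "0::real" 1] zI unfolding compact_def by metis
    have zl: "(\<lambda>n. z (e n)) \<longlonglongrightarrow> l" using e(2) by (simp add: o_def)
    have vz: "c < \<bar>v (t n) (z n)\<bar>" for n unfolding v_def z_def using c(2) by simp
    have "c \<le> \<bar>w l\<bar>"
    proof (rule LIMSEQ_le_const)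
      have d1: "(\<lambda>n. v (t (e n)) (z (e n)) - v (t (e n)) l) \<longlonglongrightarrow> 0"
      proof -
        have "(\<lambda>n. (v (t (e n)) (z (e n)) - v (t (e n)) l)\<^sup>2) \<longlonglongrightarrow> 0"
        proof (rule tendsto_sandwich[OF _ _ tendsto_const])
          have "(\<lambda>n. \<bar>z (e n) - l\<bar> * (1 / \<delta>)) \<longlonglongrightarrow> \<bar>l - l\<bar> * (1 / \<delta>)" by (intro tendsto_intros zl)
          then show "(\<lambda>n. \<bar>z (e n) - l\<bar> * (1 / \<delta>)) \<longlonglongrightarrow> 0" by simp
          show "\<forall>\<^sub>F n in sequentially. (v (t (e n)) (z (e n)) - v (t (e n)) l)\<^sup>2 \<le> \<bar>z (e n) - l\<bar> * (1 / \<delta>)"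
            by (intro always_eventually allI order_trans[OF primitive_Hoelder_global[OF vH]] mult_left_mono v2) simp
        qed simp
        then show ?thesis
          using tendsto_real_sqrt[of "\<lambda>n. (v (t (e n)) (z (e n)) - v (t (e n)) l)\<^sup>2" 0] by (simp add: tendsto_rabs_zero_iff)
      qed
      have d2: "(\<lambda>n. v (t (e n)) l) \<longlonglongrightarrow> w l" using LIMSEQ_subseq_LIMSEQ[OF w(2) e(1)] by (simp add: o_def)
      show "(\<lambda>n. \<bar>v (t (e n)) (z (e n))\<bar>) \<longlonglongrightarrow> \<bar>w l\<bar>"
        using tendsto_rabs[OF tendsto_add[OF d1 d2]] by simp
      show "\<exists>N. \<forall>n\<ge>N. c \<le> \<bar>v (t (e n)) (z (e n))\<bar>" using vz less_imp_le by blast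
    qed
    then have "w l \<noteq> 0" using c(1) by auto
    then show ?thesis ..
  qed
  then obtain x0 where x0: "w x0 \<noteq> 0" ..
  have stlim: "(\<lambda>n. nlin \<Gamma> r (u (s (t n)))) \<longlonglongrightarrow> S"
    using LIMSEQ_subseq_LIMSEQ[OF ulim strict_mono_compose[OF s t]] by (simp add: o_def)
  have final: "qform V w h = 1 \<and> nlin \<Delta> r w = S"
    if V: "\<And>x. (\<lambda>n. U (x + real_of_int (k (s n)))) \<longlonglongrightarrow> V x" and \<Delta>: "\<And>x. (\<lambda>n. \<Gamma> (x + real_of_int (k (s n)))) \<longlonglongrightarrow> \<Delta> x" for V \<Delta>
  proof -
    have V': "(\<lambda>n. U (x + real_of_int (k (s (t n))))) \<longlonglongrightarrow> V x" for x
      using LIMSEQ_subseq_LIMSEQ[OF V t] by (simp add: o_def)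
    have D': "(\<lambda>n. \<Gamma> (x + real_of_int (k (s (t n))))) \<longlonglongrightarrow> \<Delta> x" for x
      using LIMSEQ_subseq_LIMSEQ[OF \<Delta> t] by (simp add: o_def)
    have Sn: "nlin (\<lambda>x. \<Gamma> (x + real_of_int (k (s (t n))))) r f \<le> S * qform (\<lambda>x. U (x + real_of_int (k (s (t n))))) f f' powr (r / 2)"
      if "H1pair f f'" for n f f'
      unfolding qform_unshift nlin_unshift by (rule Sle[OF H1pair_shift_minus[OF that]])
    have vl: "(\<lambda>n. nlin (\<lambda>x. \<Gamma> (x + real_of_int (k (s (t n))))) r (v (t n))) \<longlonglongrightarrow> S"
      unfolding vn by (rule stlim)
    show ?thesis
      using maximizing_profile[of K "\<lambda>n x. U (x + real_of_int (k (s (t n))))" V M "\<lambda>n x. \<Gamma> (x + real_of_int (k (s (t n))))" \<Delta> \<delta> r S "\<lambda>n. v (t n)" "\<lambda>n. v' (t n)" w h x0,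
        OF bdd_by_shift[OF U] V' bdd_by_shift[OF G] D' d0 coercive_shift[OF d] r S0 Sn vH vq vl w x0] by blast
  qed
  have "\<exists>w h. H1pair w h \<and> ((qform U w h = 1 \<and> nlin \<Gamma> r w = S) \<or> (qform U1 w h = 1 \<and> nlin \<Gamma>1 r w = S) \<or>
      (qform U2 w h = 1 \<and> nlin \<Gamma>2 r w = S))"
    using sk
  proof (elim disjE exE)
    fix b assume b: "\<forall>\<^sub>F n in sequentially. k (s n) = b"
    have "(\<lambda>n. f (x + real_of_int (k (s n)))) \<longlonglongrightarrow> f (x + real_of_int b)" for f :: "real \<Rightarrow> real" and x
      by (rule tendsto_eventually) (use b in \<open>eventually_elim, simp\<close>)
    from final[OF this this] have "qform (\<lambda>x. U (x + real_of_int b)) w h = 1 \<and> nlin (\<lambda>x. \<Gamma> (x + real_of_int b)) r w = S" .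
    then show ?thesis unfolding qform_unshift nlin_unshift using H1pair_shift_minus[OF w(1)] by blast
  next
    assume "\<forall>N. \<forall>\<^sub>F n in sequentially. N \<le> k (s n)"
    then have kk: "\<And>N. \<forall>\<^sub>F n in sequentially. N \<le> k (s n)" by blast
    show ?thesis
      using final[OF interface_limit[OF U1 pU1 kk] interface_limit[OF G1 pG1 kk]] w(1) by blast
  next
    assume "\<forall>N. \<forall>\<^sub>F n in sequentially. k (s n) \<le> N"
    then have kk: "\<And>N. \<forall>\<^sub>F n in sequentially. k (s n) \<le> N" by blast
    show ?thesis
      using final[OF interface_limit'[OF U2 pU2 kk] interface_limit'[OF G2 pG2 kk]] w(1) by blast
  qed
  then show ?thesis using S0 Sle by blast
qed

subsection \<open>Replacing a tail by a Bloch mode\<close>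

text \<open>The cut creates no jump because \<open>f\<close> vanishes at 0.\<close>

lemma primitive_cut:
  assumes p: "primitive f f'" and f0: "f 0 = 0"
  shows "primitive (\<lambda>x. indicator {..0} x * f x) (\<lambda>x. indicator {..0} x * f' x)"
  unfolding primitive_def locally_integrable_def
proof (intro conjI allI impI)
  fix a b :: real
  have "set_integrable lebesgue {a..b} (\<lambda>x. f' x * indicator {..0} x)"
    by (rule set_integrable_mult_bounded[OF primitive_integrable[OF p], where C=1]) (auto simp: indicator_def)
  then show "set_integrable lebesgue {a..b} (\<lambda>x. indicator {..0} x * f' x)" by (simp add: mult.commute)
next
  fix a b :: real assume ab: "a \<le> b"
  consider "b \<le> 0" | "0 < a" | "a \<le> 0" "0 < b" using ab by linarith
  then show "indicator {..0} b * f b - indicator {..0} a * f a = (LINT x:{a..b}|lebesgue. indicator {..0} x * f' x)"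
  proof cases
    case 1
    have "(LINT x:{a..b}|lebesgue. indicator {..0} x * f' x) = (LINT x:{a..b}|lebesgue. f' x)"
      unfolding set_lebesgue_integral_def by (rule Bochner_Integration.integral_cong) (use 1 in \<open>auto simp: indicator_def\<close>)
    then show ?thesis using primitive_diff[OF p ab] 1 ab by simp
  next
    case 2
    have "(LINT x:{a..b}|lebesgue. indicator {..0} x * f' x) = (LINT x|(lebesgue::real measure). 0)"
      unfolding set_lebesgue_integral_def by (rule Bochner_Integration.integral_cong) (use 2 in \<open>auto simp: indicator_def\<close>)
    then show ?thesis using 2 ab by simp
  next
    case 3
    have "(LINT x:{a..b}|lebesgue. indicator {..0} x * f' x) = (LINT x:{a..0}|lebesgue. f' x)"
      unfolding set_lebesgue_integral_def by (rule Bochner_Integration.integral_cong) (use 3 in \<open>auto simp: indicator_def\<close>)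
    then show ?thesis using primitive_diff[OF p 3(1)] 3 f0 by simp
  qed
qed

section \<open>Bloch modes as Floquet functions on the left half-line\<close>

lemma floquet_iterate:
  fixes f :: "real \<Rightarrow> real"
  assumes p: "\<And>x. f (x + 1) = exp k * f x" shows "f (x + real n) = exp (k * real n) * f x"
proof (induction n)
  case (Suc n)
  have "f (x + real (Suc n)) = exp k * f (x + real n)" using p[of "x + real n"] by (simp add: add_ac)
  then show ?case using Suc by (simp add: algebra_simps exp_add)
qed simp

text \<open>A translation by the integer part of \<open>-x\<close> leads into the period from -1 to
  0; the extra factor \<open>exp k\<close> in the constant accounts for the fractional part.\<close>

lemma floquet_bound:
  fixes f :: "real \<Rightarrow> real"
  assumes c: "continuous_on UNIV f" and p: "\<And>x. f (x + 1) = exp k * f x" and k: "0 < k"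
  obtains B where "0 \<le> B" "\<forall>x\<le>0. \<bar>f x\<bar> \<le> B * exp (k * x)"
proof -
  obtain C where C: "C \<ge> 0" "\<And>x. x \<in> {-1..0} \<Longrightarrow> \<bar>f x\<bar> \<le> C" using continuous_bounded_interval[OF c] by metis
  have "\<bar>f x\<bar> \<le> (C * exp k) * exp (k * x)" if x: "x \<le> 0" for x
  proof -
    define n where "n = nat \<lfloor>- x\<rfloor>"
    have n: "real n \<le> - x" "- x < real n + 1" using x unfolding n_def by linarith+
    have "\<bar>f (x + real n)\<bar> \<le> C" by (rule C(2)) (use n in auto)
    then have 1: "exp (k * real n) * \<bar>f x\<bar> \<le> C" unfolding floquet_iterate[of f k, OF p] by (simp add: abs_mult)
    have "\<bar>f x\<bar> = exp (- (k * real n)) * (exp (k * real n) * \<bar>f x\<bar>)" by (simp add: exp_minus)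
    also have "\<dots> \<le> exp (- (k * real n)) * C" by (rule mult_left_mono[OF 1]) simp
    also have "\<dots> \<le> exp (k * (x + 1)) * C"
    proof (rule mult_right_mono[OF _ C(1)])
      have "k * (- real n) \<le> k * (x + 1)" using n k by (intro mult_left_mono) auto
      then show "exp (- (k * real n)) \<le> exp (k * (x + 1))" by simp
    qed
    finally show ?thesis by (simp add: distrib_left exp_add mult_ac)
  qed
  then show ?thesis using C(1) that[of "C * exp k"] by simp
qed

lemma floquet_tendsto:
  fixes f :: "real \<Rightarrow> real"
  assumes p: "\<And>x. f (x + 1) = exp k * f x" and k: "0 < k"
  shows "(\<lambda>n. f (- real n)) \<longlonglongrightarrow> 0"
proof -
  have "f (- real n) = exp (- k) ^ n * f 0" for n
    using floquet_iterate[of f k "- real n" n, OF p] by (simp add: exp_minus exp_of_nat_mult[symmetric] field_simps)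
  moreover have "(\<lambda>n. exp (- k) ^ n * f 0) \<longlonglongrightarrow> 0"
    using k by (intro tendsto_mult_left_zero LIMSEQ_realpow_zero) auto
  ultimately show ?thesis by simp
qed

lemma sq_integrable_exp_tail:
  fixes f :: "real \<Rightarrow> real"
  assumes m: "f \<in> borel_measurable lebesgue" and b: "\<forall>x\<le>0. \<bar>f x\<bar> \<le> B * exp (k * x)" and k: "0 < k"
  shows "sq_integrable (\<lambda>x. indicator {..0} x * f x)"
  unfolding sq_integrable_def
proof
  show m': "(\<lambda>x. indicator {..0} x * f x) \<in> borel_measurable lebesgue" using m by measurable
  have "(\<lambda>x::real. exp (- (2 * k) * x)) absolutely_integrable_on {0..}"
    by (rule nonnegative_absolutely_integrable_1[OF integrable_on_exp_minus_to_infinity]) (use k in auto)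
  then have "integrable lebesgue (\<lambda>x. indicator {0..} x * exp (- (2 * k) * x))" by (simp add: set_integrable_def)
  then have "integrable lebesgue (\<lambda>x. indicator {0..} (- x) * exp (- (2 * k) * - x))"
    using integrable_reflect[of "\<lambda>x. indicator {0..} x * exp (- (2 * k) * x)"] by simp
  then have i: "integrable lebesgue (\<lambda>x. B\<^sup>2 * (indicator {0..} (- x) * exp (- (2 * k) * - x)))" by simp
  show "integrable lebesgue (\<lambda>x. (indicator {..0} x * f x)\<^sup>2)"
  proof (rule Bochner_Integration.integrable_bound[OF i])
    show "(\<lambda>x. (indicator {..0} x * f x)\<^sup>2) \<in> borel_measurable lebesgue" using m' by measurable
    show "AE x in lebesgue. norm ((indicator {..0} x * f x)\<^sup>2) \<le> norm (B\<^sup>2 * (indicator {0..} (- x) * exp (- (2 * k) * - x)))"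
    proof (rule AE_I2)
      fix x
      show "norm ((indicator {..0} x * f x)\<^sup>2) \<le> norm (B\<^sup>2 * (indicator {0..} (- x) * exp (- (2 * k) * - x)))"
      proof (cases "x \<le> 0")
        case True
        then have "\<bar>f x\<bar>\<^sup>2 \<le> (B * exp (k * x))\<^sup>2" using b by (intro power_mono) auto
        also have "\<dots> = B\<^sup>2 * exp (2 * k * x)" by (simp add: power_mult_distrib power2_eq_square[of "exp _"] exp_add[symmetric])
        finally show ?thesis using True by simp
      qed simp
    qed
  qed
qed

lemma AE_shift:
  fixes P :: "real \<Rightarrow> bool"
  assumes "AE x in lebesgue. P x" shows "AE x in lebesgue. P (x + t)"
proof -
  have "AE x in lborel. P x" using assms by (simp add: AE_completion_iff)
  then obtain N where N: "N \<in> null_sets lborel" "{x \<in> space lborel. \<not> P x} \<subseteq> N"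
    unfolding eventually_ae_filter by auto
  have "{x. x - (- t) \<in> N} \<in> null_sets lborel" by (rule null_sets_translation[OF N(1)])
  moreover have "{x \<in> space lborel. \<not> P (x + t)} \<subseteq> {x. x - (- t) \<in> N}" using N(2) by auto
  ultimately have "AE x in lborel. P (x + t)" unfolding eventually_ae_filter by blast
  then show ?thesis by (simp add: AE_completion_iff)
qed

text \<open>From the product with a periodic function only the multiplier over one period is kept.
  It passes to the continuous representative, and to its derivative because a shifted derivative is
  again a derivative of the multiple; the sign of the exponent is left open so that both modes are
  covered.\<close>

lemma bloch_representative:
  assumes b: "bloch_mode V lam \<mu> u" and U: "bdd_by K U" and UV: "AE x in lebesgue. V x - lam = U x"
  shows "\<exists>v v'. primitive v v' \<and> primitive v' (\<lambda>x. U x * v x) \<and> (\<forall>x. v (x + 1) = exp \<mu> * v x) \<and>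
     (\<forall>x. v' (x + 1) = exp \<mu> * v' x) \<and> (\<exists>x. v x \<noteq> 0) \<and> (AE x in lebesgue. u x = v x)"
proof -
  from b obtain v0 w0 p where d: "has_weak_deriv u v0" "has_weak_deriv v0 w0"
    and eq: "AE x in lebesgue. - w0 x + (V x - lam) * u x = 0"
    and nz: "\<not> (AE x in lebesgue. u x = 0)" and p: "periodic_fun_simple' p" and up: "\<And>x. u x = p x * exp (\<mu> * x)"
    unfolding bloch_mode_def linear_solution_def by blast
  obtain v where v: "primitive v v0" "AE x in lebesgue. v x = u x" by (rule weak_deriv_imp_primitive[OF d(1)])
  obtain v' where v': "primitive v' w0" "AE x in lebesgue. v' x = v0 x" by (rule weak_deriv_imp_primitive[OF d(2)])
  have pv: "primitive v v'"
    by (rule primitive_cong_AE[OF v(1)]) (use v'(2) in \<open>eventually_elim, simp\<close>)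
  have pv': "primitive v' (\<lambda>x. U x * v x)"
  proof (rule primitive_cong_AE[OF v'(1)])
    show "AE x in lebesgue. w0 x = U x * v x" using eq v(2) UV by eventually_elim simp
  qed
  have pp: "p (x + 1) = p x" for x using p by (simp add: periodic_fun_simple'_def)
  have u1: "u (x + 1) = exp \<mu> * u x" for x by (simp add: up pp distrib_left exp_add mult_ac)
  have cv: "continuous_on UNIV v" "continuous_on UNIV v'" by (rule primitive_continuous[OF pv], rule primitive_continuous[OF pv'])
  have c1: "continuous_on UNIV (\<lambda>x. f (x + 1))" if "continuous_on UNIV f" for f :: "real \<Rightarrow> real"
    by (rule continuous_on_compose2[OF that]) (auto intro!: continuous_intros)
  have "(\<lambda>x. v (x + 1)) = (\<lambda>x. exp \<mu> * v x)"
  proof (rule continuous_AE_eq)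
    show "continuous_on UNIV (\<lambda>x. v (x + 1))" by (rule c1[OF cv(1)])
    show "continuous_on UNIV (\<lambda>x. exp \<mu> * v x)" by (intro continuous_intros cv)
    show "AE x in lebesgue. v (x + 1) = exp \<mu> * v x"
      using v(2) AE_shift[OF v(2), of 1] by eventually_elim (simp add: u1)
  qed
  then have v1: "v (x + 1) = exp \<mu> * v x" for x by metis
  have "(\<lambda>x. v' (x + 1)) = (\<lambda>x. exp \<mu> * v' x)"
  proof (rule continuous_AE_eq)
    show "continuous_on UNIV (\<lambda>x. v' (x + 1))" by (rule c1[OF cv(2)])
    show "continuous_on UNIV (\<lambda>x. exp \<mu> * v' x)" by (intro continuous_intros cv)
    have "primitive (\<lambda>x. exp \<mu> * v x) (\<lambda>x. v' (x + 1))" using primitive_shift[OF pv, of 1] by (simp add: v1)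
    then show "AE x in lebesgue. v' (x + 1) = exp \<mu> * v' x" by (rule primitive_unique[OF _ primitive_cmult[OF pv]])
  qed
  then have v1': "v' (x + 1) = exp \<mu> * v' x" for x by metis
  have "\<exists>x. v x \<noteq> 0"
  proof (rule ccontr)
    assume "\<not> ?thesis"
    then have "AE x in lebesgue. u x = 0" using v(2) by (auto elim: eventually_mono)
    then show False using nz by blast
  qed
  moreover have "AE x in lebesgue. u x = v x" using v(2) by eventually_elim simp
  ultimately show ?thesis using pv pv' v1 v1' by blast
qed

lemma indicator_square: "(indicator A x * (f x :: real))\<^sup>2 = indicator A x * (f x)\<^sup>2"
  by (simp add: indicator_def)

text \<open>If the mode vanished at 0, its restriction to the left half-line would lie in H^1, and
  its form value would be the boundary term \<open>v' 0 * v 0 = 0\<close>, against coercivity. This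
  permits matching with a multiple of the mode at 0.\<close>

lemma bloch_nonzero:
  assumes pv: "primitive v v'" "primitive v' (\<lambda>x. U x * v x)"
    and per: "\<And>x. v (x + 1) = exp k * v x" "\<And>x. v' (x + 1) = exp k * v' x" and k: "0 < k" and nz: "\<exists>x. v x \<noteq> 0"
    and U: "bdd_by K U"
    and d0: "0 < \<delta>" and d: "\<And>u g. H1pair u g \<Longrightarrow> \<delta> * ((LINT x|lebesgue. (u x)\<^sup>2) + (LINT x|lebesgue. (g x)\<^sup>2)) \<le> qform U u g"
  shows "v 0 \<noteq> 0"
proof
  assume v0: "v 0 = 0"
  obtain B where B: "0 \<le> B" "\<forall>x\<le>0. \<bar>v x\<bar> \<le> B * exp (k * x)"
    by (rule floquet_bound[OF primitive_continuous[OF pv(1)] per(1) k])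
  obtain B' where B': "0 \<le> B'" "\<forall>x\<le>0. \<bar>v' x\<bar> \<le> B' * exp (k * x)"
    by (rule floquet_bound[OF primitive_continuous[OF pv(2)] per(2) k])
  have s: "sq_integrable (\<lambda>x. indicator {..0} x * v x)" "sq_integrable (\<lambda>x. indicator {..0} x * v' x)"
    by (rule sq_integrable_exp_tail[OF primitive_borel[OF pv(1)] B(2) k],
        rule sq_integrable_exp_tail[OF primitive_borel[OF pv(2)] B'(2) k])
  have H: "H1pair (\<lambda>x. indicator {..0} x * v x) (\<lambda>x. indicator {..0} x * v' x)"
    unfolding H1pair_def using primitive_cut[OF pv(1) v0] s by blast
  have eq: "(indicator {..0} x * v' x)\<^sup>2 + U x * (indicator {..0} x * v x)\<^sup>2 = indicator {..0} x * ((U x * v x) * v x + v' x * v' x)" for x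
    by (simp add: indicator_def power2_eq_square algebra_simps)
  have i: "integrable lebesgue (\<lambda>x. indicator {..0} x * ((U x * v x) * v x + v' x * v' x))"
    using qform_integrable[OF U H] unfolding eq .
  have "(LINT x|lebesgue. indicator {..0} x * ((U x * v x) * v x + v' x * v' x)) = v' 0 * v 0"
  proof (rule primitive_half_line[OF primitive_mult[OF pv(2) pv(1)] i])
    show "(\<lambda>n. v' (- real n) * v (- real n)) \<longlonglongrightarrow> 0"
      using tendsto_mult[OF floquet_tendsto[of v', OF per(2) k] floquet_tendsto[of v, OF per(1) k]] by simp
  qed
  then have "qform U (\<lambda>x. indicator {..0} x * v x) (\<lambda>x. indicator {..0} x * v' x) = 0"
    unfolding qform_def eq using v0 by simp
  then have le: "\<delta> * ((LINT x|lebesgue. (indicator {..0} x * v x)\<^sup>2) + (LINT x|lebesgue. (indicator {..0} x * v' x)\<^sup>2)) \<le> 0"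
    using d[OF H] by simp
  have z: "v x = 0" if "x \<le> 0" for x
  proof (rule ccontr)
    assume "v x \<noteq> 0"
    then have "indicator {..0} x * v x \<noteq> 0" using that by simp
    from H1pair_integral_pos[OF H this]
    have "0 < (LINT x|lebesgue. (indicator {..0} x * v x)\<^sup>2)" .
    moreover have "0 \<le> (LINT x|lebesgue. (indicator {..0} x * v' x)\<^sup>2)" by simp
    moreover have "(LINT x|lebesgue. (indicator {..0} x * v x)\<^sup>2) + (LINT x|lebesgue. (indicator {..0} x * v' x)\<^sup>2) \<le> 0"
      using le d0 by (simp only: mult_le_0_iff) linarith
    ultimately show False by linarith
  qed
  \<comment> \<open>The Floquet relation carries the zeros from the left half-line to the whole
    line.\<close>
  have "v x = 0" for x
  proof -
    obtain n where n: "x \<le> real n" using real_arch_simple by blast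
    have "v (x - real n + real n) = exp (k * real n) * v (x - real n)" by (rule floquet_iterate[of v k, OF per(1)])
    then show ?thesis using z[of "x - real n"] n by simp
  qed
  then show False using nz by blast
qed

text \<open>A geometric series in closed form: shifting by one period multiplies the integrand by
  \<open>exp (2 * k)\<close>, so the half-line integral is a positive multiple of the one over a
  period.\<close>

lemma bloch_half_line_integral:
  fixes W f :: "real \<Rightarrow> real"
  assumes i: "integrable lebesgue (\<lambda>x. indicator {..0} x * (W x * (f x)\<^sup>2))"
    and p: "\<And>x. W (x + 1) = W x" "\<And>x. f (x + 1) = exp k * f x" and k: "0 < k"
    and neg: "(LINT x:{-1..0}|lebesgue. W x * (f x)\<^sup>2) < 0"
  shows "(LINT x|lebesgue. indicator {..0} x * (W x * (f x)\<^sup>2)) < 0"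
proof -
  let ?F = "\<lambda>x. W x * (f x)\<^sup>2"
  define J where "J = (LINT x|lebesgue. indicator {..0} x * ?F x)"
  have F1: "?F (x + 1) = exp (2 * k) * ?F x" for x
    by (simp add: p power_mult_distrib power2_eq_square[of "exp k"] exp_add[symmetric])
  have i1: "integrable lebesgue (\<lambda>x. indicator {..-1} x * ?F x)"
  proof -
    have "integrable lebesgue (\<lambda>x. indicator {..-1::real} x *\<^sub>R (indicator {..0} x * ?F x))" by (rule integrable_mult_indicator[OF _ i]) simp
    moreover have "(\<lambda>x. indicator {..-1::real} x *\<^sub>R (indicator {..0} x * ?F x)) = (\<lambda>x. indicator {..-1} x * ?F x)"
      by (intro ext) (simp add: indicator_def)
    ultimately show ?thesis by simp
  qed
  have i2: "integrable lebesgue (\<lambda>x. indicator {-1..0} x * ?F x)"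
  proof -
    have "integrable lebesgue (\<lambda>x. indicator {-1..0::real} x *\<^sub>R (indicator {..0} x * ?F x))" by (rule integrable_mult_indicator[OF _ i]) simp
    moreover have "(\<lambda>x. indicator {-1..0::real} x *\<^sub>R (indicator {..0} x * ?F x)) = (\<lambda>x. indicator {-1..0} x * ?F x)"
      by (intro ext) (simp add: indicator_def)
    ultimately show ?thesis by simp
  qed
  have "J = (LINT x|lebesgue. indicator {..0} (x + 1) * ?F (x + 1))"
    unfolding J_def using integral_shift[of "\<lambda>x. indicator {..0} x * ?F x" 1] by simp
  also have "\<dots> = (LINT x|lebesgue. exp (2 * k) * (indicator {..-1} x * ?F x))"
    unfolding F1 by (rule Bochner_Integration.integral_cong) (auto simp: indicator_def)
  finally have J1: "J = exp (2 * k) * (LINT x|lebesgue. indicator {..-1} x * ?F x)" by simp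
  have "J = (LINT x|lebesgue. indicator {..-1} x * ?F x + indicator {-1..0} x * ?F x)"
    unfolding J_def
  proof (rule integral_cong_AE)
    show "(\<lambda>x. indicator {..0} x * ?F x) \<in> borel_measurable lebesgue" using i by (rule borel_measurable_integrable)
    have "integrable lebesgue (\<lambda>x. indicator {..-1} x * ?F x + indicator {-1..0} x * ?F x)"
      using i1 i2 by (rule Bochner_Integration.integrable_add)
    then show "(\<lambda>x. indicator {..-1} x * ?F x + indicator {-1..0} x * ?F x) \<in> borel_measurable lebesgue"
      by (rule borel_measurable_integrable)
    \<comment> \<open>The point -1 belongs to both intervals.\<close>
    have "AE x in lebesgue. x \<noteq> (-1::real)" by (rule AE_not_in[of "{-1}", simplified]) simp
    then show "AE x in lebesgue. indicator {..0} x * ?F x = indicator {..-1} x * ?F x + indicator {-1..0} x * ?F x"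
      by eventually_elim (simp add: indicator_def)
  qed
  also have "\<dots> = (LINT x|lebesgue. indicator {..-1} x * ?F x) + (LINT x|lebesgue. indicator {-1..0} x * ?F x)"
    by (rule Bochner_Integration.integral_add[OF i1 i2])
  finally have J2: "J < (LINT x|lebesgue. indicator {..-1} x * ?F x)"
    using neg by (simp add: set_lebesgue_integral_def)
  have "J < 0"
  proof (rule ccontr)
    assume "\<not> J < 0"
    then have J0: "0 \<le> J" by simp
    then have "0 \<le> (LINT x|lebesgue. indicator {..-1} x * ?F x)" unfolding J1 by (simp add: zero_le_mult_iff)
    moreover have "1 \<le> exp (2 * k)" using k by simp
    ultimately have "1 * (LINT x|lebesgue. indicator {..-1} x * ?F x) \<le> J" unfolding J1 by (intro mult_right_mono)
    then show False using J2 by simp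
  qed
  then show ?thesis by (simp add: J_def)
qed

text \<open>Let \<open>w\<close> be a maximizer for the periodic problem that is small on the negative half-line. Replace it
  there by the multiple of the Bloch mode with the same value at 0. This lowers the periodic form by its
  value at the difference, lowers the interface form further by a multiple of \<open>w(0)\<^sup>2\<close>, and changes the
  nonlinear term only to higher order. Hence it beats \<open>w\<close> unless \<open>w\<close> vanishes on the negative half-line,
  in which case \<open>w\<close> itself is a maximizer for the interface problem.\<close>

lemma tail_replacement:
  assumes U: "bdd_by K U" and V1: "bdd_by K V1" and V2: "bdd_by K V2"
    and U1: "\<And>x. 0 < x \<Longrightarrow> U x = V1 x" and U2: "\<And>x. x < 0 \<Longrightarrow> U x = V2 x"
    and pV1: "\<And>x k. V1 (x + real_of_int k) = V1 x" and pV2: "\<And>x k. V2 (x + real_of_int k) = V2 x"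
    and G: "bdd_by M \<Gamma>" and G1: "bdd_by M \<Gamma>1" and GG: "\<And>x. 0 < x \<Longrightarrow> \<Gamma> x = \<Gamma>1 x"
    and pG1: "\<And>x k. \<Gamma>1 (x + real_of_int k) = \<Gamma>1 x"
    and d0: "0 < \<delta>" and d: "\<And>u g. H1pair u g \<Longrightarrow> \<delta> * ((LINT x|lebesgue. (u x)\<^sup>2) + (LINT x|lebesgue. (g x)\<^sup>2)) \<le> qform U u g"
    and r: "2 < r" and S0: "0 < S" and S: "\<And>u g. H1pair u g \<Longrightarrow> nlin \<Gamma> r u \<le> S * qform U u g powr (r / 2)"
    and b: "primitive b b'" "primitive b' (\<lambda>x. V1 x * b x)"
    and per: "\<And>x. b (x + 1) = exp k * b x" "\<And>x. b' (x + 1) = exp k * b' x" and k: "0 < k" and nz: "\<exists>x. b x \<noteq> 0"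
    and neg: "(LINT x:{-1..0}|lebesgue. (V2 x - V1 x) * (b x)\<^sup>2) < 0"
    and w: "H1pair w h" "qform V1 w h = 1" "nlin \<Gamma>1 r w = S"
  shows "\<exists>w h. H1pair w h \<and> qform U w h = 1 \<and> nlin \<Gamma> r w = S"
proof -
  have r2: "2 \<le> r" using r by simp
  have M0: "0 \<le> M" using bdd_by_nonneg[OF G] .
  let ?I = "\<lambda>x. indicator {..0::real} x :: real"
  \<comment> \<open>The coefficients are prescribed only off 0, so that the reflected interface,
    which attaches 0 to the other side, fits the hypotheses too.\<close>
  have ne0: "AE x in lebesgue. x \<noteq> (0::real)" by (rule AE_not_in[of "{0}", simplified]) simp
  have ev: "\<forall>\<^sub>F n in sequentially. N \<le> int n" for N
    by (rule eventually_sequentiallyI[of "nat N"]) linarith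
  have lim: "(\<lambda>n. U (x + real n)) \<longlonglongrightarrow> V1 x" for x
    using interface_limit[of U V1 int x, OF U1 pV1 ev] by simp
  have dV: "\<delta> * ((LINT x|lebesgue. (u x)\<^sup>2) + (LINT x|lebesgue. (g x)\<^sup>2)) \<le> qform V1 u g" if "H1pair u g" for u g
    by (rule coercive_limit[OF U lim d that])
  have b0: "b 0 \<noteq> 0" by (rule bloch_nonzero[OF b per k nz V1 d0 dV])
  obtain B where B: "0 \<le> B" "\<forall>x\<le>0. \<bar>b x\<bar> \<le> B * exp (k * x)"
    by (rule floquet_bound[OF primitive_continuous[OF b(1)] per(1) k])
  obtain B' where B': "0 \<le> B'" "\<forall>x\<le>0. \<bar>b' x\<bar> \<le> B' * exp (k * x)"
    by (rule floquet_bound[OF primitive_continuous[OF b(2)] per(2) k])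
  have bs: "sq_integrable (\<lambda>x. ?I x * b x)" "sq_integrable (\<lambda>x. ?I x * b' x)"
    by (rule sq_integrable_exp_tail[OF primitive_borel[OF b(1)] B(2) k],
        rule sq_integrable_exp_tail[OF primitive_borel[OF b(2)] B'(2) k])
  have bi: "integrable lebesgue (\<lambda>x. ?I x * (b x)\<^sup>2)" using sq_integrable_square[OF bs(1)] unfolding indicator_square .
  define P where "P = (LINT x|lebesgue. ?I x * (b x)\<^sup>2)"
  have P0: "0 \<le> P" unfolding P_def by (intro integral_nonneg_AE AE_I2) simp
  note Wb = bdd_by_diff[OF V2 V1]
  have Ji: "integrable lebesgue (\<lambda>x. ?I x * ((V2 x - V1 x) * (b x)\<^sup>2))"
    using bdd_mult_integrable[OF Wb bi] by (simp add: mult.left_commute)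
  define J where "J = (LINT x|lebesgue. ?I x * ((V2 x - V1 x) * (b x)\<^sup>2))"
  have J0: "J < 0" unfolding J_def
    by (rule bloch_half_line_integral[OF Ji _ per(1) k neg]) (use pV1[of _ 1] pV2[of _ 1] in simp)
  \<comment> \<open>The two losses per squared multiple of the mode: 2 comes from
    \<open>(a + b)^2 \<le> 2 a^2 + 2 b^2\<close> for the old tail, the power from the bound
    \<open>\<epsilon> * (B / |b 0|)\<close> on the new one.\<close>
  define \<beta> where "\<beta> = (B / \<bar>b 0\<bar>) powr (r - 2) + 2"
  have \<beta>0: "0 < \<beta>" by (simp add: \<beta>_def add_nonneg_pos)
  \<comment> \<open>Below this threshold the loss coefficients \<open>2\<close> and
    \<open>\<beta> * P\<close> stay strictly under the gains \<open>S * \<delta>\<close> and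
    \<open>S * (- J)\<close>; \<open>P + 1\<close> keeps the denominator positive.\<close>
  define \<tau> where "\<tau> = min (S * \<delta> / 2) (S * (- J) / (\<beta> * (P + 1)))"
  have \<tau>0: "0 < \<tau>"
  proof -
    have "0 < S * (- J) / (\<beta> * (P + 1))" using S0 J0 \<beta>0 P0 by (intro divide_pos_pos mult_pos_pos) auto
    then show ?thesis using S0 d0 by (simp only: \<tau>_def min_less_iff_conj) simp
  qed
  \<comment> \<open>The tail height for which \<open>M * \<epsilon> powr (r - 2)\<close> falls below
    \<open>\<tau>\<close>; an exponent \<open>r > 2\<close> is essential.\<close>
  define \<epsilon> where "\<epsilon> = (\<tau> / (M + 1)) powr (1 / (r - 2))"
  have q0: "0 < \<tau> / (M + 1)" using \<tau>0 M0 by simp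
  have e0: "0 < \<epsilon>" unfolding \<epsilon>_def powr_gt_zero using q0 by linarith
  have er: "\<epsilon> powr (r - 2) = \<tau> / (M + 1)"
  proof -
    have "\<epsilon> powr (r - 2) = (\<tau> / (M + 1)) powr 1" unfolding \<epsilon>_def powr_powr using r by simp
    then show ?thesis using q0 by (simp only: powr_one less_imp_le)
  qed
  have Me: "M * \<epsilon> powr (r - 2) < \<tau>"
  proof -
    have "M * \<epsilon> powr (r - 2) < (M + 1) * \<epsilon> powr (r - 2)" using e0 by (simp add: mult_strict_right_mono)
    also have "\<dots> = \<tau>" using M0 by (simp add: er)
    finally show ?thesis .
  qed
  obtain T where T: "\<And>x. x \<le> - T \<Longrightarrow> \<bar>w x\<bar> \<le> \<epsilon>" using H1pair_small_at_bot[OF w(1) e0] by blast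
  obtain m where m: "T \<le> real m" using real_arch_simple by blast
  \<comment> \<open>An integer translation to the right: it preserves the periodic form and
    nonlinear term, and only values of \<open>w\<close> at or below \<open>-m\<close> remain on the
    left half-line.\<close>
  define y where "y x = w (x - real m)" for x
  define y' where "y' x = h (x - real m)" for x
  have yH: "H1pair y y'" unfolding y_def y'_def by (rule H1pair_shift_minus[OF w(1)])
  have yq: "qform V1 y y' = 1"
    using w(2) qform_unshift[of V1 "real m" w h] pV1[of _ "int m"] by (simp add: y_def[abs_def] y'_def[abs_def])
  have yn: "nlin \<Gamma>1 r y = S"
    using w(3) nlin_unshift[of \<Gamma>1 "real m" r w] pG1[of _ "int m"] by (simp add: y_def[abs_def])
  have ye: "\<bar>y x\<bar> \<le> \<epsilon>" if "x \<le> 0" for x unfolding y_def using T[of "x - real m"] m that by simp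
  define c where "c = y 0 / b 0"
  define f where "f x = y x - c * b x" for x
  define f' where "f' x = y' x - c * b' x" for x
  have fp: "primitive f f'"
    using primitive_add[OF H1pairD(1)[OF yH] primitive_cmult[OF b(1), of "- c"]] by (simp add: f_def[abs_def] f'_def[abs_def])
  have f0: "f 0 = 0" using b0 by (simp add: f_def c_def)
  define \<eta> where "\<eta> x = ?I x * f x" for x
  define \<eta>' where "\<eta>' x = ?I x * f' x" for x
  have \<eta>s: "sq_integrable \<eta>" "sq_integrable \<eta>'"
  proof -
    have "sq_integrable (\<lambda>x. ?I x * y x - c * (?I x * b x))" "sq_integrable (\<lambda>x. ?I x * y' x - c * (?I x * b' x))"
      by (intro sq_integrable_diff sq_integrable_cmult bs sq_integrable_indicator H1pairD[OF yH]; simp)+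
    then show "sq_integrable \<eta>" "sq_integrable \<eta>'"
      by (simp_all add: \<eta>_def[abs_def] \<eta>'_def[abs_def] f_def f'_def algebra_simps)
  qed
  have \<eta>H: "H1pair \<eta> \<eta>'"
    unfolding H1pair_def using primitive_cut[OF fp f0] \<eta>s by (simp add: \<eta>_def[abs_def] \<eta>'_def[abs_def])
  define z where "z x = y x - \<eta> x" for x
  define z' where "z' x = y' x - \<eta>' x" for x
  have zH: "H1pair z z'" unfolding z_def z'_def by (rule H1pair_diff[OF yH \<eta>H])
  have zneg: "z x = c * b x" "z' x = c * b' x" if "x \<le> 0" for x
    using that by (auto simp: z_def z'_def \<eta>_def \<eta>'_def f_def f'_def)
  have zpos: "z x = y x" "z' x = y' x" if "0 < x" for x
    using that by (auto simp: z_def z'_def \<eta>_def \<eta>'_def)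
  \<comment> \<open>On the left \<open>z\<close> solves the linear equation, while
    \<open>\<eta>\<close> vanishes at 0 and on the right; integration by parts leaves no
    term.\<close>
  have orth: "bform V1 z z' \<eta> \<eta>' = 0"
  proof -
    let ?F = "\<lambda>x. ?I x * ((V1 x * b x) * f x + f' x * b' x)"
    have eq: "z' x * \<eta>' x + V1 x * (z x * \<eta> x) = c * ?F x" for x
      using zneg[of x] by (cases "x \<le> 0") (auto simp: \<eta>_def \<eta>'_def algebra_simps)
    have i: "integrable lebesgue ?F"
    proof -
      have "integrable lebesgue (\<lambda>x. V1 x * ((?I x * b x) * \<eta> x) + \<eta>' x * (?I x * b' x))"
        by (intro Bochner_Integration.integrable_add bdd_mult_integrable[OF V1] sq_integrable_mult bs \<eta>s)
      moreover have "(\<lambda>x. V1 x * ((?I x * b x) * \<eta> x) + \<eta>' x * (?I x * b' x)) = ?F"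
        by (intro ext) (simp add: \<eta>_def \<eta>'_def indicator_def)
      ultimately show ?thesis by simp
    qed
    have "(LINT x|lebesgue. ?F x) = b' 0 * f 0"
    proof (rule primitive_half_line[OF primitive_mult[OF b(2) fp] i])
      have fl: "(\<lambda>n. f (- real n)) \<longlonglongrightarrow> 0"
        using H1pair_tendsto(1)[OF \<eta>H] by (simp add: \<eta>_def)
      show "(\<lambda>n. b' (- real n) * f (- real n)) \<longlonglongrightarrow> 0"
        using tendsto_mult[OF floquet_tendsto[of b', OF per(2) k] fl] by simp
    qed
    then show ?thesis unfolding bform_def eq using f0 by simp
  qed
  define Y where "Y = (LINT x|lebesgue. (\<eta> x)\<^sup>2)"
  have Y0: "0 \<le> Y" unfolding Y_def by simp
  define E where "E = qform V1 \<eta> \<eta>'"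
  have EY: "\<delta> * Y \<le> E"
  proof -
    have "\<delta> * Y \<le> \<delta> * (Y + (LINT x|lebesgue. (\<eta>' x)\<^sup>2))" using d0 by (intro mult_left_mono) auto
    also have "\<dots> \<le> E" unfolding Y_def E_def by (rule dV[OF \<eta>H])
    finally show ?thesis .
  qed
  have q1: "qform V1 z z' = 1 - E"
    using qform_add[OF V1 zH \<eta>H, of 1] orth yq by (simp add: z_def z'_def E_def)
  \<comment> \<open>The two potentials differ only on the left, where \<open>z\<close> is
    \<open>c\<close> times the Bloch mode.\<close>
  have q2: "qform U z z' = qform V1 z z' + c\<^sup>2 * J"
  proof -
    have ci: "integrable lebesgue (\<lambda>x. c\<^sup>2 * (?I x * ((V2 x - V1 x) * (b x)\<^sup>2)))" using Ji by simp
    have "qform U z z' = (LINT x|lebesgue. ((z' x)\<^sup>2 + V1 x * (z x)\<^sup>2) + c\<^sup>2 * (?I x * ((V2 x - V1 x) * (b x)\<^sup>2)))"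
      unfolding qform_def
    proof (rule integral_cong_AE)
      show "(\<lambda>x. (z' x)\<^sup>2 + U x * (z x)\<^sup>2) \<in> borel_measurable lebesgue"
        by (rule borel_measurable_integrable[OF qform_integrable[OF U zH]])
      show "(\<lambda>x. ((z' x)\<^sup>2 + V1 x * (z x)\<^sup>2) + c\<^sup>2 * (?I x * ((V2 x - V1 x) * (b x)\<^sup>2))) \<in> borel_measurable lebesgue"
        by (rule borel_measurable_integrable[OF Bochner_Integration.integrable_add[OF qform_integrable[OF V1 zH] ci]])
      show "AE x in lebesgue. (z' x)\<^sup>2 + U x * (z x)\<^sup>2 = ((z' x)\<^sup>2 + V1 x * (z x)\<^sup>2) + c\<^sup>2 * (?I x * ((V2 x - V1 x) * (b x)\<^sup>2))"
        using ne0
      proof eventually_elim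
        case (elim x)
        show ?case
        proof (cases "0 < x")
          case True then show ?thesis by (simp add: U1)
        next
          case False
          then have "x < 0" using elim by simp
          then show ?thesis using zneg[of x] U2[of x] by (simp add: power_mult_distrib algebra_simps)
        qed
      qed
    qed
    also have "\<dots> = qform V1 z z' + (LINT x|lebesgue. c\<^sup>2 * (?I x * ((V2 x - V1 x) * (b x)\<^sup>2)))"
      unfolding qform_def by (rule Bochner_Integration.integral_add[OF qform_integrable[OF V1 zH] ci])
    finally show ?thesis by (simp add: J_def)
  qed
  define D where "D = E - c\<^sup>2 * J"
  have qU: "qform U z z' = 1 - D" using q1 q2 by (simp add: D_def)
  have cJ: "c\<^sup>2 * J \<le> 0" using J0 by (simp add: mult_nonneg_nonpos)
  have D0: "0 \<le> D"
  proof -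
    have "0 \<le> \<delta> * Y" using d0 Y0 by (intro mult_nonneg_nonneg) auto
    then show ?thesis using EY cJ unfolding D_def by linarith
  qed
  have D1: "0 \<le> 1 - D"
  proof -
    have "0 \<le> \<delta> * ((LINT x|lebesgue. (z x)\<^sup>2) + (LINT x|lebesgue. (z' x)\<^sup>2))" using d0 by simp
    then show ?thesis using d[OF zH] qU by linarith
  qed
  \<comment> \<open>On the unit interval a power with exponent at least 1 lies below the identity,
    so a drop \<open>D\<close> of the form lowers the admissible value by at least
    \<open>S * D\<close>.\<close>
  have up: "nlin \<Gamma> r z \<le> S - S * D"
  proof -
    have "(1 - D) powr (r / 2) \<le> (1 - D) powr 1" using D0 D1 r by (intro powr_mono') auto
    then have "S * (1 - D) powr (r / 2) \<le> S * (1 - D)" using D1 S0 by (intro mult_left_mono) auto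
    then show ?thesis using S[OF zH] unfolding qU by (simp add: algebra_simps)
  qed
  \<comment> \<open>On the left both functions are of size \<open>\<epsilon>\<close>, and their r-th
    powers are \<open>\<epsilon> powr (r - 2)\<close> times squares up to constants; on the right
    \<open>z\<close> agrees with \<open>y\<close>.\<close>
  have low: "S - M * \<epsilon> powr (r - 2) * (\<beta> * (c\<^sup>2 * P) + 2 * Y) \<le> nlin \<Gamma> r z"
  proof -
    let ?R = "\<lambda>x. M * \<epsilon> powr (r - 2) * (\<beta> * (c\<^sup>2 * (?I x * (b x)\<^sup>2)) + 2 * (\<eta> x)\<^sup>2)"
    have Ri: "integrable lebesgue ?R"
      by (intro integrable_mult_right Bochner_Integration.integrable_add bi sq_integrable_square \<eta>s)
    have pt: "\<Gamma>1 x * \<bar>y x\<bar> powr r - \<Gamma> x * \<bar>z x\<bar> powr r \<le> ?R x" if x: "x \<noteq> 0" for x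
    proof (cases "0 < x")
      case True
      have "0 \<le> ?R x" using M0 \<beta>0 by simp
      then show ?thesis using True by (simp add: GG zpos)
    next
      case False
      then have x0: "x \<le> 0" by simp
      have y1: "\<bar>y x\<bar> powr r \<le> \<epsilon> powr (r - 2) * (y x)\<^sup>2" by (rule powr_le_square[OF ye[OF x0] r2])
      have yx: "y x = c * b x + \<eta> x" using x0 by (simp add: \<eta>_def f_def)
      have "0 \<le> (c * b x - \<eta> x)\<^sup>2" by simp
      then have "(y x)\<^sup>2 \<le> 2 * (c * b x)\<^sup>2 + 2 * (\<eta> x)\<^sup>2" unfolding yx power2_diff power2_sum by linarith
      then have y2: "\<bar>y x\<bar> powr r \<le> \<epsilon> powr (r - 2) * (2 * (c * b x)\<^sup>2 + 2 * (\<eta> x)\<^sup>2)"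
        using order_trans[OF y1 mult_left_mono] by simp
      have "\<bar>z x\<bar> \<le> \<epsilon> * (B / \<bar>b 0\<bar>)"
      proof -
        have "\<bar>b x\<bar> \<le> B * exp (k * x)" using B(2) x0 by simp
        also have "\<dots> \<le> B * 1" using B(1) k x0 by (intro mult_left_mono) (auto simp: mult_nonneg_nonpos)
        finally have "\<bar>b x\<bar> \<le> B" by simp
        then have "\<bar>y 0\<bar> * \<bar>b x\<bar> \<le> \<epsilon> * B" using ye[of 0] by (intro mult_mono) auto
        then show ?thesis unfolding zneg(1)[OF x0] c_def by (simp add: abs_mult divide_right_mono)
      qed
      then have "\<bar>z x\<bar> powr r \<le> (\<epsilon> * (B / \<bar>b 0\<bar>)) powr (r - 2) * (z x)\<^sup>2" by (rule powr_le_square[OF _ r2])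
      also have "\<dots> = \<epsilon> powr (r - 2) * ((B / \<bar>b 0\<bar>) powr (r - 2) * (c * b x)\<^sup>2)"
        unfolding zneg(1)[OF x0] by (simp only: powr_mult mult.assoc)
      finally have z2: "\<bar>z x\<bar> powr r \<le> \<epsilon> powr (r - 2) * ((B / \<bar>b 0\<bar>) powr (r - 2) * (c * b x)\<^sup>2)" .
      have a1: "\<Gamma>1 x * \<bar>y x\<bar> powr r \<le> M * \<bar>y x\<bar> powr r" using bdd_by_abs[OF G1, of x] by (intro mult_right_mono) auto
      have a2: "- \<Gamma> x * \<bar>z x\<bar> powr r \<le> M * \<bar>z x\<bar> powr r" using bdd_by_abs[OF G, of x] by (intro mult_right_mono) auto
      have "\<Gamma>1 x * \<bar>y x\<bar> powr r - \<Gamma> x * \<bar>z x\<bar> powr r \<le> M * (\<bar>y x\<bar> powr r + \<bar>z x\<bar> powr r)"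
        using a1 a2 by (simp add: distrib_left)
      also have "\<dots> \<le> M * (\<epsilon> powr (r - 2) * (2 * (c * b x)\<^sup>2 + 2 * (\<eta> x)\<^sup>2) + \<epsilon> powr (r - 2) * ((B / \<bar>b 0\<bar>) powr (r - 2) * (c * b x)\<^sup>2))"
        by (intro mult_left_mono add_mono y2 z2 M0)
      also have "\<dots> = ?R x" using x0 by (simp add: \<beta>_def power_mult_distrib algebra_simps)
      finally show ?thesis .
    qed
    have i: "integrable lebesgue (\<lambda>x. \<Gamma>1 x * \<bar>y x\<bar> powr r)" "integrable lebesgue (\<lambda>x. \<Gamma> x * \<bar>z x\<bar> powr r)"
      by (rule nlin_integrable[OF G1 yH r2], rule nlin_integrable[OF G zH r2])
    have "S - nlin \<Gamma> r z = (LINT x|lebesgue. \<Gamma>1 x * \<bar>y x\<bar> powr r - \<Gamma> x * \<bar>z x\<bar> powr r)"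
      unfolding yn[symmetric] nlin_def by (rule Bochner_Integration.integral_diff[OF i, symmetric])
    also have "\<dots> \<le> (LINT x|lebesgue. ?R x)"
    proof (rule integral_mono_AE[OF Bochner_Integration.integrable_diff[OF i] Ri])
      show "AE x in lebesgue. \<Gamma>1 x * \<bar>y x\<bar> powr r - \<Gamma> x * \<bar>z x\<bar> powr r \<le> ?R x"
        using ne0 by eventually_elim (rule pt)
    qed
    also have "\<dots> = M * \<epsilon> powr (r - 2) * ((LINT x|lebesgue. \<beta> * (c\<^sup>2 * (?I x * (b x)\<^sup>2))) + (LINT x|lebesgue. 2 * (\<eta> x)\<^sup>2))"
    proof -
      have "(LINT x|lebesgue. \<beta> * (c\<^sup>2 * (?I x * (b x)\<^sup>2)) + 2 * (\<eta> x)\<^sup>2) =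
        (LINT x|lebesgue. \<beta> * (c\<^sup>2 * (?I x * (b x)\<^sup>2))) + (LINT x|lebesgue. 2 * (\<eta> x)\<^sup>2)"
        by (intro Bochner_Integration.integral_add integrable_mult_right bi sq_integrable_square \<eta>s)
      then show ?thesis by (simp only: integral_mult_right_zero)
    qed
    finally show ?thesis by (simp add: P_def Y_def)
  qed
  \<comment> \<open>The gain is at least \<open>S * \<delta> * Y + S * (- J) * c^2\<close> and the
    loss has strictly smaller coefficients; both can balance only if \<open>Y\<close> and
    \<open>c\<close> vanish.\<close>
  have key: "Y = 0 \<and> c = 0"
  proof (rule ccontr)
    assume no: "\<not> (Y = 0 \<and> c = 0)"
    define X where "X = M * \<epsilon> powr (r - 2)"
    have X0: "0 \<le> X" using M0 by (simp add: X_def)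
    have t1: "X * 2 < S * \<delta>" using Me unfolding X_def \<tau>_def by simp
    have t2: "X * (\<beta> * P) < S * (- J)"
    proof -
      have "X < S * (- J) / (\<beta> * (P + 1))" using Me unfolding X_def \<tau>_def by simp
      moreover have "0 < \<beta> * (P + 1)" using \<beta>0 P0 by (intro mult_pos_pos) auto
      ultimately have "X * (\<beta> * (P + 1)) < S * (- J)" by (simp only: pos_less_divide_eq)
      moreover have "X * (\<beta> * P) \<le> X * (\<beta> * (P + 1))" using X0 \<beta>0 by (intro mult_left_mono) auto
      ultimately show ?thesis by linarith
    qed
    have "S * D \<le> X * (\<beta> * (c\<^sup>2 * P) + 2 * Y)" using low up unfolding X_def by linarith
    then have "S * (E - c\<^sup>2 * J) \<le> (X * (\<beta> * P)) * c\<^sup>2 + (X * 2) * Y" unfolding D_def by (simp add: algebra_simps)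
    moreover have "S * (\<delta> * Y) \<le> S * E" using EY S0 by (intro mult_left_mono) auto
    ultimately have le: "S * \<delta> * Y + S * (- J) * c\<^sup>2 \<le> (X * (\<beta> * P)) * c\<^sup>2 + (X * 2) * Y" by (simp add: algebra_simps)
    have c1: "(X * (\<beta> * P)) * c\<^sup>2 \<le> S * (- J) * c\<^sup>2" using t2 by (intro mult_right_mono) auto
    have c2: "(X * 2) * Y \<le> S * \<delta> * Y" using t1 Y0 by (intro mult_right_mono) auto
    show False
    proof (cases "Y = 0")
      case True
      then have "0 < c\<^sup>2" using no by simp
      then have "(X * (\<beta> * P)) * c\<^sup>2 < S * (- J) * c\<^sup>2" using t2 by (intro mult_strict_right_mono)
      then show False using le c2 by linarith
    next
      case False
      then have "0 < Y" using Y0 by simp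
      then have "(X * 2) * Y < S * \<delta> * Y" using t1 by (intro mult_strict_right_mono)
      then show False using le c1 by linarith
    qed
  qed
  have n1: "nlin \<Gamma> r z = S"
  proof -
    have "S \<le> nlin \<Gamma> r z" using low key by simp
    moreover have "S * D \<ge> 0" using S0 D0 by simp
    ultimately show ?thesis using up by linarith
  qed
  have "D = 0"
  proof -
    have "S * D \<le> 0" using up n1 by linarith
    then show ?thesis using S0 D0 by (simp add: mult_le_0_iff)
  qed
  then show ?thesis using zH qU n1 by auto
qed

subsection \<open>From maximizers to strong ground states\<close>

lemma integral_eq_AE:
  fixes f g :: "real \<Rightarrow> real"
  assumes "integrable lebesgue f" and "AE x in lebesgue. f x = g x"
  shows "(LINT x|lebesgue. g x) = (LINT x|lebesgue. f x)"
  using borel_measurable_integrable[OF assms(1)] borel_measurable_AE[OF borel_measurable_integrable[OF assms(1)] assms(2)] assms(2)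
  by (intro integral_cong_AE) (auto simp: eq_commute)

lemma L2_real_iff: "f \<in> L2 \<longleftrightarrow> sq_integrable f" for f :: "real \<Rightarrow> real"
  by (simp add: L2_def sq_integrable_def)

lemma H1_imp_H1pair:
  fixes u :: "real \<Rightarrow> real"
  assumes u: "u \<in> H1"
  shows "\<exists>v. H1pair v (weak_deriv u) \<and> (AE x in lebesgue. u x = v x)"
proof -
  from u obtain g where "g \<in> L2" "has_weak_deriv u g" "u \<in> L2"
    unfolding H1_def by blast
  then have g: "sq_integrable g" "has_weak_deriv u g" and us: "sq_integrable u"
    by (simp_all add: L2_real_iff)
  have d: "has_weak_deriv u (weak_deriv u)" by (rule has_weak_deriv_weak_deriv[OF u])
  have "AE x in lebesgue. g x = weak_deriv u x" by (rule weak_deriv_unique[OF g(2) d]) simp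
  from sq_integrable_cong_AE(1)[OF g(1) this] have "sq_integrable (weak_deriv u)" .
  from has_weak_deriv_H1pair[OF d us this] show ?thesis by metis
qed

lemma H1pair_imp_H1:
  assumes h: "H1pair v g" shows "v \<in> H1"
proof -
  have "v \<in> L2" "g \<in> L2" using h by (simp_all add: L2_real_iff H1pair_def)
  then show ?thesis using primitive_imp_weak_deriv[OF H1pairD(1)[OF h]] unfolding H1_def by blast
qed

lemma energy_nehari_forms:
  assumes h: "H1pair v g" and U: "bdd_by K U" and G: "bdd_by M \<Delta>" and p: "1 < p"
    and uv: "AE x in lebesgue. u x = v x" and ug: "AE x in lebesgue. weak_deriv u x = g x"
    and VU: "AE x in lebesgue. V x - lam = U x" and GD: "AE x in lebesgue. \<Gamma> x = \<Delta> x"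
  shows "energy V \<Gamma> lam p u = 1/2 * qform U v g - 1 / (p + 1) * nlin \<Delta> (p + 1) v"
    and "(LINT x|lebesgue. \<bar>weak_deriv u x\<bar>\<^sup>2 + (V x - lam) * (u x)\<^sup>2 - \<Gamma> x * \<bar>u x\<bar> powr (p + 1)) = qform U v g - nlin \<Delta> (p + 1) v"
proof -
  have i: "integrable lebesgue (\<lambda>x. (g x)\<^sup>2 + U x * (v x)\<^sup>2)" "integrable lebesgue (\<lambda>x. \<Delta> x * \<bar>v x\<bar> powr (p + 1))"
    using p by (intro qform_integrable[OF U h] nlin_integrable[OF G h]; simp)+
  have "energy V \<Gamma> lam p u = (LINT x|lebesgue. 1/2 * ((g x)\<^sup>2 + U x * (v x)\<^sup>2) - 1 / (p + 1) * (\<Delta> x * \<bar>v x\<bar> powr (p + 1)))"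
    unfolding energy_def
  proof (rule integral_eq_AE)
    show "integrable lebesgue (\<lambda>x. 1/2 * ((g x)\<^sup>2 + U x * (v x)\<^sup>2) - 1 / (p + 1) * (\<Delta> x * \<bar>v x\<bar> powr (p + 1)))"
      by (intro Bochner_Integration.integrable_diff integrable_mult_right i)
    show "AE x in lebesgue. 1/2 * ((g x)\<^sup>2 + U x * (v x)\<^sup>2) - 1 / (p + 1) * (\<Delta> x * \<bar>v x\<bar> powr (p + 1)) =
       1/2 * (\<bar>weak_deriv u x\<bar>\<^sup>2 + (V x - lam) * (u x)\<^sup>2) - 1 / (p + 1) * \<Gamma> x * \<bar>u x\<bar> powr (p + 1)"
      using uv ug VU GD by eventually_elim simp
  qed
  also have "\<dots> = (LINT x|lebesgue. 1/2 * ((g x)\<^sup>2 + U x * (v x)\<^sup>2)) - (LINT x|lebesgue. 1 / (p + 1) * (\<Delta> x * \<bar>v x\<bar> powr (p + 1)))"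
    by (intro Bochner_Integration.integral_diff integrable_mult_right i)
  finally show "energy V \<Gamma> lam p u = 1/2 * qform U v g - 1 / (p + 1) * nlin \<Delta> (p + 1) v"
    by (simp only: qform_def nlin_def integral_mult_right_zero)
  have "(LINT x|lebesgue. \<bar>weak_deriv u x\<bar>\<^sup>2 + (V x - lam) * (u x)\<^sup>2 - \<Gamma> x * \<bar>u x\<bar> powr (p + 1)) =
     (LINT x|lebesgue. ((g x)\<^sup>2 + U x * (v x)\<^sup>2) - \<Delta> x * \<bar>v x\<bar> powr (p + 1))"
  proof (rule integral_eq_AE)
    show "integrable lebesgue (\<lambda>x. ((g x)\<^sup>2 + U x * (v x)\<^sup>2) - \<Delta> x * \<bar>v x\<bar> powr (p + 1))"
      by (intro Bochner_Integration.integrable_diff i)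
    show "AE x in lebesgue. ((g x)\<^sup>2 + U x * (v x)\<^sup>2) - \<Delta> x * \<bar>v x\<bar> powr (p + 1) =
       \<bar>weak_deriv u x\<bar>\<^sup>2 + (V x - lam) * (u x)\<^sup>2 - \<Gamma> x * \<bar>u x\<bar> powr (p + 1)"
      using uv ug VU GD by eventually_elim simp
  qed
  also have "\<dots> = qform U v g - nlin \<Delta> (p + 1) v"
    unfolding qform_def nlin_def by (rule Bochner_Integration.integral_diff[OF i])
  finally show "(LINT x|lebesgue. \<bar>weak_deriv u x\<bar>\<^sup>2 + (V x - lam) * (u x)\<^sup>2 - \<Gamma> x * \<bar>u x\<bar> powr (p + 1)) = qform U v g - nlin \<Delta> (p + 1) v" .
qed

text \<open>On the Nehari manifold the form equals the nonlinear term \<open>q\<close>, so the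
  energy is \<open>(1/2 - 1/r) q\<close>. The inequality \<open>q \<le> S q^(r/2)\<close> bounds
  \<open>q\<close> from below, and the scaled maximizer attains this bound.\<close>

lemma maximizer_imp_ground_state:
  assumes U: "bdd_by K U" and G: "bdd_by M \<Delta>" and p: "1 < p"
    and VU: "AE x in lebesgue. V x - lam = U x" and GD: "AE x in lebesgue. \<Gamma> x = \<Delta> x"
    and d0: "0 < \<delta>" and d: "\<And>u g. H1pair u g \<Longrightarrow> \<delta> * ((LINT x|lebesgue. (u x)\<^sup>2) + (LINT x|lebesgue. (g x)\<^sup>2)) \<le> qform U u g"
    and S0: "0 < S" and S: "\<And>u g. H1pair u g \<Longrightarrow> nlin \<Delta> (p + 1) u \<le> S * qform U u g powr ((p + 1) / 2)"
    and w: "H1pair w h" "qform U w h = 1" "nlin \<Delta> (p + 1) w = S"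
  shows "\<exists>u. strong_ground_state V \<Gamma> lam p u"
proof -
  define r where "r = p + 1"
  have r: "2 < r" using p by (simp add: r_def)
  \<comment> \<open>The solution of \<open>c^2 = S c^r\<close>, which places \<open>c\<close> times
    the maximizer on the Nehari manifold.\<close>
  define c where "c = (1 / S) powr (1 / (r - 2))"
  have c0: "0 < c" unfolding c_def powr_gt_zero using S0 by simp
  have cr: "c powr (r - 2) = 1 / S"
  proof -
    have "c powr (r - 2) = (1 / S) powr 1" unfolding c_def powr_powr using r by simp
    then show ?thesis using S0 by simp
  qed
  define u where "u x = c * w x" for x
  define g where "g x = c * h x" for x
  have uH: "H1pair u g" unfolding u_def g_def by (rule H1pair_cmult[OF w(1)])
  have uq: "qform U u g = c\<^sup>2" unfolding u_def g_def by (simp add: qform_cmult w(2))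
  have un: "nlin \<Delta> r u = c\<^sup>2"
  proof -
    have "c powr r = c powr (r - 2) * c powr 2" by (subst powr_add[symmetric]) simp
    also have "\<dots> = c\<^sup>2 / S" using c0 by (simp add: cr)
    finally have "c powr r = c\<^sup>2 / S" .
    then show ?thesis unfolding u_def using c0 S0 w(3) by (simp add: nlin_cmult r_def)
  qed
  have uH1: "u \<in> H1" by (rule H1pair_imp_H1[OF uH])
  have dd: "AE x in lebesgue. weak_deriv u x = g x"
    by (rule weak_deriv_unique[OF has_weak_deriv_weak_deriv[OF uH1] primitive_imp_weak_deriv[OF H1pairD(1)[OF uH]]]) simp
  note F = energy_nehari_forms[OF uH U G p AE_I2 dd VU GD, OF refl]
  have nz: "\<not> (AE x in lebesgue. u x = 0)"
  proof
    assume "AE x in lebesgue. u x = 0"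
    then have "u = (\<lambda>x. 0)" by (intro continuous_AE_eq H1pairD(8)[OF uH]) auto
    then have "nlin \<Delta> r u = 0" by (simp add: nlin_def)
    then show False using un c0 by simp
  qed
  have uN: "u \<in> nehari V \<Gamma> lam p"
    unfolding nehari_def using uH1 nz F(2) uq un by (simp add: r_def)
  have ue: "energy V \<Gamma> lam p u = (1/2 - 1/r) * c\<^sup>2"
    unfolding F(1) using uq un by (simp add: r_def algebra_simps)
  have "energy V \<Gamma> lam p u \<le> energy V \<Gamma> lam p v" if v: "v \<in> nehari V \<Gamma> lam p" for v
  proof -
    have vH1: "v \<in> H1" and vnz: "\<not> (AE x in lebesgue. v x = 0)" using v by (auto simp: nehari_def)
    obtain v1 where v1: "H1pair v1 (weak_deriv v)" "AE x in lebesgue. v x = v1 x" using H1_imp_H1pair[OF vH1] by blast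
    note Fv = energy_nehari_forms[OF v1(1) U G p v1(2) AE_I2 VU GD, OF refl]
    let ?q = "qform U v1 (weak_deriv v)"
    have eq: "?q = nlin \<Delta> r v1" using v Fv(2) by (simp add: nehari_def r_def)
    have "\<exists>x. v1 x \<noteq> 0"
    proof (rule ccontr)
      assume "\<not> ?thesis"
      then have "AE x in lebesgue. v x = 0" using v1(2) by simp
      then show False using vnz by blast
    qed
    then obtain x where "v1 x \<noteq> 0" by blast
    from H1pair_integral_pos[OF v1(1) this] have "0 < (LINT x|lebesgue. (v1 x)\<^sup>2)" .
    moreover have "0 \<le> (LINT x|lebesgue. (weak_deriv v x)\<^sup>2)" by simp
    ultimately have "0 < \<delta> * ((LINT x|lebesgue. (v1 x)\<^sup>2) + (LINT x|lebesgue. (weak_deriv v x)\<^sup>2))"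
      using d0 by (intro mult_pos_pos) linarith+
    then have q0: "0 < ?q" using d[OF v1(1)] by linarith
    have "?q \<le> S * ?q powr (r / 2)" using S[OF v1(1)] eq by (simp add: r_def)
    also have "?q powr (r / 2) = ?q powr ((r - 2) / 2) * ?q"
    proof -
      have "?q powr (r / 2) = ?q powr ((r - 2) / 2 + 1)" by (simp add: diff_divide_distrib)
      then show ?thesis using q0 by (simp add: powr_add)
    qed
    finally have "1 * ?q \<le> (S * ?q powr ((r - 2) / 2)) * ?q" by (simp add: mult.assoc)
    then have "1 \<le> S * ?q powr ((r - 2) / 2)" using q0 by (rule mult_right_le_imp_le)
    then have "1 / S \<le> ?q powr ((r - 2) / 2)" using S0 by (simp add: pos_divide_le_eq mult.commute)
    moreover have "1 / S = (c\<^sup>2) powr ((r - 2) / 2)"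
    proof -
      have "c\<^sup>2 = c powr 2" using c0 by simp
      then have "(c\<^sup>2) powr ((r - 2) / 2) = c powr (2 * ((r - 2) / 2))" by (simp only: powr_powr)
      moreover have "2 * ((r - 2) / 2) = r - 2" by simp
      ultimately show ?thesis by (simp only: cr)
    qed
    ultimately have "c\<^sup>2 \<le> ?q"
      using powr_less_mono2[of "(r - 2) / 2" ?q "c\<^sup>2"] r q0 by fastforce
    moreover have "0 \<le> 1/2 - 1/r" using r by (simp add: field_simps)
    ultimately have "(1/2 - 1/r) * c\<^sup>2 \<le> (1/2 - 1/r) * ?q" by (rule mult_left_mono)
    moreover have "energy V \<Gamma> lam p v = (1/2 - 1/r) * ?q"
      unfolding Fv(1) using eq by (simp add: r_def algebra_simps)
    ultimately show ?thesis using ue by simp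
  qed
  then show ?thesis using uN unfolding strong_ground_state_def by blast
qed

text \<open>Truncation at an essential bound keeps measurability and periodicity. The bound is given
  for all larger constants so that two coefficients can share one.\<close>

lemma Linf_periodic_representative:
  assumes f: "f \<in> Linf" and p: "periodic_fun_simple' f"
  shows "\<exists>C f'. (\<forall>K\<ge>C. bdd_by K f') \<and> (AE x in lebesgue. f x = f' x) \<and> (\<forall>x k. f' (x + real_of_int k) = f' x)"
proof -
  from f obtain C where fm: "f \<in> borel_measurable lebesgue" and C: "AE x in lebesgue. \<bar>f x\<bar> \<le> C" by (auto simp: Linf_def)
  define f' where "f' x = max (- \<bar>C\<bar>) (min \<bar>C\<bar> (f x))" for x
  interpret periodic_fun_simple' f by (rule p)
  have "f' \<in> borel_measurable lebesgue" unfolding f'_def using fm by measurable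
  moreover have "\<bar>f' x\<bar> \<le> \<bar>C\<bar>" for x by (auto simp: f'_def)
  ultimately have "\<forall>K\<ge>\<bar>C\<bar>. bdd_by K f'" by (meson bdd_by_def order_trans)
  moreover have "AE x in lebesgue. f x = f' x" using C by eventually_elim (auto simp: f'_def)
  moreover have "f' (x + real_of_int k) = f' x" for x k by (simp add: f'_def plus_of_int)
  ultimately show ?thesis by blast
qed

lemma bdd_by_interface:
  assumes "bdd_by K f" "bdd_by K g" shows "bdd_by K (interface f g)"
  unfolding bdd_by_def
proof
  have "(\<lambda>x. if 0 \<le> x then f x else g x) \<in> borel_measurable lebesgue"
    using assms by measurable
  then show "interface f g \<in> borel_measurable lebesgue" by (simp add: interface_def[abs_def])
  show "\<forall>x. \<bar>interface f g x\<bar> \<le> K" using assms by (simp add: interface_def bdd_by_abs)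
qed

text \<open>By periodicity a sign condition on the right half-line spreads over the line through
  countably many integer translations, and would contradict the positive essential supremum.\<close>

lemma interface_not_nonpos:
  assumes G: "\<Gamma> \<in> borel_measurable lebesgue" and es: "esssup lebesgue (\<lambda>x. ereal (\<Gamma> x)) > 0"
    and ae: "AE x in lebesgue. \<Gamma> x = \<Gamma>1 x" and p: "\<And>x k. \<Gamma>1 (x + real_of_int k) = \<Gamma>1 x"
    and I: "\<And>x. 0 < x \<Longrightarrow> \<Delta> x = \<Gamma>1 x"
  shows "\<not> (AE x in lebesgue. \<Delta> x \<le> 0)"
proof
  assume a: "AE x in lebesgue. \<Delta> x \<le> 0"
  have "AE x in lebesgue. \<forall>n::nat. \<Delta> (x + real n) \<le> 0"
    unfolding AE_all_countable by (intro allI AE_shift a)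
  with ae have "AE x in lebesgue. ereal (\<Gamma> x) \<le> 0"
  proof eventually_elim
    case (elim x)
    obtain n where n: "- x < real n" using reals_Archimedean2 by blast
    have "\<Gamma>1 x = \<Gamma>1 (x + real n)" using p[of x "int n"] by simp
    also have "\<dots> = \<Delta> (x + real n)" by (rule I[symmetric]) (use n in linarith)
    also have "\<dots> \<le> 0" using elim by blast
    finally show ?case using elim by simp
  qed
  then have "esssup lebesgue (\<lambda>x. ereal (\<Gamma> x)) \<le> 0"
    by (intro esssup_I) (use G in measurable)
  then show False using es by simp
qed

theorem corollary2:
  fixes V\<^sub>1 V\<^sub>2 u\<^sub>1 u\<^sub>2 :: "real \<Rightarrow> real" and lam \<kappa>\<^sub>1 \<kappa>\<^sub>2 :: real
  assumes "V\<^sub>1 \<in> Linf" and "periodic_fun_simple' V\<^sub>1"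
    and "V\<^sub>2 \<in> Linf" and "periodic_fun_simple' V\<^sub>2"
    and "\<forall>z \<in> schroedinger_spectrum (interface V\<^sub>1 V\<^sub>2). lam < Re z"
    and "\<kappa>\<^sub>1 > 0" and "bloch_mode V\<^sub>1 lam \<kappa>\<^sub>1 u\<^sub>1"
    and "\<kappa>\<^sub>2 > 0" and "bloch_mode V\<^sub>2 lam (- \<kappa>\<^sub>2) u\<^sub>2"
    and "(LINT x:{-1..0}|lebesgue. (V\<^sub>2 x - V\<^sub>1 x) * (u\<^sub>1 x)\<^sup>2) < 0"
    and "(LINT x:{0..1}|lebesgue. (V\<^sub>1 x - V\<^sub>2 x) * (u\<^sub>2 x)\<^sup>2) < 0"
  shows "\<forall>\<Gamma>\<^sub>1 \<Gamma>\<^sub>2 p.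
    \<Gamma>\<^sub>1 \<in> Linf \<and> periodic_fun_simple' \<Gamma>\<^sub>1 \<and> esssup lebesgue (\<lambda>x. ereal (\<Gamma>\<^sub>1 x)) > 0 \<and>
    \<Gamma>\<^sub>2 \<in> Linf \<and> periodic_fun_simple' \<Gamma>\<^sub>2 \<and> esssup lebesgue (\<lambda>x. ereal (\<Gamma>\<^sub>2 x)) > 0 \<and>
    1 < p \<longrightarrow>
    (\<exists>u. strong_ground_state (interface V\<^sub>1 V\<^sub>2) (interface \<Gamma>\<^sub>1 \<Gamma>\<^sub>2) lam p u)"
proof (intro allI impI, elim conjE)
  fix \<Gamma>\<^sub>1 \<Gamma>\<^sub>2 :: "real \<Rightarrow> real" and p :: real
  assume G1: "\<Gamma>\<^sub>1 \<in> Linf" "periodic_fun_simple' \<Gamma>\<^sub>1" and es1: "esssup lebesgue (\<lambda>x. ereal (\<Gamma>\<^sub>1 x)) > 0"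
    and G2: "\<Gamma>\<^sub>2 \<in> Linf" "periodic_fun_simple' \<Gamma>\<^sub>2" and p: "1 < p"
  note V1 = assms(1,2) and V2 = assms(3,4) and spec = assms(5) and k1 = assms(6) and b1 = assms(7)
    and k2 = assms(8) and b2 = assms(9) and I1 = assms(10) and I2 = assms(11)
  obtain C1 W1 where W1: "\<forall>K\<ge>C1. bdd_by K W1" "AE x in lebesgue. V\<^sub>1 x = W1 x" "\<forall>x k. W1 (x + real_of_int k) = W1 x"
    using Linf_periodic_representative[OF V1] by blast
  obtain C2 W2 where W2: "\<forall>K\<ge>C2. bdd_by K W2" "AE x in lebesgue. V\<^sub>2 x = W2 x" "\<forall>x k. W2 (x + real_of_int k) = W2 x"
    using Linf_periodic_representative[OF V2] by blast
  obtain D1 \<Delta>1 where D1: "\<forall>K\<ge>D1. bdd_by K \<Delta>1" "AE x in lebesgue. \<Gamma>\<^sub>1 x = \<Delta>1 x" "\<forall>x k. \<Delta>1 (x + real_of_int k) = \<Delta>1 x"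
    using Linf_periodic_representative[OF G1] by blast
  obtain D2 \<Delta>2 where D2: "\<forall>K\<ge>D2. bdd_by K \<Delta>2" "AE x in lebesgue. \<Gamma>\<^sub>2 x = \<Delta>2 x" "\<forall>x k. \<Delta>2 (x + real_of_int k) = \<Delta>2 x"
    using Linf_periodic_representative[OF G2] by blast
  define K0 where "K0 = max C1 C2"
  define M where "M = max D1 D2"
  have Wb: "bdd_by K0 W1" "bdd_by K0 W2" using W1(1) W2(1) by (simp_all add: K0_def)
  have Db: "bdd_by M \<Delta>1" "bdd_by M \<Delta>2" using D1(1) D2(1) by (simp_all add: M_def)
  define W where "W = interface W1 W2"
  define \<Delta> where "\<Delta> = interface \<Delta>1 \<Delta>2"
  have WB: "bdd_by K0 W" unfolding W_def by (rule bdd_by_interface[OF Wb])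
  have DB: "bdd_by M \<Delta>" unfolding \<Delta>_def by (rule bdd_by_interface[OF Db])
  have WV: "AE x in lebesgue. W x = interface V\<^sub>1 V\<^sub>2 x"
    using W1(2) W2(2) by eventually_elim (simp add: W_def interface_def)
  then have VW: "AE x in lebesgue. interface V\<^sub>1 V\<^sub>2 x = W x" by eventually_elim simp
  have DG: "AE x in lebesgue. interface \<Gamma>\<^sub>1 \<Gamma>\<^sub>2 x = \<Delta> x"
    using D1(2) D2(2) by eventually_elim (simp add: \<Delta>_def interface_def)
  define K where "K = K0 + \<bar>lam\<bar>"
  define U where "U x = W x - lam" for x
  define U1 where "U1 x = W1 x - lam" for x
  define U2 where "U2 x = W2 x - lam" for x
  have UB: "bdd_by K U" "bdd_by K U1" "bdd_by K U2"
    unfolding U_def[abs_def] U1_def[abs_def] U2_def[abs_def] K_def by (intro bdd_by_diff bdd_by_const WB Wb)+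
  obtain \<delta> where d0: "0 < \<delta>" and d': "\<forall>u g. H1pair u g \<longrightarrow>
    \<delta> * ((LINT x|lebesgue. (u x)\<^sup>2) + (LINT x|lebesgue. (g x)\<^sup>2)) \<le> qform (\<lambda>x. W x - lam) u g"
    using coercive_below_spectrum[OF spec WB VW] by blast
  have d: "\<delta> * ((LINT x|lebesgue. (u x)\<^sup>2) + (LINT x|lebesgue. (g x)\<^sup>2)) \<le> qform U u g" if "H1pair u g" for u g
    using d' that by (simp add: U_def[abs_def])
  define r where "r = p + 1"
  have r: "2 < r" using p by (simp add: r_def)
  have Upos: "U x = U1 x" "\<Delta> x = \<Delta>1 x" if "0 < x" for x using that by (simp_all add: U_def U1_def W_def \<Delta>_def interface_def)
  have Uneg: "U x = U2 x" "\<Delta> x = \<Delta>2 x" if "x < 0" for x using that by (simp_all add: U_def U2_def W_def \<Delta>_def interface_def)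
  have pU: "U1 (x + real_of_int k) = U1 x" "U2 (x + real_of_int k) = U2 x"
    and pD: "\<Delta>1 (x + real_of_int k) = \<Delta>1 x" "\<Delta>2 (x + real_of_int k) = \<Delta>2 x" for x k
    using W1(3) W2(3) D1(3) D2(3) by (simp_all add: U1_def U2_def)
  have "\<not> (AE x in lebesgue. \<Delta> x \<le> 0)"
    using G1(1) by (intro interface_not_nonpos[OF _ es1 D1(2) pD(1) Upos(2)]) (simp add: Linf_def)
  from nlin_positive_exists[OF DB this r]
  obtain S where S0: "0 < S" and S': "\<forall>u g. H1pair u g \<longrightarrow> nlin \<Delta> r u \<le> S * qform U u g powr (r / 2)"
    and max: "\<exists>w h. H1pair w h \<and> ((qform U w h = 1 \<and> nlin \<Delta> r w = S) \<or> (qform U1 w h = 1 \<and> nlin \<Delta>1 r w = S) \<or>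
      (qform U2 w h = 1 \<and> nlin \<Delta>2 r w = S))"
    using maximizer_dichotomy[OF UB(1) Upos(1) Uneg(1) pU DB Upos(2) Uneg(2) pD d0 d r] by blast
  have S: "nlin \<Delta> r u \<le> S * qform U u g powr (r / 2)" if "H1pair u g" for u g using S' that by blast
  have "\<exists>w h. H1pair w h \<and> qform U w h = 1 \<and> nlin \<Delta> r w = S"
    using max
  proof (elim exE conjE disjE)
    \<comment> \<open>The sequence has escaped to the right; the interface then lies far to the left
      of the profile.\<close>
    fix w h assume w: "H1pair w h" "qform U1 w h = 1" "nlin \<Delta>1 r w = S"
    have VU: "AE x in lebesgue. V\<^sub>1 x - lam = U1 x" using W1(2) by eventually_elim (simp add: U1_def)
    obtain b b' where b: "primitive b b'" "primitive b' (\<lambda>x. U1 x * b x)" "\<forall>x. b (x + 1) = exp \<kappa>\<^sub>1 * b x"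
      "\<forall>x. b' (x + 1) = exp \<kappa>\<^sub>1 * b' x" "\<exists>x. b x \<noteq> 0" "AE x in lebesgue. u\<^sub>1 x = b x"
      using bloch_representative[OF b1 UB(2) VU] by blast
    have bl: "locally_integrable (\<lambda>x. (b x)\<^sup>2)"
      by (intro locally_integrable_continuous continuous_intros primitive_continuous[OF b(1)])
    have i: "integrable lebesgue (\<lambda>x. (U2 x - U1 x) * (indicator {-1..0} x * (b x)\<^sup>2))"
    proof (rule bdd_mult_integrable[OF bdd_by_diff[OF UB(3) UB(2)]])
      show "integrable lebesgue (\<lambda>x. indicator {-1..0} x * (b x)\<^sup>2)"
        using bl by (simp add: locally_integrable_def set_integrable_def)
    qed
    have "(LINT x:{-1..0}|lebesgue. (V\<^sub>2 x - V\<^sub>1 x) * (u\<^sub>1 x)\<^sup>2) = (LINT x|lebesgue. (U2 x - U1 x) * (indicator {-1..0} x * (b x)\<^sup>2))"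
      unfolding set_lebesgue_integral_def
      by (rule integral_eq_AE[OF i]) (use W1(2) W2(2) b(6) in \<open>eventually_elim, simp add: U1_def U2_def\<close>)
    then have neg: "(LINT x:{-1..0}|lebesgue. (U2 x - U1 x) * (b x)\<^sup>2) < 0"
      using I1 by (simp add: set_lebesgue_integral_def mult.left_commute)
    show ?thesis
      using tail_replacement[OF UB Upos(1) Uneg(1) pU DB Db(1) Upos(2) pD(1) d0 d r S0 S b(1,2) b(3)[rule_format] b(4)[rule_format] k1 b(5) neg w] .
  next
    \<comment> \<open>The reflection at 0 reduces this to the previous situation: it exchanges the
      half-lines, turns the mode decaying at plus infinity into one decaying at minus infinity, and
      moves the period of integration from \<open>{0..1}\<close> to \<open>{-1..0}\<close>.\<close>
    fix w h assume w: "H1pair w h" "qform U2 w h = 1" "nlin \<Delta>2 r w = S"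
    have VU: "AE x in lebesgue. V\<^sub>2 x - lam = U2 x" using W2(2) by eventually_elim (simp add: U2_def)
    obtain b b' where b: "primitive b b'" "primitive b' (\<lambda>x. U2 x * b x)" "\<forall>x. b (x + 1) = exp (- \<kappa>\<^sub>2) * b x"
      "\<forall>x. b' (x + 1) = exp (- \<kappa>\<^sub>2) * b' x" "\<exists>x. b x \<noteq> 0" "AE x in lebesgue. u\<^sub>2 x = b x"
      using bloch_representative[OF b2 UB(3) VU] by blast
    have bl: "locally_integrable (\<lambda>x. (b x)\<^sup>2)"
      by (intro locally_integrable_continuous continuous_intros primitive_continuous[OF b(1)])
    have i: "integrable lebesgue (\<lambda>x. (U1 x - U2 x) * (indicator {0..1} x * (b x)\<^sup>2))"
    proof (rule bdd_mult_integrable[OF bdd_by_diff[OF UB(2) UB(3)]])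
      show "integrable lebesgue (\<lambda>x. indicator {0..1} x * (b x)\<^sup>2)"
        using bl by (simp add: locally_integrable_def set_integrable_def)
    qed
    have "(LINT x:{0..1}|lebesgue. (V\<^sub>1 x - V\<^sub>2 x) * (u\<^sub>2 x)\<^sup>2) = (LINT x|lebesgue. (U1 x - U2 x) * (indicator {0..1} x * (b x)\<^sup>2))"
      unfolding set_lebesgue_integral_def
      by (rule integral_eq_AE[OF i]) (use W1(2) W2(2) b(6) in \<open>eventually_elim, simp add: U1_def U2_def\<close>)
    also have "\<dots> = (LINT x|lebesgue. (U1 (- x) - U2 (- x)) * (indicator {0..1} (- x) * (b (- x))\<^sup>2))"
      using integral_reflect[of "\<lambda>x. (U1 x - U2 x) * (indicator {0..1} x * (b x)\<^sup>2)"] by simp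
    also have "\<dots> = (LINT x:{-1..0}|lebesgue. (U1 (- x) - U2 (- x)) * (b (- x))\<^sup>2)"
      unfolding set_lebesgue_integral_def by (rule Bochner_Integration.integral_cong) (auto simp: indicator_def)
    finally have neg: "(LINT x:{-1..0}|lebesgue. (U1 (- x) - U2 (- x)) * (b (- x))\<^sup>2) < 0"
      using I2 by simp
    have br: "primitive (\<lambda>x. b (- x)) (\<lambda>x. - b' (- x))" "primitive (\<lambda>x. - b' (- x)) (\<lambda>x. U2 (- x) * b (- x))"
      using primitive_reflect[OF b(1)] primitive_cmult[OF primitive_reflect[OF b(2)], of "-1"] by simp_all
    \<comment> \<open>Reflection reverses the direction of the unit step, so the multiplier is
      inverted.\<close>
    have flo: "f (- (x + 1)) = exp \<kappa>\<^sub>2 * f (- x)" if "\<forall>x. f (x + 1) = exp (- \<kappa>\<^sub>2) * f x" for f :: "real \<Rightarrow> real" and x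
      using that[rule_format, of "- (x + 1)"] by (simp add: exp_minus field_simps)
    have per: "b (- (x + 1)) = exp \<kappa>\<^sub>2 * b (- x)" "- b' (- (x + 1)) = exp \<kappa>\<^sub>2 * - b' (- x)" for x
      using flo[OF b(3)] flo[OF b(4)] by simp_all
    have nz: "\<exists>x. b (- x) \<noteq> 0" using b(5) by (metis minus_minus)
    have pr: "f (- (x + real_of_int k)) = f (- x)" if "\<And>x k. f (x + real_of_int k) = f x" for f :: "real \<Rightarrow> real" and x k
      using that[of "- x" "- k"] by simp
    have unq: "qform (\<lambda>x. f (- x)) u g = qform f (\<lambda>x. u (- x)) (\<lambda>x. - g (- x))" for f u g
      using qform_reflect[of f "\<lambda>x. u (- x)" "\<lambda>x. - g (- x)"] by simp
    have unn: "nlin (\<lambda>x. f (- x)) r u = nlin f r (\<lambda>x. u (- x))" for f u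
      using nlin_reflect[of f r "\<lambda>x. u (- x)"] by simp
    have d_r: "\<delta> * ((LINT x|lebesgue. (u x)\<^sup>2) + (LINT x|lebesgue. (g x)\<^sup>2)) \<le> qform (\<lambda>x. U (- x)) u g" if "H1pair u g" for u g
      unfolding unq using d[OF H1pair_reflect[OF that]] integral_reflect[of "\<lambda>x. (u x)\<^sup>2"] integral_reflect[of "\<lambda>x. (g x)\<^sup>2"] by simp
    have S_r: "nlin (\<lambda>x. \<Delta> (- x)) r u \<le> S * qform (\<lambda>x. U (- x)) u g powr (r / 2)" if "H1pair u g" for u g
      unfolding unq unn by (rule S[OF H1pair_reflect[OF that]])
    have Ur: "U (- x) = U2 (- x)" "\<Delta> (- x) = \<Delta>2 (- x)" if "0 < x" for x using Uneg[of "- x"] that by simp_all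
    have Ul: "U (- x) = U1 (- x)" if "x < 0" for x using Upos(1)[of "- x"] that by simp
    have wq: "qform (\<lambda>x. U2 (- x)) (\<lambda>x. w (- x)) (\<lambda>x. - h (- x)) = 1" unfolding qform_reflect by (rule w(2))
    have wn: "nlin (\<lambda>x. \<Delta>2 (- x)) r (\<lambda>x. w (- x)) = S" unfolding nlin_reflect by (rule w(3))
    have "\<exists>w h. H1pair w h \<and> qform (\<lambda>x. U (- x)) w h = 1 \<and> nlin (\<lambda>x. \<Delta> (- x)) r w = S"
      by (rule tail_replacement[OF bdd_by_reflect[OF UB(1)] bdd_by_reflect[OF UB(3)] bdd_by_reflect[OF UB(2)]
          Ur(1) Ul pr[of U2, OF pU(2)] pr[of U1, OF pU(1)] bdd_by_reflect[OF DB] bdd_by_reflect[OF Db(2)] Ur(2) pr[of \<Delta>2, OF pD(2)]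
          d0 d_r r S0 S_r br per k2 nz neg H1pair_reflect[OF w(1)] wq wn])
    then obtain w h where w: "H1pair w h" "qform (\<lambda>x. U (- x)) w h = 1" "nlin (\<lambda>x. \<Delta> (- x)) r w = S" by blast
    then show ?thesis unfolding unq unn using H1pair_reflect[OF w(1)] by blast
  qed blast
  then obtain w h where w: "H1pair w h" "qform U w h = 1" "nlin \<Delta> r w = S" by blast
  have VU: "AE x in lebesgue. interface V\<^sub>1 V\<^sub>2 x - lam = U x" using VW by eventually_elim (simp add: U_def)
  show "\<exists>u. strong_ground_state (interface V\<^sub>1 V\<^sub>2) (interface \<Gamma>\<^sub>1 \<Gamma>\<^sub>2) lam p u"
    by (rule maximizer_imp_ground_state[OF UB(1) DB p VU DG d0 d S0 S[unfolded r_def] w[unfolded r_def]])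
qed

end
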